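(* Let $1<\gamma<n$ and $p,q>0$. (1) If $p>\frac{n(\gamma-1)}{n-\gamma}$, then $$-\Delta_\gamma u(x)=c(x)u^p(x),\quad x\in\mathbb{R}^n,$$ has positive solutions for some double bounded $c(x)$. If $0<p\le\frac{n(\gamma-1)}{n-\gamma}$, then for any double bounded $c(x)$ this equation has no positive solution satisfying $\inf_{\mathbb{R}^n}u=0$. (2) Consider the $\gamma$-Laplace system $$-\Delta_\gamma u(x)=c_1(x)v^q(x),\qquad -\Delta_\gamma v(x)=c_2(x)u^p(x),\qquad x\in\mathbb{R}^n.$$ If $pq>(\gamma-1)^2$ and $$\max\Big\{\frac{\gamma(q+\gamma-1)}{pq-(\gamma-1)^2},\ \frac{\gamma(p+\gamma-1)}{pq-(\gamma-1)^2}\Big\}<\frac{n-\gamma}{\gamma-1},$$ then there exist positive solutions $u,v$ of the system for some double bounded $c_1(x)$ and $c_2(x)$. On the contrary, for any double bounded functions $c_1(x)$ and $c_2(x)$, if one of the following conditions holds: (i) $0<pq\le(\gamma-1)^2$; (ii) $pq>(\gamma-1)^2$ and $$\max\Big\{\frac{\gamma(q+\gamma-1)}{pq-(\gamma-1)^2},\ \frac{\gamma(p+\gamma-1)}{pq-(\gamma-1)^2}\Big\}\ge\frac{n-\gamma}{\gamma-1},$$ then the system has no positive solutions $u,v$ satisfying $\inf_{\mathbb{R}^n}u=\inf_{\mathbb{R}^n}v=0$.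
   Context: $\Delta_\gamma u:=\operatorname{div}(|\nabla u|^{\gamma-2}\nabla u)$ is the $\gamma$-Laplacian. A function $c:\mathbb{R}^n\to\mathbb{R}$ is called double bounded if there is a constant $C>0$ such that $\frac1C\le c(x)\le C$ for all $x\in\mathbb{R}^n$. *)

theory Defs
  imports "HOL-Analysis.Analysis"
begin

definition double_bounded :: "(real^'n \<Rightarrow> real) \<Rightarrow> bool" where
  "double_bounded c \<longleftrightarrow> (\<exists>C>0. \<forall>x. 1 / C \<le> c x \<and> c x \<le> C)"

definition locally_integrable :: "(real^'n \<Rightarrow> 'b::euclidean_space) \<Rightarrow> bool" where
  "locally_integrable f \<longleftrightarrow> (\<forall>K. compact K \<longrightarrow> f absolutely_integrable_on K)"

(* phi is a compactly supported C^1 function and D is its gradient.  Everything tested below is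
   locally integrable, so by mollification C^infinity test functions would give the same notions. *)
definition test_function :: "(real^'n \<Rightarrow> real) \<Rightarrow> (real^'n \<Rightarrow> real^'n) \<Rightarrow> bool" where
  "test_function \<phi> D \<longleftrightarrow>
     (\<forall>x. GDERIV \<phi> x :> D x) \<and> continuous_on UNIV D \<and> compact (closure {x. \<phi> x \<noteq> 0})"

definition has_weak_gradient :: "(real^'n \<Rightarrow> real) \<Rightarrow> (real^'n \<Rightarrow> real^'n) \<Rightarrow> bool" where
  "has_weak_gradient u G \<longleftrightarrow>
     locally_integrable u \<and> locally_integrable G \<and>
     (\<forall>\<phi> D. test_function \<phi> D \<longrightarrow>
        (LINT x|lebesgue. u x *\<^sub>R D x) = - (LINT x|lebesgue. \<phi> x *\<^sub>R G x))"

(* Local integrability of g is what makes the coefficients c of the equations Lebesgue measurable. *)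
definition has_weak_divergence :: "(real^'n \<Rightarrow> real^'n) \<Rightarrow> (real^'n \<Rightarrow> real) \<Rightarrow> bool" where
  "has_weak_divergence F g \<longleftrightarrow>
     locally_integrable F \<and> locally_integrable g \<and>
     (\<forall>\<phi> D. test_function \<phi> D \<longrightarrow>
        (LINT x|lebesgue. F x \<bullet> D x) = - (LINT x|lebesgue. \<phi> x * g x))"

(* u lies in the local Sobolev space W^{1,gamma}, with weak gradient G *)
definition sobolev_loc :: "real \<Rightarrow> (real^'n \<Rightarrow> real) \<Rightarrow> (real^'n \<Rightarrow> real^'n) \<Rightarrow> bool" where
  "sobolev_loc \<gamma> u G \<longleftrightarrow>
     has_weak_gradient u G \<and>
     locally_integrable (\<lambda>x. \<bar>u x\<bar> powr \<gamma>) \<and>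
     locally_integrable (\<lambda>x. norm (G x) powr \<gamma>)"

(* The gamma-Laplacian of u, taken in the weak sense, is f.  Where G x = 0 the field is 0,
   also for gamma < 2, because 0 powr a = 0. *)
definition has_gamma_Laplacian :: "real \<Rightarrow> (real^'n \<Rightarrow> real) \<Rightarrow> (real^'n \<Rightarrow> real) \<Rightarrow> bool" where
  "has_gamma_Laplacian \<gamma> u f \<longleftrightarrow>
     (\<exists>G. sobolev_loc \<gamma> u G \<and>
          has_weak_divergence (\<lambda>x. (norm (G x) powr (\<gamma> - 2)) *\<^sub>R G x) f)"

(* u is a positive solution of - Delta_gamma u = f on R^n.  Solutions are weak solutions that
   are continuous, so that positivity and the infimum of u have their pointwise meaning. *)
definition positive_solution :: "real \<Rightarrow> (real^'n \<Rightarrow> real) \<Rightarrow> (real^'n \<Rightarrow> real) \<Rightarrow> bool" where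
  "positive_solution \<gamma> u f \<longleftrightarrow>
     continuous_on UNIV u \<and> (\<forall>x. 0 < u x) \<and> has_gamma_Laplacian \<gamma> u (\<lambda>x. - f x)"

end

theory Submission
  imports Defs
begin

text \<open>
  Nonexistence rests on comparison with radial functions. Let \<open>M\<close> and \<open>N\<close> be the minima of \<open>u\<close> and \<open>v\<close> over the ball of
  radius \<open>r\<close>, and \<open>a = (n - \<gamma>) / (\<gamma> - 1)\<close> the decay exponent of the fundamental solution. Since \<open>- \<Delta>\<^sub>\<gamma> u \<ge> 0\<close>, comparison
  with the fundamental solution shows that \<open>M\<close> decays at most like \<open>r powr (- a)\<close> (\<open>ball_min_ge_decay\<close>). Since
  \<open>- \<Delta>\<^sub>\<gamma> u\<close> is at least a constant times \<open>v powr q\<close>, comparison with the torsion function of the ball shows that \<open>M\<close> is at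
  least a constant times \<open>r powr (\<gamma> / (\<gamma> - 1)) * N powr (q / (\<gamma> - 1))\<close>, and symmetrically for \<open>N\<close>
  (\<open>ball_min_coupling\<close>). If \<open>p * q \<le> (\<gamma> - 1)\<^sup>2\<close>, the two inequalities together force \<open>M\<close> to grow without bound. If
  \<open>p * q > (\<gamma> - 1)\<^sup>2\<close>, they bound \<open>M\<close> from above by a power of \<open>r\<close>, and the condition on the exponents says that, after
  exchanging \<open>u\<close> and \<open>v\<close> if necessary, this power decays faster than \<open>r powr (- a)\<close> or, in the critical case, equally
  fast. In the critical case \<open>v powr q\<close> is so large that \<open>- \<Delta>\<^sub>\<gamma> u\<close> is at least a multiple of \<open>\<bar>x\<bar> powr (- n)\<close>, and this
  improves the lower bound for \<open>u\<close> by a power of the logarithm (\<open>logarithmic_lower_bound\<close>). Either way there is a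
  contradiction (\<open>no_positive_solution_pair\<close>).

  The comparison of a weak solution with an explicit \<open>C\<^sup>1\<close> function is \<open>weak_comparison_principle\<close>. Its proof tests
  both equations with the square of the positive part of a difference, formed with mollifications of the solution, and
  passes to the limit; this is where the convergence of mollifications in \<open>L\<^sup>\<gamma>\<close> is used.

  For existence, powers of \<open>1 + \<bar>x\<bar> powr (\<gamma> / (\<gamma> - 1))\<close> are \<open>C\<^sup>1\<close> functions whose \<open>\<gamma>\<close>-Laplacian can be computed by hand
  (\<open>profile_solves\<close>); below the decay rate of the fundamental solution it is comparable with a negative power of the
  same function, and the quotient is the coefficient.
\<close>

section \<open>Test functions and integration by parts\<close>

lemma continuous_on_gderiv:
  assumes "\<And>x. x \<in> A \<Longrightarrow> GDERIV f x :> D x"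
  shows "continuous_on A f"
  using assms unfolding gderiv_def
  by (auto intro!: continuous_at_imp_continuous_on has_derivative_continuous)

lemma test_function_off_support:
  assumes "test_function \<phi> D" "x \<notin> closure {x. \<phi> x \<noteq> 0}"
  shows "\<phi> x = 0" "D x = 0"
proof -
  show "\<phi> x = 0" using assms(2) closure_subset[of "{x. \<phi> x \<noteq> 0}"] by auto
  have "(\<phi> has_derivative (\<lambda>h. h \<bullet> D x)) (at x)"
    using assms(1) by (simp add: test_function_def gderiv_def)
  moreover have "(\<phi> has_derivative (\<lambda>h. 0)) (at x)"
    by (rule has_derivative_transform_within_open[OF has_derivative_const[of 0], of "- closure {x. \<phi> x \<noteq> 0}"])
       (use assms(2) closure_subset[of "{x. \<phi> x \<noteq> 0}"] in auto)
  ultimately have "(\<lambda>h. h \<bullet> D x) = (\<lambda>h. 0)" by (rule has_derivative_unique)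
  then have "D x \<bullet> D x = 0" by metis
  then show "D x = 0" by simp
qed

lemma test_function_continuous: "test_function \<phi> D \<Longrightarrow> continuous_on UNIV \<phi>"
  unfolding test_function_def gderiv_def
  by (metis continuous_at_imp_continuous_on has_derivative_continuous)

lemma continuous_compact_support_integral:
  fixes f :: "'a::euclidean_space \<Rightarrow> 'b::euclidean_space"
  assumes "continuous_on UNIV f" "\<And>x. x \<notin> cbox a b \<Longrightarrow> f x = 0"
  shows "integrable lebesgue f" "integral\<^sup>L lebesgue f = integral (cbox a b) f"
proof -
  have "f absolutely_integrable_on cbox a b"
    using assms(1) by (intro absolutely_integrable_continuous) (rule continuous_on_subset, auto)
  moreover have "(\<lambda>x. indicator (cbox a b) x *\<^sub>R f x) = f"
    using assms(2) by (auto simp: indicator_def)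
  ultimately show "integrable lebesgue f" "integral\<^sup>L lebesgue f = integral (cbox a b) f"
    using set_lebesgue_integral_eq_integral(2)[of "cbox a b" f]
    by (auto simp: set_integrable_def set_lebesgue_integral_def)
qed

lemma integral_lebesgue_translation:
  fixes f :: "'a::euclidean_space \<Rightarrow> 'b::euclidean_space"
  assumes "continuous_on UNIV f"
  shows "(LINT x|lebesgue. f (c + x)) = integral\<^sup>L lebesgue f"
proof -
  have m: "f \<in> borel_measurable borel"
    using assms by (rule borel_measurable_continuous_onI)
  have "continuous_on UNIV (\<lambda>x. f (c + x))"
    by (intro continuous_intros continuous_on_compose2[OF assms]) auto
  then have m2: "(\<lambda>x. f (c + x)) \<in> borel_measurable borel"
    by (rule borel_measurable_continuous_onI)
  have "integral\<^sup>L lborel f = integral\<^sup>L (distr lborel borel ((+) c)) f"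
    by (simp add: lborel_distr_plus)
  also have "\<dots> = (LINT x|lborel. f (c + x))"
    using m by (intro integral_distr) auto
  finally show ?thesis
    using m m2 by (simp add: integral_completion)
qed

lemma test_function_bounded_support:
  fixes \<phi> :: "real^'n \<Rightarrow> real"
  assumes "test_function \<phi> D"
  obtains R where "R > 0" "\<And>x. norm x > R \<Longrightarrow> \<phi> x = 0 \<and> D x = 0"
proof -
  have "bounded (closure {x. \<phi> x \<noteq> 0})"
    using assms compact_imp_bounded by (auto simp: test_function_def)
  then obtain R where R: "R > 0" "\<And>x. x \<in> closure {x. \<phi> x \<noteq> 0} \<Longrightarrow> norm x \<le> R"
    by (auto simp: bounded_pos)
  show ?thesis
    using that[of R] R test_function_off_support[OF assms] by (meson not_le)
qed

lemma norm_bounded_in_box: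
  fixes R :: real
  obtains a b :: "'a::euclidean_space" where "\<And>x. norm x \<le> R \<Longrightarrow> x \<in> cbox a b"
  using bounded_subset_cbox_symmetric[of "cball (0::'a) R"] bounded_cball
  by (metis mem_cball_0 subset_iff)

text \<open>The integral of \<open>\<psi>\<close> over \<open>\<real>\<^sup>n\<close> does not change when \<open>\<psi>\<close> is translated in the direction \<open>e\<close>; differentiating
  the translated integral under the integral sign gives the integral of the directional derivative.\<close>

lemma integral_gradient_test_function:
  fixes \<psi> :: "real^'n \<Rightarrow> real"
  assumes "test_function \<psi> E"
  shows "integrable lebesgue E" "integral\<^sup>L lebesgue E = 0"
proof -
  have cE: "continuous_on UNIV E" and dE: "\<And>x. (\<psi> has_derivative (\<lambda>h. h \<bullet> E x)) (at x)"
    using assms by (auto simp: test_function_def gderiv_def)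
  have cpsi: "continuous_on UNIV \<psi>" by (rule test_function_continuous[OF assms])
  obtain R where R: "R > 0" "\<And>x. norm x > R \<Longrightarrow> \<psi> x = 0 \<and> E x = 0"
    using test_function_bounded_support[OF assms] by blast
  obtain a0 b0 :: "real^'n" where ab0: "\<And>x. norm x \<le> R \<Longrightarrow> x \<in> cbox a0 b0"
    using norm_bounded_in_box by blast
  show intE: "integrable lebesgue E"
    by (rule continuous_compact_support_integral(1)[OF cE]) (use ab0 R not_le in blast)
  have "integral\<^sup>L lebesgue E \<bullet> e = 0" for e :: "real^'n"
  proof -
    obtain a b :: "real^'n" where ab: "\<And>x. norm x \<le> R + norm e \<Longrightarrow> x \<in> cbox a b"
      using norm_bounded_in_box by blast
    let ?F = "\<lambda>t. integral (cbox a b) (\<lambda>x. \<psi> (x + t *\<^sub>R e))"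
    have const: "?F t = integral\<^sup>L lebesgue \<psi>" if "t \<in> {-1..1}" for t
    proof -
      have "integral\<^sup>L lebesgue (\<lambda>x. \<psi> (x + t *\<^sub>R e)) = ?F t"
      proof (rule continuous_compact_support_integral(2))
        show "continuous_on UNIV (\<lambda>x. \<psi> (x + t *\<^sub>R e))"
          by (intro continuous_intros continuous_on_compose2[OF cpsi]) auto
        fix x assume "x \<notin> cbox a b"
        then have "norm x > R + norm e" using ab not_le by blast
        moreover have "norm x \<le> norm (x + t *\<^sub>R e) + norm (t *\<^sub>R e)"
          using norm_triangle_ineq4[of "x + t *\<^sub>R e" "t *\<^sub>R e"] by simp
        moreover have "norm (t *\<^sub>R e) \<le> norm e"
          using that mult_right_mono[of "\<bar>t\<bar>" 1 "norm e"] by auto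
        ultimately show "\<psi> (x + t *\<^sub>R e) = 0" using R(2)[of "x + t *\<^sub>R e"] by linarith
      qed
      then show ?thesis
        using integral_lebesgue_translation[OF cpsi, of "t *\<^sub>R e"] by (simp add: add.commute)
    qed
    have "(?F has_field_derivative integral (cbox a b) (\<lambda>x. E (x + 0 *\<^sub>R e) \<bullet> e)) (at 0 within {-1..1})"
    proof (rule leibniz_rule_field_derivative[where fx = "\<lambda>t x. E (x + t *\<^sub>R e) \<bullet> e"])
      fix t :: real and x :: "real^'n"
      have "((\<lambda>t. \<psi> (x + t *\<^sub>R e)) has_derivative (\<lambda>s. (s *\<^sub>R e) \<bullet> E (x + t *\<^sub>R e))) (at t)"
        by (rule has_derivative_compose[OF _ dE, of "\<lambda>t. x + t *\<^sub>R e" "\<lambda>s. s *\<^sub>R e"])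
           (auto intro!: derivative_eq_intros)
      then show "((\<lambda>t. \<psi> (x + t *\<^sub>R e)) has_field_derivative E (x + t *\<^sub>R e) \<bullet> e) (at t within {-1..1})"
        unfolding has_field_derivative_def
        by (rule has_derivative_eq_rhs[OF has_derivative_at_withinI]) (simp_all add: fun_eq_iff inner_commute)
    next
      fix t :: real
      show "(\<lambda>x. \<psi> (x + t *\<^sub>R e)) integrable_on cbox a b"
        by (intro integrable_continuous continuous_intros continuous_on_compose2[OF cpsi]) auto
    next
      show "continuous_on ({- 1..1} \<times> cbox a b) (\<lambda>(t, x). E (x + t *\<^sub>R e) \<bullet> e)"
        unfolding case_prod_unfold
        by (intro continuous_intros continuous_on_compose2[OF cE]) auto
    qed auto
    then have "(?F has_field_derivative integral (cbox a b) (\<lambda>x. E x \<bullet> e)) (at 0)"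
      by (subst (asm) at_within_interior) auto
    moreover have "(?F has_field_derivative 0) (at 0)"
      by (rule has_field_derivative_transform_within_open[of "\<lambda>_. integral\<^sup>L lebesgue \<psi>" _ _ "{-1<..<1}"])
         (auto simp: const)
    ultimately have z: "integral (cbox a b) (\<lambda>x. E x \<bullet> e) = 0"
      by (rule DERIV_unique)
    have "(LINT x|lebesgue. E x \<bullet> e) = integral (cbox a b) (\<lambda>x. E x \<bullet> e)"
    proof (rule continuous_compact_support_integral(2))
      show "continuous_on UNIV (\<lambda>x. E x \<bullet> e)" by (intro continuous_intros cE)
      fix x assume "x \<notin> cbox a b"
      then have "norm x > R" using ab[of x] not_le norm_ge_zero[of e] by (smt (verit))
      then show "E x \<bullet> e = 0" using R by simp
    qed
    with z intE show ?thesis by simp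
  qed
  then show "integral\<^sup>L lebesgue E = 0"
    by (metis inner_eq_zero_iff)
qed

text \<open>Only the values of \<open>s\<close> near the support of \<open>\<phi>\<close> matter, so \<open>s\<close> may be singular elsewhere, as the radial barriers
  are at the origin.\<close>

lemma test_function_mult_C1:
  fixes \<phi> s :: "real^'n \<Rightarrow> real"
  assumes \<phi>: "test_function \<phi> D"
    and \<Omega>: "open \<Omega>" "closure {x. \<phi> x \<noteq> 0} \<subseteq> \<Omega>"
    and s: "\<And>x. x \<in> \<Omega> \<Longrightarrow> GDERIV s x :> S x" "continuous_on \<Omega> S"
  shows "test_function (\<lambda>x. \<phi> x * s x) (\<lambda>x. s x *\<^sub>R D x + \<phi> x *\<^sub>R S x)"
proof -
  let ?K = "closure {x. \<phi> x \<noteq> 0}"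
  have un: "\<Omega> \<union> (- ?K) = UNIV" using \<Omega> by blast
  have off: "\<phi> x = 0" "D x = 0" if "x \<notin> ?K" for x
    using test_function_off_support[OF \<phi> that] by auto
  have "GDERIV (\<lambda>x. \<phi> x * s x) x :> s x *\<^sub>R D x + \<phi> x *\<^sub>R S x" for x
  proof (cases "x \<in> \<Omega>")
    case True
    then show ?thesis
      using \<phi> s(1)[OF True] unfolding test_function_def gderiv_def
      by (intro has_derivative_subst[OF has_derivative_mult, of \<phi> _ x s]) (auto simp: fun_eq_iff inner_add_right)
  next
    case False
    then have "x \<in> - ?K" using \<Omega> by blast
    have "((\<lambda>x. \<phi> x * s x) has_derivative (\<lambda>h. 0)) (at x)"
    proof (rule has_derivative_transform_within_open[OF has_derivative_const _ \<open>x \<in> - ?K\<close>])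
      fix y assume "y \<in> - ?K"
      then have "\<phi> y = 0" using off(1)[of y] by blast
      then show "0 = \<phi> y * s y" by simp
    qed (simp add: open_Compl)
    moreover have "\<phi> x = 0" "D x = 0" using off[of x] \<open>x \<in> - ?K\<close> by blast+
    ultimately show ?thesis by (simp add: gderiv_def)
  qed
  moreover have "continuous_on UNIV (\<lambda>x. s x *\<^sub>R D x + \<phi> x *\<^sub>R S x)"
  proof (subst un[symmetric], rule continuous_on_open_Un)
    have "continuous_on \<Omega> s"
      using s(1) by (rule continuous_on_gderiv)
    moreover have "continuous_on \<Omega> D" "continuous_on \<Omega> \<phi>"
      using \<phi> test_function_continuous[OF \<phi>] by (auto simp: test_function_def intro: continuous_on_subset)
    ultimately show "continuous_on \<Omega> (\<lambda>x. s x *\<^sub>R D x + \<phi> x *\<^sub>R S x)"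
      by (intro continuous_intros s)
    show "continuous_on (- ?K) (\<lambda>x. s x *\<^sub>R D x + \<phi> x *\<^sub>R S x)"
    proof (rule continuous_on_eq[OF continuous_on_const[of _ 0]])
      fix x assume "x \<in> - ?K"
      then have "\<phi> x = 0" "D x = 0" using off[of x] by blast+
      then show "0 = s x *\<^sub>R D x + \<phi> x *\<^sub>R S x" by simp
    qed
  qed (use \<Omega> in auto)
  moreover have "compact (closure {x. \<phi> x * s x \<noteq> 0})"
  proof (rule compact_closure[THEN iffD2], rule bounded_subset)
    show "bounded ?K" using \<phi> compact_imp_bounded by (auto simp: test_function_def)
    show "{x. \<phi> x * s x \<noteq> 0} \<subseteq> ?K" using closure_subset by fastforce
  qed
  ultimately show ?thesis by (simp add: test_function_def)
qed

lemma test_function_integrable: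
  fixes f :: "real^'n \<Rightarrow> 'b::euclidean_space"
  assumes "test_function \<phi> D" "open \<Omega>" "closure {x. \<phi> x \<noteq> 0} \<subseteq> \<Omega>"
    and "continuous_on \<Omega> f" and zero: "\<And>x. \<phi> x = 0 \<Longrightarrow> D x = 0 \<Longrightarrow> f x = 0"
  shows "integrable lebesgue f"
proof -
  let ?K = "closure {x. \<phi> x \<noteq> 0}"
  have off: "f x = 0" if "x \<notin> ?K" for x
    by (rule zero; rule test_function_off_support[OF assms(1) that])
  have "continuous_on (- ?K) f"
  proof (rule continuous_on_eq[OF continuous_on_const[of _ 0]])
    fix x assume "x \<in> - ?K"
    then show "0 = f x" using off[of x] by simp
  qed
  then have "continuous_on (\<Omega> \<union> (- ?K)) f"
    using assms(2,4) by (intro continuous_on_open_Un) (auto simp: open_Compl)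
  moreover have "\<Omega> \<union> (- ?K) = UNIV" using assms by blast
  ultimately have c: "continuous_on UNIV f" by simp
  have "bounded ?K" using assms(1) compact_imp_bounded by (auto simp: test_function_def)
  then obtain a where a: "?K \<subseteq> cbox (-a) a" using bounded_subset_cbox_symmetric by blast
  show ?thesis
    by (rule continuous_compact_support_integral(1)[OF c, of "-a" a]) (use a off in blast)
qed

lemma test_function_product_integrable:
  fixes f :: "real^'n \<Rightarrow> 'b::euclidean_space"
  assumes "test_function \<phi> D" "open \<Omega>" "closure {x. \<phi> x \<noteq> 0} \<subseteq> \<Omega>" "continuous_on \<Omega> f"
  shows "integrable lebesgue (\<lambda>x. \<phi> x *\<^sub>R f x)"
  by (rule test_function_integrable[OF assms(1-3)])
     (auto intro!: continuous_intros assms(4) continuous_on_subset[OF test_function_continuous[OF assms(1)]])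

lemma test_function_gradient_product_integrable:
  fixes s :: "real^'n \<Rightarrow> real" and F :: "real^'n \<Rightarrow> real^'n"
  assumes "test_function \<phi> D" "open \<Omega>" "closure {x. \<phi> x \<noteq> 0} \<subseteq> \<Omega>"
  shows "continuous_on \<Omega> s \<Longrightarrow> integrable lebesgue (\<lambda>x. s x *\<^sub>R D x)"
    and "continuous_on \<Omega> F \<Longrightarrow> integrable lebesgue (\<lambda>x. F x \<bullet> D x)"
proof -
  have "continuous_on \<Omega> D"
    using assms(1) by (auto simp: test_function_def intro: continuous_on_subset)
  then show "continuous_on \<Omega> s \<Longrightarrow> integrable lebesgue (\<lambda>x. s x *\<^sub>R D x)"
    and "continuous_on \<Omega> F \<Longrightarrow> integrable lebesgue (\<lambda>x. F x \<bullet> D x)"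
    by (auto intro!: test_function_integrable[OF assms] continuous_intros)
qed

text \<open>All vector fields that occur below as \<open>\<bar>\<nabla>w\<bar> powr (\<gamma> - 2) *\<^sub>R \<nabla>w\<close> for an explicit radial \<open>w\<close> have the form
  \<open>s x *\<^sub>R x\<close>, and these are the fields whose smoothness is easy to see.\<close>

lemma integral_by_parts_radial_field:
  fixes \<phi> s :: "real^'n \<Rightarrow> real"
  assumes \<phi>: "test_function \<phi> D"
    and \<Omega>: "open \<Omega>" "closure {x. \<phi> x \<noteq> 0} \<subseteq> \<Omega>"
    and s: "\<And>x. x \<in> \<Omega> \<Longrightarrow> GDERIV s x :> S x" "continuous_on \<Omega> S"
  shows "(LINT x|lebesgue. (s x *\<^sub>R x) \<bullet> D x)
       = - (LINT x|lebesgue. \<phi> x * (real CARD('n) * s x + S x \<bullet> x))"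
proof -
  let ?E = "\<lambda>i x. (s x * x $ i) *\<^sub>R D x + \<phi> x *\<^sub>R ((x $ i) *\<^sub>R S x + s x *\<^sub>R axis i 1)"
  have cs: "continuous_on \<Omega> s"
    using s(1) by (rule continuous_on_gderiv)
  have E: "integrable lebesgue (?E i)" "integral\<^sup>L lebesgue (?E i) = 0" for i
  proof -
    have "test_function (\<lambda>x. \<phi> x * (s x * x $ i)) (?E i)"
    proof (rule test_function_mult_C1[OF \<phi> \<Omega>])
      fix x assume "x \<in> \<Omega>"
      have "((\<lambda>x. x $ i) has_derivative (\<lambda>h. h $ i)) (at x)"
        by (rule bounded_linear_imp_has_derivative[OF bounded_linear_vec_nth])
      with s(1)[OF \<open>x \<in> \<Omega>\<close>]
      show "GDERIV (\<lambda>x. s x * x $ i) x :> (x $ i) *\<^sub>R S x + s x *\<^sub>R axis i 1"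
        unfolding gderiv_def
        by (intro has_derivative_subst[OF has_derivative_mult, of s _ x "\<lambda>x. x $ i"])
           (auto simp: fun_eq_iff inner_add_right inner_axis algebra_simps)
    next
      show "continuous_on \<Omega> (\<lambda>x. x $ i *\<^sub>R S x + s x *\<^sub>R axis i 1)"
        by (intro continuous_intros s cs)
    qed
    then show "integrable lebesgue (?E i)" "integral\<^sup>L lebesgue (?E i) = 0"
      by (rule integral_gradient_test_function)+
  qed
  have "(LINT x|lebesgue. (\<Sum>i\<in>UNIV. ?E i x \<bullet> axis i 1)) = 0"
    using E by (subst Bochner_Integration.integral_sum) (auto simp del: inner_axis)
  moreover have "(\<Sum>i\<in>UNIV. ?E i x \<bullet> axis i 1)
      = (s x *\<^sub>R x) \<bullet> D x + \<phi> x * (real CARD('n) * s x + S x \<bullet> x)" for x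
  proof -
    have "?E i x \<bullet> axis i 1 = s x * (x $ i * D x $ i) + \<phi> x * (S x $ i * x $ i) + \<phi> x * s x" for i
      unfolding inner_axis by (simp add: axis_def algebra_simps)
    then have "(\<Sum>i\<in>UNIV. ?E i x \<bullet> axis i 1)
        = (\<Sum>i\<in>UNIV. s x * (x $ i * D x $ i) + \<phi> x * (S x $ i * x $ i) + \<phi> x * s x)"
      by (rule sum.cong[OF refl])
    then show ?thesis
      by (simp add: inner_vec_def sum.distrib sum_distrib_left algebra_simps)
  qed
  moreover have "integrable lebesgue (\<lambda>x. (s x *\<^sub>R x) \<bullet> D x)"
    by (rule test_function_gradient_product_integrable(2)[OF \<phi> \<Omega>]) (intro continuous_intros cs)
  moreover have "integrable lebesgue (\<lambda>x. \<phi> x *\<^sub>R (real CARD('n) * s x + S x \<bullet> x))"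
    by (rule test_function_product_integrable[OF \<phi> \<Omega>]) (intro continuous_intros cs s)
  ultimately show ?thesis by simp
qed

section \<open>Mollification\<close>

lemma continuous_lebesgue_measurable:
  fixes f :: "'a::euclidean_space \<Rightarrow> 'b::euclidean_space"
  assumes "continuous_on UNIV f"
  shows "f \<in> borel_measurable lebesgue"
  using borel_measurable_continuous_onI[OF assms] by (intro measurable_completion) simp

lemma locally_integrable_measurable:
  fixes f :: "real^'n \<Rightarrow> 'b::euclidean_space"
  assumes "locally_integrable f"
  shows "f \<in> borel_measurable lebesgue"
proof (rule borel_measurable_LIMSEQ_metric)
  fix i :: nat
  show "(\<lambda>x. indicat_real (cball 0 (real i)) x *\<^sub>R f x) \<in> borel_measurable lebesgue"
    using assms compact_cball[of 0 "real i"]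
    by (auto simp: locally_integrable_def set_integrable_def intro: borel_measurable_integrable)
next
  fix x :: "real^'n"
  obtain N :: nat where "norm x \<le> real N" using real_arch_simple by blast
  then have "eventually (\<lambda>i. indicat_real (cball 0 (real i)) x *\<^sub>R f x = f x) sequentially"
    unfolding eventually_sequentially by (intro exI[of _ N]) (auto simp: indicator_def)
  then show "(\<lambda>i. indicat_real (cball 0 (real i)) x *\<^sub>R f x) \<longlonglongrightarrow> f x"
    by (rule tendsto_eventually)
qed

lemma locally_integrable_continuous:
  fixes f :: "real^'n \<Rightarrow> 'b::euclidean_space"
  assumes "continuous_on UNIV f"
  shows "locally_integrable f"
  unfolding locally_integrable_def
proof (intro allI impI)
  fix K :: "(real^'n) set"
  assume K: "compact K"
  then obtain a where a: "K \<subseteq> cbox (-a) a"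
    using bounded_subset_cbox_symmetric compact_imp_bounded by blast
  have "f absolutely_integrable_on cbox (-a) a"
    by (rule absolutely_integrable_continuous[OF continuous_on_subset[OF assms]]) simp
  then show "f absolutely_integrable_on K"
    by (rule set_integrable_subset) (use a K in \<open>auto intro: lmeasurable_compact fmeasurableD\<close>)
qed

lemma integrable_bounded_times_locally_integrable:
  fixes f :: "real^'n \<Rightarrow> 'b::euclidean_space"
  assumes "locally_integrable f" "compact K" "c \<in> borel_measurable lebesgue"
    "\<And>x. x \<notin> K \<Longrightarrow> c x = 0" "\<And>x. \<bar>c x\<bar> \<le> B"
  shows "integrable lebesgue (\<lambda>x. c x *\<^sub>R f x)"
proof -
  have "integrable lebesgue (\<lambda>x. B *\<^sub>R (indicator K x *\<^sub>R f x))"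
    using assms(1,2) unfolding locally_integrable_def set_integrable_def
    by (intro integrable_scaleR_right) auto
  then show ?thesis
  proof (rule Bochner_Integration.integrable_bound)
    show "(\<lambda>x. c x *\<^sub>R f x) \<in> borel_measurable lebesgue"
      using assms(3) locally_integrable_measurable[OF assms(1)] by (rule borel_measurable_scaleR)
    have "norm (c x *\<^sub>R f x) \<le> norm (B *\<^sub>R (indicator K x *\<^sub>R f x))" for x
      using mult_right_mono[OF assms(5)[of x] norm_ge_zero[of "f x"]] assms(4)[of x]
        mult_right_mono[OF abs_ge_self[of B] norm_ge_zero[of "f x"]]
      by (cases "x \<in> K") auto
    then show "AE x in lebesgue. norm (c x *\<^sub>R f x) \<le> norm (B *\<^sub>R (indicator K x *\<^sub>R f x))" by simp
  qed
qed

lemma has_real_derivative_pos_part_square: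
  "((\<lambda>t::real. (max 0 t)\<^sup>2) has_real_derivative 2 * max 0 t) (at t)"
proof -
  consider "t < 0" | "t > 0" | "t = 0" by linarith
  then show ?thesis
  proof cases
    case 1
    then have "2 * max 0 t = 0" by simp
    show ?thesis unfolding \<open>2 * max 0 t = 0\<close>
      by (rule has_field_derivative_transform_within_open[OF DERIV_const[where k=0] open_lessThan[of 0]])
         (use 1 in auto)
  next
    case 2
    have "((\<lambda>t. t\<^sup>2) has_real_derivative 2 * max 0 t) (at t)"
      using 2 by (auto intro!: derivative_eq_intros)
    then show ?thesis
      by (rule has_field_derivative_transform_within_open[of _ _ _ "{0<..}"]) (use 2 in auto)
  next
    case 3
    have "((\<lambda>h::real. (max 0 h)\<^sup>2 / h) \<longlongrightarrow> 0) (at 0)"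
    proof (rule Lim_null_comparison[of _ "\<lambda>h. \<bar>h\<bar>"])
      show "\<forall>\<^sub>F h::real in at 0. norm ((max 0 h)\<^sup>2 / h) \<le> \<bar>h\<bar>"
        by (auto simp: max_def power2_eq_square intro!: always_eventually)
      show "((\<lambda>h::real. \<bar>h\<bar>) \<longlongrightarrow> 0) (at 0)"
        by (rule tendsto_eq_intros refl | simp)+
    qed
    then show ?thesis using 3 by (simp add: DERIV_def)
  qed
qed

text \<open>The gradient \<open>H\<close> is a parameter so that the translates of \<open>\<eta>\<close> are test functions in the sense of the definition of
  weak derivatives; the symmetry of \<open>\<eta>\<close> makes \<open>\<lambda>y. \<eta> (x - y)\<close> a probability density as well.\<close>

definition mollifier :: "real \<Rightarrow> (real^'n \<Rightarrow> real) \<Rightarrow> (real^'n \<Rightarrow> real^'n) \<Rightarrow> bool" where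
  "mollifier \<epsilon> \<eta> H \<longleftrightarrow> test_function \<eta> H \<and> (\<forall>z. 0 \<le> \<eta> z) \<and> (\<forall>z. \<eta> (- z) = \<eta> z)
     \<and> (\<forall>z. norm z > \<epsilon> \<longrightarrow> \<eta> z = 0) \<and> integral\<^sup>L lebesgue \<eta> = 1"

definition mollify :: "(real^'n \<Rightarrow> real) \<Rightarrow> (real^'n \<Rightarrow> 'b::euclidean_space) \<Rightarrow> real^'n \<Rightarrow> 'b" where
  "mollify \<eta> f x = (LINT y|lebesgue. \<eta> (x - y) *\<^sub>R f y)"

lemma mollifier_exists:
  assumes "\<epsilon> > 0"
  shows "\<exists>\<eta> H. mollifier \<epsilon> (\<eta> :: real^'n \<Rightarrow> real) H"
proof -
  let ?b = "\<lambda>z::real^'n. (max 0 (\<epsilon>\<^sup>2 - z \<bullet> z))\<^sup>2"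
  let ?B = "\<lambda>z::real^'n. - (4 * max 0 (\<epsilon>\<^sup>2 - z \<bullet> z)) *\<^sub>R z"
  have off: "?b z = 0" if "norm z > \<epsilon>" for z
  proof -
    have "\<epsilon>\<^sup>2 < (norm z)\<^sup>2" using that assms by (intro power_strict_mono) auto
    then show ?thesis by (simp add: power2_norm_eq_inner)
  qed
  have cb: "continuous_on UNIV ?b" by (intro continuous_intros)
  have d: "GDERIV ?b z :> ?B z" for z
  proof -
    have "GDERIV (\<lambda>z::real^'n. \<epsilon>\<^sup>2 - z \<bullet> z) z :> - (2 *\<^sub>R z)"
      unfolding gderiv_def by (auto intro!: derivative_eq_intros simp: inner_commute fun_eq_iff)
    from GDERIV_DERIV_compose[OF this has_real_derivative_pos_part_square]
    show ?thesis by simp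
  qed
  have comp: "compact (closure {z. ?b z \<noteq> 0})"
  proof (rule compact_closure[THEN iffD2], rule bounded_subset[OF bounded_cball])
    show "{z. ?b z \<noteq> 0} \<subseteq> cball 0 \<epsilon>" using off by (force simp: not_le)
  qed
  have tb: "test_function ?b ?B"
    unfolding test_function_def using d comp by (intro conjI allI continuous_intros) auto
  obtain a c :: "real^'n" where ac: "\<And>x. norm x \<le> \<epsilon> \<Longrightarrow> x \<in> cbox a c"
    using norm_bounded_in_box by blast
  have off': "?b z = 0" if "z \<notin> cbox a c" for z using off ac that not_le by blast
  have int: "integral\<^sup>L lebesgue ?b = integral (cbox a c) ?b"
    by (rule continuous_compact_support_integral(2)[OF cb]) (rule off')
  define N where "N = integral\<^sup>L lebesgue ?b"
  have "box a c \<noteq> {}"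
  proof
    assume "box a c = {}"
    then have "negligible (cbox a c)" by (simp add: negligible_interval)
    moreover have "ball 0 \<epsilon> \<subseteq> cbox a c" using ac by auto
    ultimately have "negligible (ball (0::real^'n) \<epsilon>)" by (rule negligible_subset)
    then show False using assms by (simp add: open_not_negligible)
  qed
  have "?b 0 \<noteq> 0" using assms by (simp add: max_def)
  moreover have "0 \<in> cbox a c" using ac[of 0] assms by simp
  ultimately have "\<not> (\<forall>x\<in>cbox a c. ?b x = 0)" by blast
  moreover have "continuous_on (cbox a c) ?b" using cb by (rule continuous_on_subset) simp
  ultimately have "integral (cbox a c) ?b \<noteq> 0"
    using integral_cbox_eq_0_iff[of a c ?b] \<open>box a c \<noteq> {}\<close> by simp
  moreover have "integral (cbox a c) ?b \<ge> 0"
    by (rule Henstock_Kurzweil_Integration.integral_nonneg[OF integrable_continuous])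
       (use cb in \<open>auto intro: continuous_on_subset\<close>)
  ultimately have N: "N > 0" unfolding N_def int by simp
  have "test_function (\<lambda>z. ?b z * (1 / N)) (\<lambda>z. (1 / N) *\<^sub>R ?B z + ?b z *\<^sub>R 0)"
    by (rule test_function_mult_C1[OF tb open_UNIV]) (auto simp: GDERIV_const)
  then have "mollifier \<epsilon> (\<lambda>z. ?b z * (1 / N)) (\<lambda>z. (1 / N) *\<^sub>R ?B z + ?b z *\<^sub>R 0)"
    unfolding mollifier_def using N off by (auto simp: N_def[symmetric])
  then show ?thesis by blast
qed

lemma mollifierD:
  assumes "mollifier \<epsilon> \<eta> H"
  shows "test_function \<eta> H" "\<And>z. 0 \<le> \<eta> z" "\<And>z. \<eta> (- z) = \<eta> z"
    "\<And>z. norm z > \<epsilon> \<Longrightarrow> \<eta> z = 0" "integral\<^sup>L lebesgue \<eta> = 1"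
    "continuous_on UNIV \<eta>" "continuous_on UNIV H" "\<eta> \<in> borel_measurable borel"
    "integrable lebesgue \<eta>"
proof -
  show t: "test_function \<eta> H" and "\<And>z. 0 \<le> \<eta> z" "\<And>z. \<eta> (- z) = \<eta> z"
    and off: "\<And>z. norm z > \<epsilon> \<Longrightarrow> \<eta> z = 0" and one: "integral\<^sup>L lebesgue \<eta> = 1"
    using assms by (auto simp: mollifier_def)
  show c: "continuous_on UNIV \<eta>" by (rule test_function_continuous[OF t])
  then show "\<eta> \<in> borel_measurable borel" by (rule borel_measurable_continuous_onI)
  show "continuous_on UNIV H" using t by (simp add: test_function_def)
  show "integrable lebesgue \<eta>" using one not_integrable_integral_eq by fastforce
qed

lemma nn_integral_mollifier:
  assumes "mollifier \<epsilon> \<eta> H"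
  shows "(\<integral>\<^sup>+x. ennreal (\<eta> (x - y)) \<partial>lborel) = 1" "(\<integral>\<^sup>+y. ennreal (\<eta> (x - y)) \<partial>lborel) = 1"
proof -
  note m = mollifierD[OF assms]
  note [measurable] = m(8)
  have "(\<integral>\<^sup>+x. ennreal (\<eta> x) \<partial>lborel) = (\<integral>\<^sup>+x. ennreal (\<eta> x) \<partial>lebesgue)"
    by (simp add: nn_integral_completion)
  also have "\<dots> = 1"
    using m by (subst nn_integral_eq_integral) auto
  finally have one: "(\<integral>\<^sup>+x. ennreal (\<eta> x) \<partial>lborel) = 1" .
  have shift: "(\<integral>\<^sup>+x. ennreal (\<eta> (x - y)) \<partial>lborel) = 1" for y
  proof -
    have "1 = (\<integral>\<^sup>+x. ennreal (\<eta> x) \<partial>distr lborel borel ((+) (- y)))"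
      unfolding lborel_distr_plus one ..
    also have "\<dots> = (\<integral>\<^sup>+x. ennreal (\<eta> (- y + x)) \<partial>lborel)"
      by (subst nn_integral_distr) auto
    finally show ?thesis by simp
  qed
  show "(\<integral>\<^sup>+x. ennreal (\<eta> (x - y)) \<partial>lborel) = 1" by (rule shift)
  show "(\<integral>\<^sup>+y. ennreal (\<eta> (x - y)) \<partial>lborel) = 1"
    using shift[of x] m(3)[of "x - _"] by simp
qed

lemma mollify_integrable:
  fixes f :: "real^'n \<Rightarrow> 'b::euclidean_space"
  assumes "mollifier \<epsilon> \<eta> H" "locally_integrable f"
  shows "integrable lebesgue (\<lambda>y. \<eta> (x - y) *\<^sub>R f y)"
proof -
  note m = mollifierD[OF assms(1)]
  have "\<exists>B. \<forall>z\<in>cball 0 \<epsilon>. norm (\<eta> z) \<le> B"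
    using compact_imp_bounded[OF compact_continuous_image[OF continuous_on_subset[OF m(6)] compact_cball, of 0 \<epsilon>]]
    unfolding bounded_iff by auto
  then obtain B where B: "\<And>z. z \<in> cball 0 \<epsilon> \<Longrightarrow> norm (\<eta> z) \<le> B" by blast
  show ?thesis
  proof (rule integrable_bounded_times_locally_integrable[OF assms(2) compact_cball[of x \<epsilon>]])
    show "(\<lambda>y. \<eta> (x - y)) \<in> borel_measurable lebesgue"
      using m(8) by (intro measurable_completion) simp
    show "\<eta> (x - y) = 0" if "y \<notin> cball x \<epsilon>" for y
      using m(4)[of "x - y"] that by (simp add: dist_norm)
    show "\<bar>\<eta> (x - y)\<bar> \<le> max B 0" for y
      using B[of "x - y"] m(4)[of "x - y"] by (cases "norm (x - y) \<le> \<epsilon>") auto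
  qed
qed

lemma convolution_eq_integral_box:
  fixes f :: "real^'n \<Rightarrow> 'b::euclidean_space"
  assumes "\<And>y. norm y \<le> norm x0 + 1 + R \<Longrightarrow> y \<in> cbox a b" and x: "x \<in> ball x0 1"
    and "continuous_on UNIV f" "\<And>y. norm (x - y) > R \<Longrightarrow> f y = 0"
  shows "integral\<^sup>L lebesgue f = integral (cbox a b) f"
proof (rule continuous_compact_support_integral(2)[OF assms(3)])
  fix y assume "y \<notin> cbox a b"
  then have "norm y > norm x0 + 1 + R" using assms(1) not_le by blast
  moreover have "norm x < norm x0 + 1"
    using x norm_triangle_ineq2[of x x0] by (auto simp: dist_norm norm_minus_commute)
  ultimately have "norm (x - y) > R" using norm_triangle_ineq2[of y x] by (simp add: norm_minus_commute)
  then show "f y = 0" by (rule assms(4))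
qed

lemma continuous_convolution:
  fixes F :: "real^'n \<Rightarrow> real^'n \<Rightarrow> 'b::euclidean_space"
  assumes F: "continuous_on UNIV (\<lambda>(x, y). F x y)" and off: "\<And>x y. norm (x - y) > R \<Longrightarrow> F x y = 0"
  shows "continuous_on UNIV (\<lambda>x. LINT y|lebesgue. F x y)"
proof (rule continuous_at_imp_continuous_on, intro ballI)
  fix x0 :: "real^'n"
  obtain a b :: "real^'n" where ab: "\<And>y. norm y \<le> norm x0 + 1 + R \<Longrightarrow> y \<in> cbox a b"
    using norm_bounded_in_box by blast
  have cF: "continuous_on UNIV (F x)" for x
  proof -
    have "continuous_on UNIV (\<lambda>y. (x, y))" by (intro continuous_intros)
    from continuous_on_compose2[OF F this subset_UNIV] show ?thesis by simp
  qed
  have "continuous_on (ball x0 1) (\<lambda>x. LINT y|lebesgue. F x y)"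
  proof (rule continuous_on_eq)
    show "continuous_on (ball x0 1) (\<lambda>x. integral (cbox a b) (F x))"
      by (rule integral_continuous_on_param[OF continuous_on_subset[OF F]]) simp
    show "integral (cbox a b) (F x) = (LINT y|lebesgue. F x y)" if "x \<in> ball x0 1" for x
      using convolution_eq_integral_box[OF ab that cF] off by simp
  qed
  then show "isCont (\<lambda>x. LINT y|lebesgue. F x y) x0"
    by (rule continuous_on_interior) simp
qed

text \<open>The gradient falls on the kernel, and the kernel translated by \<open>x\<close> is a test function, so it is
  the definition of the weak gradient that moves it over to \<open>u\<close>.\<close>

lemma mollify_C1:
  fixes u :: "real^'n \<Rightarrow> real"
  assumes "mollifier \<epsilon> \<eta> H" "continuous_on UNIV u" "has_weak_gradient u G"
  shows "GDERIV (mollify \<eta> u) x :> mollify \<eta> G x" "continuous_on UNIV (mollify \<eta> G)"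
proof -
  note m = mollifierD[OF assms(1)]
  have dH: "(\<eta> has_derivative (\<lambda>h. h \<bullet> H z)) (at z)" for z
    using m(1) by (simp add: test_function_def gderiv_def)
  obtain R where R: "R > 0" "\<And>z. norm z > R \<Longrightarrow> \<eta> z = 0 \<and> H z = 0"
    using test_function_bounded_support[OF m(1)] by blast
  have G: "mollify \<eta> G x = (LINT y|lebesgue. u y *\<^sub>R H (x - y))" for x
  proof -
    have "test_function (\<lambda>y. \<eta> (x - y)) (\<lambda>y. - H (x - y))"
      unfolding test_function_def
    proof (intro conjI allI)
      fix y
      have "((\<lambda>y. \<eta> (x - y)) has_derivative (\<lambda>h. (- h) \<bullet> H (x - y))) (at y)"
        by (rule has_derivative_compose[OF _ dH, of "\<lambda>y. x - y" "\<lambda>h. - h"])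
           (auto intro!: derivative_eq_intros)
      then show "GDERIV (\<lambda>y. \<eta> (x - y)) y :> - H (x - y)" by (simp add: gderiv_def)
    next
      show "continuous_on UNIV (\<lambda>y. - H (x - y))"
        by (intro continuous_intros continuous_on_compose2[OF m(7)]) auto
      show "compact (closure {y. \<eta> (x - y) \<noteq> 0})"
      proof (rule compact_closure[THEN iffD2], rule bounded_subset[OF bounded_cball])
        show "{y. \<eta> (x - y) \<noteq> 0} \<subseteq> cball x \<epsilon>"
          using m(4) by (force simp: dist_norm not_le)
      qed
    qed
    with assms(3) have "(LINT y|lebesgue. u y *\<^sub>R (- H (x - y))) = - mollify \<eta> G x"
      unfolding has_weak_gradient_def mollify_def by blast
    then show ?thesis by simp
  qed
  have cH: "continuous_on UNIV (\<lambda>(x, y). u y *\<^sub>R H (x - y))"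
    unfolding case_prod_unfold
    by (intro continuous_intros continuous_on_compose2[OF m(7)] continuous_on_compose2[OF assms(2)]) auto
  show "continuous_on UNIV (mollify \<eta> G)"
    unfolding G[abs_def] by (rule continuous_convolution[OF cH, of R]) (simp add: R)
  show "GDERIV (mollify \<eta> u) x :> mollify \<eta> G x"
  proof -
    obtain a b :: "real^'n" where ab: "\<And>y. norm y \<le> norm x + 1 + R \<Longrightarrow> y \<in> cbox a b"
      using norm_bounded_in_box by blast
    have mu: "mollify \<eta> u x' = integral (cbox a b) (\<lambda>y. \<eta> (x' - y) * u y)" if "x' \<in> ball x 1" for x'
      unfolding mollify_def real_scaleR_def
      by (rule convolution_eq_integral_box[OF ab that])
         (auto simp: R intro!: continuous_intros continuous_on_compose2[OF m(6)] assms(2))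
    have cu: "continuous_on A (\<lambda>y. u y *\<^sub>R H (x - y))" for A
      by (intro continuous_intros continuous_on_compose2[OF m(7)] continuous_on_subset[OF assms(2)]) auto
    have mG: "mollify \<eta> G x = integral (cbox a b) (\<lambda>y. u y *\<^sub>R H (x - y))"
    proof -
      have "x \<in> ball x 1" by simp
      from convolution_eq_integral_box[OF ab this cu] show ?thesis unfolding G by (simp add: R)
    qed
    let ?D = "integral (cbox a b) (\<lambda>y. blinfun_inner_right (u y *\<^sub>R H (x - y)))"
    have "((\<lambda>x'. integral (cbox a b) (\<lambda>y. \<eta> (x' - y) * u y)) has_derivative ?D) (at x within ball x 1)"
    proof (rule leibniz_rule)
      fix x' y :: "real^'n"
      have "((\<lambda>x'. \<eta> (x' - y)) has_derivative (\<lambda>h. h \<bullet> H (x' - y))) (at x')"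
        by (rule has_derivative_compose[OF _ dH, of "\<lambda>x. x - y" "\<lambda>h. h"])
           (auto intro!: derivative_eq_intros)
      from has_derivative_mult_left[OF this, of "u y"]
      show "((\<lambda>x'. \<eta> (x' - y) * u y) has_derivative
          blinfun_apply (blinfun_inner_right (u y *\<^sub>R H (x' - y)))) (at x' within ball x 1)"
        by (rule has_derivative_eq_rhs[OF has_derivative_at_withinI]) (simp add: fun_eq_iff inner_commute)
    next
      fix x' :: "real^'n"
      show "(\<lambda>y. \<eta> (x' - y) * u y) integrable_on cbox a b"
        by (intro integrable_continuous continuous_intros continuous_on_compose2[OF m(6)]
            continuous_on_subset[OF assms(2)]) auto
    next
      show "continuous_on (ball x 1 \<times> cbox a b) (\<lambda>(x', y). blinfun_inner_right (u y *\<^sub>R H (x' - y)))"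
        unfolding case_prod_unfold
        by (intro continuous_intros bounded_linear.continuous_on[OF bounded_linear_blinfun_inner_right]
            continuous_on_compose2[OF m(7)] continuous_on_compose2[OF assms(2)]) auto
    qed auto
    then have "((\<lambda>x'. integral (cbox a b) (\<lambda>y. \<eta> (x' - y) * u y)) has_derivative ?D) (at x)"
      by (subst (asm) at_within_open) auto
    then have "(mollify \<eta> u has_derivative ?D) (at x)"
      by (rule has_derivative_transform_within_open[OF _ open_ball[of x 1]]) (simp_all add: mu)
    moreover have "blinfun_apply ?D h = h \<bullet> mollify \<eta> G x" for h
    proof -
      have "blinfun_apply ?D h = integral (cbox a b) (\<lambda>y. h \<bullet> (u y *\<^sub>R H (x - y)))"
        by (subst blinfun_apply_integral)
           (auto simp: inner_commute intro!: integrable_continuous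
              bounded_linear.continuous_on[OF bounded_linear_blinfun_inner_right] cu[simplified])
      also have "\<dots> = h \<bullet> mollify \<eta> G x"
        using integral_linear[OF integrable_continuous[OF cu] bounded_linear_inner_right[of h]]
        by (simp add: o_def mG)
      finally show ?thesis .
    qed
    ultimately show ?thesis
      unfolding gderiv_def by (rule has_derivative_eq_rhs[OF _ ext])
  qed
qed

lemma mollify_near:
  fixes f :: "real^'n \<Rightarrow> 'b::euclidean_space"
  assumes "mollifier \<epsilon> \<eta> H" "locally_integrable f"
    and "\<And>y. dist x y \<le> \<epsilon> \<Longrightarrow> norm (f y - c) \<le> \<delta>"
  shows "norm (mollify \<eta> f x - c) \<le> \<delta>"
proof -
  note m = mollifierD[OF assms(1)]
  have eta: "integrable lebesgue (\<lambda>y. \<eta> (x - y))" "(LINT y|lebesgue. \<eta> (x - y)) = 1"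
  proof -
    have "(\<lambda>y. \<eta> (x - y)) = (\<lambda>y. \<eta> (- x + y))"
      using m(3)[of "x - _"] by (auto simp: algebra_simps)
    then show one: "(LINT y|lebesgue. \<eta> (x - y)) = 1"
      using integral_lebesgue_translation[OF m(6), of "- x"] m(5) by simp
    then show "integrable lebesgue (\<lambda>y. \<eta> (x - y))"
      using not_integrable_integral_eq by fastforce
  qed
  have "mollify \<eta> f x - c = (LINT y|lebesgue. \<eta> (x - y) *\<^sub>R (f y - c))"
    using eta mollify_integrable[OF assms(1,2)] by (simp add: mollify_def scaleR_diff_right)
  moreover have "norm (LINT y|lebesgue. \<eta> (x - y) *\<^sub>R (f y - c)) \<le> (LINT y|lebesgue. \<eta> (x - y) * \<delta>)"
  proof (rule Bochner_Integration.integral_norm_bound_integral)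
    show "integrable lebesgue (\<lambda>y. \<eta> (x - y) *\<^sub>R (f y - c))"
      using eta mollify_integrable[OF assms(1,2)] by (simp add: scaleR_diff_right)
    show "integrable lebesgue (\<lambda>y. \<eta> (x - y) * \<delta>)" using eta by simp
    fix y
    show "norm (\<eta> (x - y) *\<^sub>R (f y - c)) \<le> \<eta> (x - y) * \<delta>"
      using m(2)[of "x - y"] m(4)[of "x - y"] assms(3)[of y]
      by (cases "dist x y \<le> \<epsilon>") (auto simp: dist_norm intro: mult_left_mono)
  qed
  ultimately show ?thesis using eta by simp
qed

text \<open>Jensen's inequality for the probability density \<open>\<lambda>y. \<eta> (x - y)\<close>.\<close>

lemma norm_mollify_powr_le:
  fixes f :: "real^'n \<Rightarrow> 'b::euclidean_space"
  assumes "mollifier \<epsilon> \<eta> H" "locally_integrable f" "\<gamma> > 1"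
  shows "ennreal (norm (mollify \<eta> f x) powr \<gamma>)
      \<le> (\<integral>\<^sup>+y. ennreal (\<eta> (x - y)) * ennreal (norm (f y) powr \<gamma>) \<partial>lebesgue)" (is "_ \<le> ?J")
proof (cases "?J = \<infinity>")
  case False
  note m = mollifierD[OF assms(1)]
  define s where "s = norm (mollify \<eta> f x)"
  have [measurable]: "f \<in> borel_measurable lebesgue"
    by (rule locally_integrable_measurable[OF assms(2)])
  have [measurable]: "(\<lambda>y. \<eta> (x - y)) \<in> borel_measurable lebesgue"
    using m(8) by (intro measurable_completion) simp
  obtain j where j: "j \<ge> 0" "?J = ennreal j" using False by (cases ?J) auto
  have one: "(\<integral>\<^sup>+y. ennreal (\<eta> (x - y)) \<partial>lebesgue) = 1"
    using nn_integral_mollifier(2)[OF assms(1)] by (simp add: nn_integral_completion)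
  have "ennreal s \<le> (\<integral>\<^sup>+y. ennreal (\<eta> (x - y) * norm (f y)) \<partial>lebesgue)"
    using integral_norm_bound_ennreal[OF mollify_integrable[OF assms(1,2), of x]] m(2)
    by (simp add: s_def mollify_def)
  then have "ennreal (s powr (\<gamma> - 1)) * ennreal s
      \<le> ennreal (s powr (\<gamma> - 1)) * (\<integral>\<^sup>+y. ennreal (\<eta> (x - y) * norm (f y)) \<partial>lebesgue)"
    by (rule mult_left_mono) simp
  also have "\<dots> = (\<integral>\<^sup>+y. ennreal (s powr (\<gamma> - 1)) * ennreal (\<eta> (x - y) * norm (f y)) \<partial>lebesgue)"
    by (rule nn_integral_cmult[symmetric]) measurable
  also have "\<dots> \<le> (\<integral>\<^sup>+y. ennreal (1 / \<gamma>) * (ennreal (\<eta> (x - y)) * ennreal (norm (f y) powr \<gamma>))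
       + ennreal ((1 - 1 / \<gamma>) * s powr \<gamma>) * ennreal (\<eta> (x - y)) \<partial>lebesgue)"
  proof (rule nn_integral_mono)
    fix y
    let ?t = "norm (f y)"
    have "?t * s powr (\<gamma> - 1) \<le> ?t powr \<gamma> / \<gamma> + (s powr (\<gamma> - 1)) powr (\<gamma> / (\<gamma> - 1)) / (\<gamma> / (\<gamma> - 1))"
      by (rule Youngs_inequality) (use assms(3) in \<open>auto simp: field_simps\<close>)
    also have "(s powr (\<gamma> - 1)) powr (\<gamma> / (\<gamma> - 1)) = s powr \<gamma>"
      using assms(3) by (simp add: powr_powr)
    also have "s powr \<gamma> / (\<gamma> / (\<gamma> - 1)) = (1 - 1 / \<gamma>) * s powr \<gamma>"
      using assms(3) by (simp add: field_simps)
    finally have "\<eta> (x - y) * (?t * s powr (\<gamma> - 1))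
        \<le> \<eta> (x - y) * (?t powr \<gamma> / \<gamma> + (1 - 1 / \<gamma>) * s powr \<gamma>)"
      using m(2) by (rule mult_left_mono)
    then have "s powr (\<gamma> - 1) * (\<eta> (x - y) * ?t)
        \<le> 1 / \<gamma> * (\<eta> (x - y) * ?t powr \<gamma>) + (1 - 1 / \<gamma>) * s powr \<gamma> * \<eta> (x - y)"
      by (simp add: algebra_simps)
    then have "ennreal (s powr (\<gamma> - 1) * (\<eta> (x - y) * ?t))
        \<le> ennreal (1 / \<gamma> * (\<eta> (x - y) * ?t powr \<gamma>) + (1 - 1 / \<gamma>) * s powr \<gamma> * \<eta> (x - y))"
      by (rule ennreal_leI)
    then show "ennreal (s powr (\<gamma> - 1)) * ennreal (\<eta> (x - y) * norm (f y))
       \<le> ennreal (1 / \<gamma>) * (ennreal (\<eta> (x - y)) * ennreal (norm (f y) powr \<gamma>))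
         + ennreal ((1 - 1 / \<gamma>) * s powr \<gamma>) * ennreal (\<eta> (x - y))"
      using m(2)[of "x - y"] assms(3) by (simp add: ennreal_mult'[symmetric] ennreal_plus[symmetric] del: ennreal_plus)
  qed
  also have "\<dots> = ennreal (1 / \<gamma>) * ?J + ennreal ((1 - 1 / \<gamma>) * s powr \<gamma>) * 1"
    unfolding one[symmetric] by (simp add: nn_integral_add nn_integral_cmult)
  also have "\<dots> = ennreal (1 / \<gamma> * j + (1 - 1 / \<gamma>) * s powr \<gamma>)"
    using assms(3) j by (simp add: ennreal_mult'[symmetric] ennreal_plus[symmetric] del: ennreal_plus)
  finally have "ennreal (s powr (\<gamma> - 1) * s) \<le> ennreal (1 / \<gamma> * j + (1 - 1 / \<gamma>) * s powr \<gamma>)"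
    by (simp add: ennreal_mult' s_def)
  then have "s powr (\<gamma> - 1) * s \<le> 1 / \<gamma> * j + (1 - 1 / \<gamma>) * s powr \<gamma>"
    using assms(3) j by (subst (asm) ennreal_le_iff) auto
  moreover have "s powr (\<gamma> - 1) * s = s powr \<gamma>"
    using powr_mult_base[of s "\<gamma> - 1"] by (simp add: s_def mult.commute)
  ultimately have "s powr \<gamma> \<le> j" using assms(3) by (simp add: field_simps)
  then show ?thesis using j by (simp add: s_def ennreal_leI)
qed simp

text \<open>By Tonelli's theorem the order of averaging can be exchanged, and the mass that a point \<open>y\<close> sends to \<open>K\<close> is at most
  one, and zero when \<open>y\<close> is farther than \<open>\<epsilon>\<close> from \<open>K\<close>.\<close>

lemma nn_integral_mollify_le:
  fixes g :: "real^'n \<Rightarrow> ennreal"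
  assumes "mollifier \<epsilon> \<eta> H" "g \<in> borel_measurable lebesgue"
    and K: "K \<in> sets borel" "K' \<in> sets borel" "\<And>x y. x \<in> K \<Longrightarrow> dist x y \<le> \<epsilon> \<Longrightarrow> y \<in> K'"
  shows "(\<integral>\<^sup>+x. (\<integral>\<^sup>+y. ennreal (\<eta> (x - y)) * g y \<partial>lebesgue) * indicator K x \<partial>lebesgue)
      \<le> (\<integral>\<^sup>+y. g y * indicator K' y \<partial>lebesgue)"
proof -
  note m = mollifierD[OF assms(1)]
  note [measurable] = m(8) K(1,2)
  obtain g' where g'[measurable]: "g' \<in> borel_measurable lborel" and ae: "AE y in lborel. g y = g' y"
    using completion_ex_borel_measurable[OF assms(2)] by blast
  have i1: "(\<integral>\<^sup>+y. ennreal (\<eta> (x - y)) * g y \<partial>lebesgue) = (\<integral>\<^sup>+y. ennreal (\<eta> (x - y)) * g' y \<partial>lborel)" for x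
    unfolding nn_integral_completion by (rule nn_integral_cong_AE) (use ae in auto)
  have i2: "(\<integral>\<^sup>+y. g y * indicator K' y \<partial>lebesgue) = (\<integral>\<^sup>+y. g' y * indicator K' y \<partial>lborel)"
    unfolding nn_integral_completion by (rule nn_integral_cong_AE) (use ae in auto)
  have "(\<integral>\<^sup>+x. (\<integral>\<^sup>+y. ennreal (\<eta> (x - y)) * g' y \<partial>lborel) * indicator K x \<partial>lborel)
      = (\<integral>\<^sup>+x. (\<integral>\<^sup>+y. ennreal (\<eta> (x - y)) * g' y * indicator K x \<partial>lborel) \<partial>lborel)"
    by (intro nn_integral_cong nn_integral_multc[symmetric]) measurable
  also have "\<dots> = (\<integral>\<^sup>+y. (\<integral>\<^sup>+x. ennreal (\<eta> (x - y)) * g' y * indicator K x \<partial>lborel) \<partial>lborel)"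
    by (rule lborel_pair.Fubini') measurable
  also have "\<dots> \<le> (\<integral>\<^sup>+y. (\<integral>\<^sup>+x. ennreal (\<eta> (x - y)) * (g' y * indicator K' y) \<partial>lborel) \<partial>lborel)"
  proof (intro nn_integral_mono)
    fix x y
    show "ennreal (\<eta> (x - y)) * g' y * indicator K x \<le> ennreal (\<eta> (x - y)) * (g' y * indicator K' y)"
      using K(3)[of x y] m(4)[of "x - y"] by (cases "dist x y \<le> \<epsilon>") (auto simp: indicator_def dist_norm)
  qed
  also have "\<dots> = (\<integral>\<^sup>+y. g' y * indicator K' y \<partial>lborel)"
    using nn_integral_mollifier(1)[OF assms(1)] by (simp add: nn_integral_multc)
  finally show ?thesis unfolding i1 i2 by (simp add: nn_integral_completion)
qed

lemma norm_add_powr_le: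
  assumes "\<gamma> \<ge> 0"
  shows "norm (a + b) powr \<gamma> \<le> 2 powr \<gamma> * (norm a powr \<gamma> + norm b powr \<gamma>)"
proof -
  let ?m = "max (norm a) (norm b)"
  have "norm (a + b) \<le> 2 * ?m" using norm_triangle_ineq[of a b] by linarith
  then have "norm (a + b) powr \<gamma> \<le> (2 * ?m) powr \<gamma>" using assms by (intro powr_mono2) auto
  also have "\<dots> = 2 powr \<gamma> * ?m powr \<gamma>" by (simp add: powr_mult)
  also have "?m powr \<gamma> \<le> norm a powr \<gamma> + norm b powr \<gamma>" by (simp add: max_def)
  finally show ?thesis by simp
qed

abbreviation powr_integral :: "real \<Rightarrow> (real^'n) set \<Rightarrow> (real^'n \<Rightarrow> 'b::euclidean_space) \<Rightarrow> ennreal" where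
  "powr_integral \<gamma> K f \<equiv> (\<integral>\<^sup>+x. ennreal (norm (f x) powr \<gamma>) * indicator K x \<partial>lebesgue)"

lemma nn_integral_powr_triangle:
  fixes f g :: "real^'n \<Rightarrow> 'b::euclidean_space"
  assumes [measurable]: "f \<in> borel_measurable lebesgue" "g \<in> borel_measurable lebesgue" "K \<in> sets lebesgue"
    and "\<gamma> \<ge> 0" "a \<ge> 0" "b \<ge> 0"
    and fa: "powr_integral \<gamma> K f \<le> ennreal a"
    and gb: "powr_integral \<gamma> K g \<le> ennreal b"
  shows "powr_integral \<gamma> K (\<lambda>x. f x + g x) \<le> ennreal (2 powr \<gamma> * (a + b))"
proof -
  have "powr_integral \<gamma> K (\<lambda>x. f x + g x)
     \<le> (\<integral>\<^sup>+x. ennreal (2 powr \<gamma>) * (ennreal (norm (f x) powr \<gamma>) * indicator K x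
           + ennreal (norm (g x) powr \<gamma>) * indicator K x) \<partial>lebesgue)"
  proof (rule nn_integral_mono)
    fix x
    have "ennreal (norm (f x + g x) powr \<gamma>) \<le> ennreal (2 powr \<gamma> * (norm (f x) powr \<gamma> + norm (g x) powr \<gamma>))"
      using norm_add_powr_le[OF \<open>\<gamma> \<ge> 0\<close>] by (rule ennreal_leI)
    then show "ennreal (norm (f x + g x) powr \<gamma>) * indicator K x
      \<le> ennreal (2 powr \<gamma>) * (ennreal (norm (f x) powr \<gamma>) * indicator K x
           + ennreal (norm (g x) powr \<gamma>) * indicator K x)"
      by (auto simp: indicator_def ennreal_mult')
  qed
  also have "\<dots> = ennreal (2 powr \<gamma>) * (powr_integral \<gamma> K f
       + powr_integral \<gamma> K g)"
    by (simp add: nn_integral_cmult nn_integral_add)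
  also have "\<dots> \<le> ennreal (2 powr \<gamma>) * (ennreal a + ennreal b)"
    by (intro mult_left_mono add_mono fa gb) simp
  also have "\<dots> = ennreal (2 powr \<gamma> * (a + b))"
    using assms by (simp add: ennreal_mult')
  finally show ?thesis .
qed

lemma nn_integral_dominated_tendsto_0:
  fixes f :: "nat \<Rightarrow> 'a \<Rightarrow> ennreal"
  assumes "\<And>i. f i \<in> borel_measurable M" "w \<in> borel_measurable M"
    and "\<And>i. AE x in M. f i x \<le> w x" "(\<integral>\<^sup>+x. w x \<partial>M) < \<infinity>"
    and "AE x in M. (\<lambda>i. f i x) \<longlonglongrightarrow> 0" "\<delta> > 0"
  shows "\<exists>i. (\<integral>\<^sup>+x. f i x \<partial>M) \<le> ennreal \<delta>"
proof -
  have "(\<lambda>i. \<integral>\<^sup>+x. f i x \<partial>M) \<longlonglongrightarrow> (\<integral>\<^sup>+x. 0 \<partial>M)"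
    by (rule nn_integral_dominated_convergence[where w = w]) (use assms in auto)
  then have "eventually (\<lambda>i. (\<integral>\<^sup>+x. f i x \<partial>M) < ennreal \<delta>) sequentially"
    using \<open>\<delta> > 0\<close> by (intro order_tendstoD(2)) auto
  then show ?thesis
    using eventually_happens[of _ sequentially] less_imp_le by fastforce
qed

text \<open>Radial truncation makes the function bounded, and a bounded measurable function is an almost everywhere limit of
  continuous functions, which the same truncation makes uniformly bounded; so dominated convergence applies twice.\<close>

lemma powr_integrable_approx_continuous:
  fixes F :: "real^'n \<Rightarrow> 'b::euclidean_space"
  assumes meas[measurable]: "F \<in> borel_measurable lebesgue" and "\<gamma> > 0" "\<delta> > 0"
    and fin: "powr_integral \<gamma> (cball 0 R) F < \<infinity>"
  obtains g where "continuous_on UNIV g"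
    "powr_integral \<gamma> (cball 0 R) (\<lambda>x. F x - g x) \<le> ennreal \<delta>"
proof -
  have [measurable]: "cball (0::real^'n) R \<in> sets lebesgue" by simp
  define P where "P M = closest_point (cball (0::'b) (real M))" for M
  have P_in: "norm (P M v) \<le> real M" for M v
    using closest_point_in_set[of "cball (0::'b) (real M)" v] by (simp add: P_def)
  have P_id: "P M v = v" if "norm v \<le> real M" for M v
    using that by (simp add: P_def closest_point_self)
  have P_diff: "norm (v - P M v) \<le> norm v" for M v
    using closest_point_le[of "cball (0::'b) (real M)" 0 v] by (simp add: P_def dist_norm)
  have P_cont: "continuous_on UNIV (P M)" for M
    unfolding P_def by (rule continuous_on_closest_point) auto
  have P_meas: "P M \<in> borel_measurable borel" for M
    by (rule borel_measurable_continuous_onI[OF P_cont])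
  have PF[measurable]: "(\<lambda>x. P M (F x)) \<in> borel_measurable lebesgue" for M
    using measurable_compose[OF meas P_meas] .
  define \<delta>' where "\<delta>' = \<delta> / (2 powr \<gamma> * 2)"
  have "\<delta>' > 0" using \<open>\<delta> > 0\<close> by (simp add: \<delta>'_def)
  let ?B = "indicator (cball 0 R) :: real^'n \<Rightarrow> ennreal"
  let ?f = "\<lambda>M x. ennreal (norm (F x - P M (F x)) powr \<gamma>) * ?B x"
  have "\<exists>M. powr_integral \<gamma> (cball 0 R) (\<lambda>x. F x - P M (F x)) \<le> ennreal \<delta>'"
  proof (rule nn_integral_dominated_tendsto_0[where w = "\<lambda>x. ennreal (norm (F x) powr \<gamma>) * indicator (cball 0 R) x"])
    fix M :: nat
    show "AE x in lebesgue. ?f M x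
        \<le> ennreal (norm (F x) powr \<gamma>) * indicator (cball 0 R) x"
      using P_diff \<open>\<gamma> > 0\<close> by (intro always_eventually allI mult_right_mono ennreal_leI powr_mono2) auto
  next
    have "(\<lambda>M. ?f M x) \<longlonglongrightarrow> 0" for x
    proof (rule tendsto_eventually)
      obtain N :: nat where "norm (F x) \<le> real N" using real_arch_simple by blast
      then show "\<forall>\<^sub>F M in sequentially. ?f M x = 0"
        unfolding eventually_sequentially by (intro exI[of _ N]) (auto simp: P_id)
    qed
    then show "AE x in lebesgue. (\<lambda>M. ?f M x) \<longlonglongrightarrow> 0"
      by simp
    show "(\<lambda>x. ?f M x) \<in> borel_measurable lebesgue"
      for M by measurable
    show "(\<lambda>x. ennreal (norm (F x) powr \<gamma>) * indicator (cball 0 R) x) \<in> borel_measurable lebesgue"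
      by measurable
  qed (use fin \<open>\<delta>' > 0\<close> in auto)
  then obtain M where
    M: "powr_integral \<gamma> (cball 0 R) (\<lambda>x. F x - P M (F x)) \<le> ennreal \<delta>'" ..
  have "F measurable_on (cball 0 R)"
    by (rule lebesgue_measurable_imp_measurable_on[OF meas]) simp
  then obtain N h where N: "negligible N" and h: "\<And>i. continuous_on UNIV (h i)"
    and lim: "\<And>x. x \<notin> N \<Longrightarrow> (\<lambda>i. h i x) \<longlonglongrightarrow> (if x \<in> cball 0 R then F x else 0)"
    unfolding measurable_on_def by blast
  have Ph: "continuous_on UNIV (\<lambda>x. P M (h i x))" for i
    by (intro continuous_on_compose2[OF P_cont h]) auto
  have [measurable]: "(\<lambda>x. P M (h i x)) \<in> borel_measurable lebesgue" for i
    by (rule continuous_lebesgue_measurable[OF Ph[of i]])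
  let ?g = "\<lambda>i x. ennreal (norm (P M (F x) - P M (h i x)) powr \<gamma>) * ?B x"
  have "\<exists>i. powr_integral \<gamma> (cball 0 R) (\<lambda>x. P M (F x) - P M (h i x)) \<le> ennreal \<delta>'"
  proof (rule nn_integral_dominated_tendsto_0[where w = "\<lambda>x. ennreal ((2 * M) powr \<gamma>) * indicator (cball 0 R) x"])
    fix i
    have "norm (P M (F x) - P M (h i x)) \<le> 2 * M" for x
      using norm_triangle_ineq4[of "P M (F x)" "P M (h i x)"] P_in[of M "F x"] P_in[of M "h i x"] by simp
    then show "AE x in lebesgue. ?g i x
        \<le> ennreal ((2 * M) powr \<gamma>) * indicator (cball 0 R) x"
      using \<open>\<gamma> > 0\<close> by (intro always_eventually allI mult_right_mono ennreal_leI powr_mono2) auto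
  next
    have "emeasure lebesgue (cball (0::real^'n) R) < \<infinity>"
      using emeasure_bounded_finite[of "cball (0::real^'n) R"] by simp
    then show "(\<integral>\<^sup>+x. ennreal ((2 * M) powr \<gamma>) * indicator (cball 0 R) (x::real^'n) \<partial>lebesgue) < \<infinity>"
      by (simp add: nn_integral_cmult ennreal_mult_less_top)
  next
    have "(\<lambda>i. ?g i x) \<longlonglongrightarrow> 0"
      if "x \<notin> N" for x
    proof (cases "x \<in> cball 0 R")
      case True
      then have "(\<lambda>i. h i x) \<longlonglongrightarrow> F x" using lim[OF that] by simp
      then have "(\<lambda>i. P M (h i x)) \<longlonglongrightarrow> P M (F x)"
        by (rule continuous_on_tendsto_compose[OF P_cont]) auto
      then have "(\<lambda>i. norm (P M (F x) - P M (h i x)) powr \<gamma>) \<longlonglongrightarrow> norm (P M (F x) - P M (F x)) powr \<gamma>"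
        using \<open>\<gamma> > 0\<close> by (intro tendsto_powr' tendsto_intros) auto
      then have "(\<lambda>i. ennreal (norm (P M (F x) - P M (h i x)) powr \<gamma>)) \<longlonglongrightarrow> ennreal 0"
        by (intro tendsto_ennrealI) simp
      then show ?thesis using True by simp
    qed simp
    moreover have "AE x in lebesgue. x \<notin> N"
      using N by (intro AE_not_in) (simp add: negligible_iff_null_sets)
    ultimately show "AE x in lebesgue. (\<lambda>i. ?g i x) \<longlonglongrightarrow> 0"
      by auto
    show "(\<lambda>x. ?g i x) \<in> borel_measurable lebesgue"
      for i by measurable
    show "(\<lambda>x::real^'n. ennreal ((2 * M) powr \<gamma>) * indicator (cball 0 R) x) \<in> borel_measurable lebesgue"
      by measurable
  qed (use \<open>\<delta>' > 0\<close> in auto)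
  then obtain i where
    i: "powr_integral \<gamma> (cball 0 R) (\<lambda>x. P M (F x) - P M (h i x)) \<le> ennreal \<delta>'" ..
  have "powr_integral \<gamma> (cball 0 R) (\<lambda>x. (F x - P M (F x)) + (P M (F x) - P M (h i x))) \<le> ennreal (2 powr \<gamma> * (\<delta>' + \<delta>'))"
    by (rule nn_integral_powr_triangle[OF _ _ _ _ _ _ M i]) (use \<open>\<delta>' > 0\<close> \<open>\<gamma> > 0\<close> in auto)
  also have "2 powr \<gamma> * (\<delta>' + \<delta>') = \<delta>" by (simp add: \<delta>'_def)
  finally show ?thesis using that[OF Ph[of i]] by simp
qed

lemma mollify_diff:
  fixes f g :: "real^'n \<Rightarrow> 'b::euclidean_space"
  assumes "mollifier \<epsilon> \<eta> H" "locally_integrable f" "locally_integrable g"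
  shows "mollify \<eta> (\<lambda>x. f x - g x) x = mollify \<eta> f x - mollify \<eta> g x"
  using mollify_integrable[OF assms(1,2)] mollify_integrable[OF assms(1,3)]
  by (simp add: mollify_def scaleR_diff_right)

lemma locally_integrable_diff:
  "locally_integrable f \<Longrightarrow> locally_integrable g \<Longrightarrow> locally_integrable (\<lambda>x. f x - g x)"
  unfolding locally_integrable_def by (auto intro: set_integral_diff)

lemma continuous_mollify:
  fixes f :: "real^'n \<Rightarrow> 'b::euclidean_space"
  assumes "mollifier \<epsilon> \<eta> H" "continuous_on UNIV f"
  shows "continuous_on UNIV (mollify \<eta> f)"
  unfolding mollify_def[abs_def] using mollifierD(4,6)[OF assms(1)]
  by (intro continuous_convolution[of _ \<epsilon>])
     (auto simp: case_prod_unfold intro!: continuous_intros continuous_on_compose2[OF assms(2)]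
        continuous_on_compose2[OF mollifierD(6)[OF assms(1)]])

lemma mollify_uniform_convergence:
  fixes g :: "real^'n \<Rightarrow> 'b::euclidean_space"
  assumes "continuous_on UNIV g" "t > 0"
  shows "\<exists>d>0. \<forall>\<epsilon> \<eta> H x. mollifier \<epsilon> \<eta> H \<longrightarrow> \<epsilon> \<le> d \<longrightarrow> x \<in> cball 0 R \<longrightarrow> norm (mollify \<eta> g x - g x) \<le> t"
proof -
  have "uniformly_continuous_on (cball 0 (R + 1)) g"
    by (rule compact_uniformly_continuous[OF continuous_on_subset[OF assms(1)]]) auto
  then obtain d where d: "d > 0" "\<And>x y. x \<in> cball 0 (R + 1) \<Longrightarrow> y \<in> cball 0 (R + 1) \<Longrightarrow> dist y x < d \<Longrightarrow> dist (g y) (g x) < t"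
    using \<open>t > 0\<close> unfolding uniformly_continuous_on_def by metis
  show ?thesis
  proof (intro exI[of _ "min 1 (d / 2)"] conjI allI impI)
    show "min 1 (d / 2) > 0" using d by simp
    fix \<epsilon> :: real and \<eta> :: "real^'n \<Rightarrow> real" and H and x :: "real^'n"
    assume mo: "mollifier \<epsilon> \<eta> H" and \<epsilon>: "\<epsilon> \<le> min 1 (d / 2)" and x: "x \<in> cball 0 R"
    show "norm (mollify \<eta> g x - g x) \<le> t"
    proof (rule mollify_near[OF mo locally_integrable_continuous[OF assms(1)]])
      fix y assume "dist x y \<le> \<epsilon>"
      moreover have "norm y \<le> norm x + dist x y"
        using norm_triangle_ineq2[of y x] by (simp add: dist_norm norm_minus_commute)
      ultimately show "norm (g y - g x) \<le> t"
        using d(2)[of x y] \<epsilon> x d(1) by (simp add: dist_norm norm_minus_commute)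
    qed
  qed
qed

text \<open>Mollification converges locally uniformly on continuous functions, these are dense in \<open>L\<^sup>\<gamma>\<close> of a ball, and
  mollification does not increase the \<open>L\<^sup>\<gamma>\<close> norm except by enlarging the ball a little.\<close>

lemma mollify_powr_convergence:
  fixes F :: "real^'n \<Rightarrow> 'b::euclidean_space"
  assumes F: "locally_integrable F" "locally_integrable (\<lambda>x. norm (F x) powr \<gamma>)" and "\<gamma> > 1" "\<delta> > 0"
  obtains \<epsilon>0 where "\<epsilon>0 > 0"
    "\<And>\<epsilon> \<eta> H. mollifier \<epsilon> \<eta> H \<Longrightarrow> \<epsilon> \<le> \<epsilon>0 \<Longrightarrow> continuous_on UNIV (mollify \<eta> F) \<Longrightarrow>
      powr_integral \<gamma> (cball 0 R) (\<lambda>x. mollify \<eta> F x - F x) \<le> ennreal \<delta>"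
proof -
  have [measurable]: "F \<in> borel_measurable lebesgue" by (rule locally_integrable_measurable[OF F(1)])
  have [measurable]: "cball (0::real^'n) r \<in> sets lebesgue" for r by simp
  define V where "V = measure lebesgue (cball (0::real^'n) R)"
  define \<delta>' where "\<delta>' = \<delta> / (2 powr \<gamma> * (2 powr \<gamma> * 2 + 1))"
  define t where "t = (\<delta>' / (V + 1)) powr (1 / \<gamma>)"
  have "\<delta>' > 0" using \<open>\<delta> > 0\<close> by (simp add: \<delta>'_def add_pos_pos)
  have "V \<ge> 0" by (simp add: V_def)
  have tV: "t powr \<gamma> * V \<le> \<delta>'"
  proof -
    have "t powr \<gamma> = \<delta>' / (V + 1)"
      using \<open>\<gamma> > 1\<close> \<open>\<delta>' > 0\<close> \<open>V \<ge> 0\<close> by (simp add: t_def powr_powr)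
    then have "t powr \<gamma> * (V + 1) = \<delta>'" using \<open>V \<ge> 0\<close> by simp
    moreover have "t powr \<gamma> * V \<le> t powr \<gamma> * (V + 1)" by (rule mult_left_mono) auto
    ultimately show ?thesis by simp
  qed
  have "t > 0" using \<open>\<delta>' > 0\<close> \<open>V \<ge> 0\<close> by (simp add: t_def)
  have fin: "powr_integral \<gamma> (cball 0 (R + 1)) F < \<infinity>"
  proof -
    have "set_integrable lebesgue (cball 0 (R + 1)) (\<lambda>x. norm (F x) powr \<gamma>)"
      using F(2) compact_cball unfolding locally_integrable_def by blast
    then have "integrable lebesgue (\<lambda>x. norm (F x) powr \<gamma> * indicator (cball 0 (R + 1)) x)"
      by (simp add: set_integrable_def mult.commute)
    then have "(\<integral>\<^sup>+x. ennreal (norm (F x) powr \<gamma> * indicator (cball 0 (R + 1)) x) \<partial>lebesgue) < \<infinity>"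
      by (simp add: integrable_iff_bounded)
    then show ?thesis by (simp add: ennreal_mult' ennreal_indicator)
  qed
  have "\<exists>g. continuous_on UNIV g \<and>
      powr_integral \<gamma> (cball 0 (R + 1)) (\<lambda>x. F x - g x) \<le> ennreal \<delta>'"
    by (rule powr_integrable_approx_continuous[OF \<open>F \<in> borel_measurable lebesgue\<close> _ \<open>\<delta>' > 0\<close> fin])
       (use \<open>\<gamma> > 1\<close> in auto)
  then obtain g where g: "continuous_on UNIV g"
    and gF: "powr_integral \<gamma> (cball 0 (R + 1)) (\<lambda>x. F x - g x) \<le> ennreal \<delta>'"
    by blast
  have gl: "locally_integrable g" by (rule locally_integrable_continuous[OF g])
  have [measurable]: "g \<in> borel_measurable lebesgue" by (rule locally_integrable_measurable[OF gl])
  obtain d where d: "d > 0" "\<And>\<epsilon> \<eta> H x. mollifier \<epsilon> \<eta> H \<Longrightarrow> \<epsilon> \<le> d \<Longrightarrow> x \<in> cball 0 R \<Longrightarrow> norm (mollify \<eta> g x - g x) \<le> t"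
    using mollify_uniform_convergence[OF g \<open>t > 0\<close>, of R] by blast
  show ?thesis
  proof (rule that[of "min 1 d"])
    show "min 1 d > 0" using d by simp
    fix \<epsilon> \<eta> H
    assume mo: "mollifier \<epsilon> \<eta> H" and \<epsilon>: "\<epsilon> \<le> min 1 d" and cont: "continuous_on UNIV (mollify \<eta> F)"
    have fgl: "locally_integrable (\<lambda>x. F x - g x)" by (rule locally_integrable_diff[OF F(1) gl])
    have near: "norm (mollify \<eta> g x - g x) \<le> t" if "x \<in> cball 0 R" for x
      using d(2)[OF mo _ that] \<epsilon> by simp
    have mm[measurable]: "mollify \<eta> F \<in> borel_measurable lebesgue" by (rule continuous_lebesgue_measurable[OF cont])
    have eq: "mollify \<eta> F x - F x = (mollify \<eta> (\<lambda>x. F x - g x) x + (g x - F x)) + (mollify \<eta> g x - g x)" for x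
      by (simp add: mollify_diff[OF mo F(1) gl])
    have 1: "powr_integral \<gamma> (cball 0 R) (\<lambda>x. mollify \<eta> (\<lambda>x. F x - g x) x) \<le> ennreal \<delta>'"
    proof -
      have "powr_integral \<gamma> (cball 0 R) (\<lambda>x. mollify \<eta> (\<lambda>x. F x - g x) x)
        \<le> (\<integral>\<^sup>+x. (\<integral>\<^sup>+y. ennreal (\<eta> (x - y)) * ennreal (norm (F y - g y) powr \<gamma>) \<partial>lebesgue) * indicator (cball 0 R) x \<partial>lebesgue)"
        by (intro nn_integral_mono mult_right_mono norm_mollify_powr_le[OF mo fgl \<open>\<gamma> > 1\<close>]) simp
      also have "\<dots> \<le> powr_integral \<gamma> (cball 0 (R + 1)) (\<lambda>x. F x - g x)"
      proof (rule nn_integral_mollify_le[OF mo])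
        fix x y :: "real^'n" assume "x \<in> cball 0 R" "dist x y \<le> \<epsilon>"
        then show "y \<in> cball 0 (R + 1)"
          using norm_triangle_ineq2[of y x] \<epsilon> by (simp add: dist_norm norm_minus_commute)
      qed auto
      finally show ?thesis using gF by (rule order_trans)
    qed
    have 2: "powr_integral \<gamma> (cball 0 R) (\<lambda>x. g x - F x) \<le> ennreal \<delta>'"
    proof (rule order_trans[OF nn_integral_mono gF])
      fix x
      show "ennreal (norm (g x - F x) powr \<gamma>) * indicator (cball 0 R) x
          \<le> ennreal (norm (F x - g x) powr \<gamma>) * indicator (cball 0 (R + 1)) x"
        by (auto simp: indicator_def norm_minus_commute)
    qed
    have 3: "powr_integral \<gamma> (cball 0 R) (\<lambda>x. mollify \<eta> g x - g x) \<le> ennreal \<delta>'"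
    proof -
      have "powr_integral \<gamma> (cball 0 R) (\<lambda>x. mollify \<eta> g x - g x)
          \<le> (\<integral>\<^sup>+x. ennreal (t powr \<gamma>) * indicator (cball 0 R) (x::real^'n) \<partial>lebesgue)"
      proof (rule nn_integral_mono)
        fix x :: "real^'n"
        show "ennreal (norm (mollify \<eta> g x - g x) powr \<gamma>) * indicator (cball 0 R) x
            \<le> ennreal (t powr \<gamma>) * indicator (cball 0 R) x"
          using near[of x] \<open>\<gamma> > 1\<close> by (auto simp: indicator_def intro!: ennreal_leI powr_mono2)
      qed
      also have "\<dots> = ennreal (t powr \<gamma>) * emeasure lebesgue (cball (0::real^'n) R)"
        by (rule nn_integral_cmult_indicator) simp
      also have "emeasure lebesgue (cball (0::real^'n) R) = ennreal V"
        unfolding V_def by (rule emeasure_eq_measure2) (use emeasure_bounded_finite[of "cball (0::real^'n) R"] in auto)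
      also have "ennreal (t powr \<gamma>) * ennreal V = ennreal (t powr \<gamma> * V)"
        by (simp add: ennreal_mult')
      finally show ?thesis using ennreal_leI[OF tV] by (rule order_trans)
    qed
    have [measurable]: "mollify \<eta> g \<in> borel_measurable lebesgue" by (rule continuous_lebesgue_measurable[OF continuous_mollify[OF mo g]])
    have [measurable]: "mollify \<eta> (\<lambda>x. F x - g x) \<in> borel_measurable lebesgue"
      unfolding mollify_diff[OF mo F(1) gl, abs_def] by measurable
    have "powr_integral \<gamma> (cball 0 R) (\<lambda>x. mollify \<eta> F x - F x)
        \<le> ennreal (2 powr \<gamma> * (2 powr \<gamma> * (\<delta>' + \<delta>') + \<delta>'))"
      unfolding eq
      by (rule nn_integral_powr_triangle[OF _ _ _ _ _ _ nn_integral_powr_triangle[OF _ _ _ _ _ _ 1 2] 3])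
         (use \<open>\<delta>' > 0\<close> \<open>\<gamma> > 1\<close> in auto)
    also have "2 powr \<gamma> * (2 powr \<gamma> * (\<delta>' + \<delta>') + \<delta>') = (2 powr \<gamma> * (2 powr \<gamma> * 2 + 1)) * \<delta>'"
      by (simp add: algebra_simps)
    also have "\<dots> = \<delta>"
    proof -
      have "2 powr \<gamma> * (2 powr \<gamma> * 2 + 1) > (0::real)" by (intro mult_pos_pos add_pos_pos) auto
      then show ?thesis unfolding \<delta>'_def by (auto simp: zero_less_mult_iff)
    qed
    finally show "powr_integral \<gamma> (cball 0 R) (\<lambda>x. mollify \<eta> F x - F x) \<le> ennreal \<delta>" .
  qed
qed

section \<open>The weak comparison principle\<close>

text \<open>By the Cauchy-Schwarz inequality the pairing is at least \<open>(\<bar>a\<bar> powr (\<gamma> - 1) - \<bar>b\<bar> powr (\<gamma> - 1)) * (\<bar>a\<bar> - \<bar>b\<bar>)\<close>, and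
  \<open>t powr (\<gamma> - 1)\<close> is strictly increasing.\<close>

lemma flux_monotone:
  fixes a b :: "'a::real_inner"
  assumes "\<gamma> > 1"
  shows "0 \<le> ((norm a powr (\<gamma> - 2)) *\<^sub>R a - (norm b powr (\<gamma> - 2)) *\<^sub>R b) \<bullet> (a - b)"
    and "((norm a powr (\<gamma> - 2)) *\<^sub>R a - (norm b powr (\<gamma> - 2)) *\<^sub>R b) \<bullet> (a - b) = 0 \<Longrightarrow> a = b"
proof -
  let ?x = "norm a" and ?y = "norm b"
  let ?A = "?x powr (\<gamma> - 2)" and ?B = "?y powr (\<gamma> - 2)"
  let ?E = "(?A *\<^sub>R a - ?B *\<^sub>R b) \<bullet> (a - b)"
  have p: "t powr (\<gamma> - 2) * t = t powr (\<gamma> - 1)" if "t \<ge> 0" for t :: real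
    using powr_mult_base[OF that, of "\<gamma> - 2"] by (simp add: mult.commute)
  have aa: "a \<bullet> a = ?x * ?x" "b \<bullet> b = ?y * ?y" by (simp_all add: norm_eq_sqrt_inner)
  have E: "?E = (?x powr (\<gamma> - 1) - ?y powr (\<gamma> - 1)) * (?x - ?y) + (?A + ?B) * (?x * ?y - a \<bullet> b)"
    unfolding p[OF norm_ge_zero, symmetric]
    by (simp add: inner_diff_left inner_diff_right aa inner_commute algebra_simps)
  have mono: "0 \<le> (?x powr (\<gamma> - 1) - ?y powr (\<gamma> - 1)) * (?x - ?y)"
  proof (cases "?x \<le> ?y")
    case True
    then show ?thesis using assms by (intro mult_nonpos_nonpos) (auto intro!: powr_mono2)
  next
    case False
    then show ?thesis using assms by (intro mult_nonneg_nonneg) (auto intro!: powr_mono2)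
  qed
  have cs: "a \<bullet> b \<le> ?x * ?y" by (rule norm_cauchy_schwarz)
  have nn: "0 \<le> (?A + ?B) * (?x * ?y - a \<bullet> b)" using cs by simp
  show "0 \<le> ?E" unfolding E using mono nn by simp
  assume "?E = 0"
  then have z: "(?x powr (\<gamma> - 1) - ?y powr (\<gamma> - 1)) * (?x - ?y) = 0" "(?A + ?B) * (?x * ?y - a \<bullet> b) = 0"
    using E mono nn by linarith+
  have "?x = ?y"
  proof (rule ccontr)
    assume "?x \<noteq> ?y"
    then have "?x powr (\<gamma> - 1) \<noteq> ?y powr (\<gamma> - 1)"
      using assms powr_less_mono2[of "\<gamma> - 1" ?x ?y] powr_less_mono2[of "\<gamma> - 1" ?y ?x]
      by (cases "?x < ?y") auto
    with z(1) \<open>?x \<noteq> ?y\<close> show False by simp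
  qed
  show "a = b"
  proof (cases "a = 0")
    case True
    then show ?thesis using \<open>?x = ?y\<close> by simp
  next
    case False
    then have "?A > 0" by simp
    then have "a \<bullet> b = ?x * ?y" using z(2) \<open>?x = ?y\<close> by simp
    then show ?thesis using \<open>?x = ?y\<close> norm_cauchy_schwarz_eq[of a b] False by auto
  qed
qed

abbreviation powr_integrable :: "'a measure \<Rightarrow> 'a set \<Rightarrow> real \<Rightarrow> ('a \<Rightarrow> 'b::euclidean_space) \<Rightarrow> bool" where
  "powr_integrable M K a Z \<equiv> integrable M (\<lambda>x. indicator K x * norm (Z x) powr a)"

lemma powr_integrable_diff:
  fixes Y Z :: "'a \<Rightarrow> 'b::euclidean_space"
  assumes "a > 0" and [measurable]: "Z \<in> borel_measurable M" "Y \<in> borel_measurable M" "K \<in> sets M"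
    and "powr_integrable M K a Z" "powr_integrable M K a Y"
  shows "powr_integrable M K a (\<lambda>x. Z x - Y x)"
proof (rule Bochner_Integration.integrable_bound)
  show "integrable M (\<lambda>x. 2 powr a * (indicator K x * norm (Z x) powr a + indicator K x * norm (Y x) powr a))"
    using assms by simp
  have "indicator K x * norm (Z x - Y x) powr a
      \<le> 2 powr a * (indicator K x * norm (Z x) powr a + indicator K x * norm (Y x) powr a)" for x
    using norm_add_powr_le[of a "Z x" "- Y x"] assms(1) by (simp add: indicator_def)
  then show "AE x in M. norm (indicator K x * norm (Z x - Y x) powr a)
      \<le> norm (2 powr a * (indicator K x * norm (Z x) powr a + indicator K x * norm (Y x) powr a))"
    by (intro always_eventually allI) (auto intro: order_trans[OF _ abs_ge_self])
qed measurable

text \<open>A form of Young's inequality with explicit constants: the first term on the right dominates when \<open>b\<close> is small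
  compared with \<open>a powr (1 / (\<gamma> - 1))\<close>, the second one otherwise.\<close>

lemma product_le_powr_sum:
  fixes a b t :: real
  assumes "\<gamma> > 1" "t > 0" "a \<ge> 0" "b \<ge> 0"
  shows "a * b \<le> t * a powr (\<gamma> / (\<gamma> - 1)) + t powr (1 - \<gamma>) * b powr \<gamma>"
proof (cases "b \<le> t * a powr (1 / (\<gamma> - 1))")
  case True
  have "a * b \<le> a * (t * a powr (1 / (\<gamma> - 1)))" using True assms by (intro mult_left_mono)
  also have "\<dots> = t * a powr (1 + 1 / (\<gamma> - 1))"
    using powr_mult_base[OF \<open>a \<ge> 0\<close>] by simp
  also have "1 + 1 / (\<gamma> - 1) = \<gamma> / (\<gamma> - 1)" using assms by (simp add: field_simps)
  finally show ?thesis by (smt (verit) powr_ge_zero mult_nonneg_nonneg)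
next
  case False
  then have "a powr (1 / (\<gamma> - 1)) \<le> b / t" using assms by (simp add: field_simps)
  then have "(a powr (1 / (\<gamma> - 1))) powr (\<gamma> - 1) \<le> (b / t) powr (\<gamma> - 1)"
    using assms by (intro powr_mono2) auto
  then have "a \<le> (b / t) powr (\<gamma> - 1)" using assms by (simp add: powr_powr)
  also have "\<dots> = t powr (1 - \<gamma>) * b powr (\<gamma> - 1)"
    using assms by (simp add: powr_divide powr_minus_divide[of t "\<gamma> - 1", simplified])
  finally have "a * b \<le> t powr (1 - \<gamma>) * b powr (\<gamma> - 1) * b"
    using assms by (intro mult_right_mono) auto
  also have "\<dots> = t powr (1 - \<gamma>) * b powr \<gamma>"
    using powr_mult_base[OF \<open>b \<ge> 0\<close>, of "\<gamma> - 1"] by (simp add: mult.commute mult.left_commute)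
  finally show ?thesis using assms by (smt (verit) powr_ge_zero mult_nonneg_nonneg)
qed

lemma integral_inner_powr_bound:
  fixes \<Psi> Y :: "'a::euclidean_space \<Rightarrow> 'b::euclidean_space"
  assumes "\<gamma> > 1" and [measurable]: "\<Psi> \<in> borel_measurable M" "Y \<in> borel_measurable M" "q \<in> borel_measurable M"
    and P: "powr_integrable M K (\<gamma> / (\<gamma> - 1)) \<Psi>"
    and Y: "powr_integrable M K \<gamma> Y"
    and q: "\<And>x. x \<notin> K \<Longrightarrow> q x = 0" "\<And>x. \<bar>q x\<bar> \<le> Q"
  shows "integrable M (\<lambda>x. q x * (\<Psi> x \<bullet> Y x))"
    and "t > 0 \<Longrightarrow> \<bar>LINT x|M. q x * (\<Psi> x \<bullet> Y x)\<bar>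
      \<le> Q * (t * (LINT x|M. indicator K x * norm (\<Psi> x) powr (\<gamma> / (\<gamma> - 1)))
             + t powr (1 - \<gamma>) * (LINT x|M. indicator K x * norm (Y x) powr \<gamma>))"
proof -
  let ?B = "\<lambda>t x. Q * (t * (indicator K x * norm (\<Psi> x) powr (\<gamma> / (\<gamma> - 1)))
      + t powr (1 - \<gamma>) * (indicator K x * norm (Y x) powr \<gamma>))"
  have bound: "\<bar>q x * (\<Psi> x \<bullet> Y x)\<bar> \<le> ?B t x" if "t > 0" for t x
  proof (cases "x \<in> K")
    case True
    have "\<bar>\<Psi> x \<bullet> Y x\<bar> \<le> norm (\<Psi> x) * norm (Y x)" by (rule Cauchy_Schwarz_ineq2)
    also have "\<dots> \<le> t * norm (\<Psi> x) powr (\<gamma> / (\<gamma> - 1)) + t powr (1 - \<gamma>) * norm (Y x) powr \<gamma>"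
      using product_le_powr_sum[of \<gamma> t "norm (\<Psi> x)" "norm (Y x)"] assms(1) that by simp
    finally show ?thesis
      using True q(2)[of x] by (auto simp: abs_mult intro!: mult_mono)
  qed (simp add: q)
  have int: "integrable M (?B t)" for t using P Y by simp
  show i: "integrable M (\<lambda>x. q x * (\<Psi> x \<bullet> Y x))"
    by (rule Bochner_Integration.integrable_bound[OF int[of 1]])
       (use bound[of 1] in \<open>auto intro!: always_eventually intro: order_trans[OF _ abs_ge_self]\<close>)
  assume "t > 0"
  then have "\<bar>LINT x|M. q x * (\<Psi> x \<bullet> Y x)\<bar> \<le> (LINT x|M. ?B t x)"
    by (intro Bochner_Integration.integral_abs_bound_integral i int bound)
  also have "\<dots> = Q * (t * (LINT x|M. indicator K x * norm (\<Psi> x) powr (\<gamma> / (\<gamma> - 1)))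
             + t powr (1 - \<gamma>) * (LINT x|M. indicator K x * norm (Y x) powr \<gamma>))"
    using P Y by simp
  finally show "\<bar>LINT x|M. q x * (\<Psi> x \<bullet> Y x)\<bar>
      \<le> Q * (t * (LINT x|M. indicator K x * norm (\<Psi> x) powr (\<gamma> / (\<gamma> - 1)))
             + t powr (1 - \<gamma>) * (LINT x|M. indicator K x * norm (Y x) powr \<gamma>))" .
qed

text \<open>Strong convergence of \<open>Yk\<close> in \<open>L\<^sup>\<gamma>\<close> is paired with a fixed \<open>\<Psi>\<close> in the dual space; in Young's inequality the
  parameter \<open>t\<close> is chosen first, to make the contribution of \<open>\<Psi>\<close> alone small.\<close>

lemma integral_inner_powr_tendsto:
  fixes \<Psi> Y :: "'a::euclidean_space \<Rightarrow> 'b::euclidean_space" and Yk :: "nat \<Rightarrow> 'a \<Rightarrow> 'b"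
  assumes "\<gamma> > 1"
    and [measurable]: "\<Psi> \<in> borel_measurable M" "Y \<in> borel_measurable M" "\<And>k. Yk k \<in> borel_measurable M"
      "q \<in> borel_measurable M" "\<And>k. qk k \<in> borel_measurable M"
    and P: "powr_integrable M K (\<gamma> / (\<gamma> - 1)) \<Psi>"
    and Y: "powr_integrable M K \<gamma> Y"
    and Yk: "\<And>k. powr_integrable M K \<gamma> (\<lambda>x. Yk k x - Y x)"
      "(\<lambda>k. LINT x|M. indicator K x * norm (Yk k x - Y x) powr \<gamma>) \<longlonglongrightarrow> 0"
    and q: "\<And>x. x \<notin> K \<Longrightarrow> q x = 0" "\<And>x. \<bar>q x\<bar> \<le> Q"
    and qk: "\<And>k x. x \<notin> K \<Longrightarrow> qk k x = 0" "\<And>k x. \<bar>qk k x - q x\<bar> \<le> \<tau> k" "\<tau> \<longlonglongrightarrow> 0"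
  shows "(\<lambda>k. LINT x|M. qk k x * (\<Psi> x \<bullet> Yk k x)) \<longlonglongrightarrow> (LINT x|M. q x * (\<Psi> x \<bullet> Y x))"
    and "\<And>k. integrable M (\<lambda>x. qk k x * (\<Psi> x \<bullet> Yk k x))"
proof -
  define L where "L k = (LINT x|M. indicator K x * norm (Yk k x - Y x) powr \<gamma>)" for k
  define N where "N = (LINT x|M. indicator K x * norm (\<Psi> x) powr (\<gamma> / (\<gamma> - 1)))"
  define B where "B = N + (LINT x|M. indicator K x * norm (Y x) powr \<gamma>)"
  have Q: "Q \<ge> 0" using q(2)[of undefined] by linarith
  have \<tau>: "\<tau> k \<ge> 0" for k using qk(2)[of k undefined] by linarith
  have qkQ: "\<bar>qk k x\<bar> \<le> Q + \<tau> k" for k x using q(2)[of x] qk(2)[of k x] by linarith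
  have i1: "integrable M (\<lambda>x. q x * (\<Psi> x \<bullet> Y x))"
    by (rule integral_inner_powr_bound[OF assms(1) _ _ _ P Y q]) auto
  have i2: "integrable M (\<lambda>x. (qk k x - q x) * (\<Psi> x \<bullet> Y x))"
    and e2: "\<bar>LINT x|M. (qk k x - q x) * (\<Psi> x \<bullet> Y x)\<bar> \<le> \<tau> k * B" for k
  proof -
    note b = integral_inner_powr_bound[OF assms(1) _ _ _ P Y _ qk(2)]
    show "integrable M (\<lambda>x. (qk k x - q x) * (\<Psi> x \<bullet> Y x))" by (rule b(1)) (auto simp: q qk)
    show "\<bar>LINT x|M. (qk k x - q x) * (\<Psi> x \<bullet> Y x)\<bar> \<le> \<tau> k * B"
      by (rule order_trans[OF b(2)[where t = 1]]) (auto simp: q qk N_def B_def)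
  qed
  have i3: "integrable M (\<lambda>x. qk k x * (\<Psi> x \<bullet> (Yk k x - Y x)))"
    and e1: "t > 0 \<Longrightarrow> \<bar>LINT x|M. qk k x * (\<Psi> x \<bullet> (Yk k x - Y x))\<bar>
      \<le> (Q + \<tau> k) * (t * N + t powr (1 - \<gamma>) * L k)" for k t
    unfolding N_def L_def
    by (rule integral_inner_powr_bound[OF assms(1) _ _ _ P Yk(1) qk(1) qkQ]; simp)+
  have eq: "qk k x * (\<Psi> x \<bullet> Yk k x)
      = qk k x * (\<Psi> x \<bullet> (Yk k x - Y x)) + (qk k x - q x) * (\<Psi> x \<bullet> Y x) + q x * (\<Psi> x \<bullet> Y x)" for k x
    by (simp add: inner_diff_right algebra_simps)
  show "integrable M (\<lambda>x. qk k x * (\<Psi> x \<bullet> Yk k x))" for k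
    unfolding eq using i1 i2 i3 by simp
  have bound: "\<bar>(LINT x|M. qk k x * (\<Psi> x \<bullet> Yk k x)) - (LINT x|M. q x * (\<Psi> x \<bullet> Y x))\<bar>
      \<le> (Q + \<tau> k) * (t * N + t powr (1 - \<gamma>) * L k) + \<tau> k * B" if "t > 0" for k t
  proof -
    have "(LINT x|M. qk k x * (\<Psi> x \<bullet> Yk k x)) - (LINT x|M. q x * (\<Psi> x \<bullet> Y x))
        = (LINT x|M. qk k x * (\<Psi> x \<bullet> (Yk k x - Y x))) + (LINT x|M. (qk k x - q x) * (\<Psi> x \<bullet> Y x))"
      unfolding eq[of k] using i1 i2 i3 by simp
    then show ?thesis using e1[OF that, of k] e2[of k] by linarith
  qed
  show "(\<lambda>k. LINT x|M. qk k x * (\<Psi> x \<bullet> Yk k x)) \<longlonglongrightarrow> (LINT x|M. q x * (\<Psi> x \<bullet> Y x))"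
  proof (rule tendstoI)
    fix e :: real assume "e > 0"
    have N: "N \<ge> 0" unfolding N_def by (rule Bochner_Integration.integral_nonneg) auto
    define t where "t = e / (2 * (Q * N + 1))"
    have QN: "Q * N \<ge> 0" using Q N by simp
    then have t: "t > 0" using \<open>e > 0\<close> by (simp add: t_def)
    have "Q * (t * N) = e * (Q * N) / (2 * (Q * N + 1))" by (simp add: t_def)
    also have "\<dots> < e"
    proof -
      have "X < 2 * (X + 1)" if "X \<ge> 0" for X :: real using that by (simp add: distrib_left)
      from this[OF QN] have "e * (Q * N) < e * (2 * (Q * N + 1))" using \<open>e > 0\<close> by (rule mult_strict_left_mono)
      then show ?thesis using QN by (subst pos_divide_less_eq) auto
    qed
    finally have lt: "Q * (t * N) < e" .
    have L0: "L \<longlonglongrightarrow> 0" using Yk(2) by (simp add: L_def[abs_def])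
    have "(\<lambda>k. (Q + \<tau> k) * (t * N + t powr (1 - \<gamma>) * L k) + \<tau> k * B)
        \<longlonglongrightarrow> (Q + 0) * (t * N + t powr (1 - \<gamma>) * 0) + 0 * B"
      by (intro tendsto_intros qk(3) L0)
    then have "\<forall>\<^sub>F k in sequentially. (Q + \<tau> k) * (t * N + t powr (1 - \<gamma>) * L k) + \<tau> k * B < e"
      by (rule order_tendstoD(2)) (use lt in simp)
    then show "\<forall>\<^sub>F k in sequentially. dist (LINT x|M. qk k x * (\<Psi> x \<bullet> Yk k x)) (LINT x|M. q x * (\<Psi> x \<bullet> Y x)) < e"
      by eventually_elim (use bound[OF t] in \<open>auto simp: dist_real_def intro: le_less_trans\<close>)
  qed
qed

lemma continuous_on_zero_extension:
  fixes f :: "'a::t2_space \<Rightarrow> 'b::{t2_space,zero}"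
  assumes "open \<Omega>" "compact K" "K \<subseteq> \<Omega>" "continuous_on \<Omega> f" "\<And>x. x \<in> \<Omega> \<Longrightarrow> x \<notin> K \<Longrightarrow> f x = 0"
  shows "continuous_on UNIV (\<lambda>x. if x \<in> \<Omega> then f x else 0)" (is "continuous_on UNIV ?g")
proof -
  have "continuous_on \<Omega> ?g" by (rule continuous_on_eq[OF assms(4)]) simp
  moreover have "continuous_on (- K) ?g"
    by (rule continuous_on_eq[OF continuous_on_const[of _ 0]]) (use assms(5) in auto)
  ultimately have "continuous_on (\<Omega> \<union> - K) ?g"
    using assms by (intro continuous_on_open_Un) (auto simp: compact_imp_closed open_Compl)
  moreover have "\<Omega> \<union> - K = UNIV" using assms(3) by blast
  ultimately show ?thesis by simp
qed

lemma test_function_zero_extension: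
  fixes f :: "real^'n \<Rightarrow> real"
  assumes "open \<Omega>" "compact K" "K \<subseteq> \<Omega>" "\<And>x. x \<in> \<Omega> \<Longrightarrow> GDERIV f x :> D x" "continuous_on \<Omega> D"
    and zero: "\<And>x. x \<in> \<Omega> \<Longrightarrow> x \<notin> K \<Longrightarrow> f x = 0 \<and> D x = 0"
  shows "test_function (\<lambda>x. if x \<in> \<Omega> then f x else 0) (\<lambda>x. if x \<in> \<Omega> then D x else 0)"
  unfolding test_function_def
proof (intro conjI allI)
  let ?f = "\<lambda>x. if x \<in> \<Omega> then f x else 0" and ?D = "\<lambda>x. if x \<in> \<Omega> then D x else 0"
  show "continuous_on UNIV ?D"
    by (rule continuous_on_zero_extension[OF assms(1-3,5)]) (use zero in blast)
  have "{x. ?f x \<noteq> 0} \<subseteq> K" using zero by (auto split: if_splits)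
  then show "compact (closure {x. ?f x \<noteq> 0})"
    using compact_imp_bounded[OF assms(2)] bounded_subset by (simp only: compact_closure) blast
  fix x
  show "GDERIV ?f x :> ?D x"
  proof (cases "x \<in> \<Omega>")
    case True
    have "(f has_derivative (\<lambda>h. h \<bullet> D x)) (at x)" using assms(4)[OF True] by (simp add: gderiv_def)
    then have "(?f has_derivative (\<lambda>h. h \<bullet> D x)) (at x)"
      by (rule has_derivative_transform_within_open[OF _ assms(1) True]) simp
    then show ?thesis using True by (simp add: gderiv_def)
  next
    case False
    then have "x \<in> - K" using assms(3) by blast
    have "open (- K)" using assms(2) by (simp add: compact_imp_closed open_Compl)
    have "(?f has_derivative (\<lambda>h. 0)) (at x)"
    proof (rule has_derivative_transform_within_open[OF has_derivative_const \<open>open (- K)\<close> \<open>x \<in> - K\<close>])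
      fix y assume "y \<in> - K"
      then show "0 = ?f y" using zero[of y] by auto
    qed
    then show ?thesis using False by (simp add: gderiv_def)
  qed
qed

lemma integrable_continuous_on_compact:
  fixes f :: "real^'n \<Rightarrow> 'b::euclidean_space"
  assumes "compact K" "continuous_on K f"
  shows "integrable lebesgue (\<lambda>x. indicator K x *\<^sub>R f x)"
proof -
  have "integrable lborel (\<lambda>x. indicator K x *\<^sub>R f x)"
    using borel_integrable_compact[OF assms] by (simp add: indicator_scaleR_eq_if cong: if_cong)
  then show ?thesis by (simp add: integrable_completion borel_measurable_integrable)
qed

text \<open>The uniform closeness keeps the supports of the test functions made from these approximations in one compact set; the
  convergence of the gradients is in the norm dual to the integrability of the flux.\<close>

lemma sobolev_mollifier_sequence:
  fixes u :: "real^'n \<Rightarrow> real"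
  assumes "\<gamma> > 1" "continuous_on UNIV u" "sobolev_loc \<gamma> u G" "\<rho> > 0"
  obtains uk Gk where "\<And>k x. GDERIV (uk k) x :> Gk k x" "\<And>k. continuous_on UNIV (Gk k)"
    "\<And>k x. x \<in> cball 0 R \<Longrightarrow> \<bar>uk k x - u x\<bar> \<le> min \<rho> (1 / real (Suc k))"
    "\<And>k. powr_integral \<gamma> (cball 0 R) (\<lambda>x. Gk k x - G x) \<le> ennreal (1 / real (Suc k))"
proof -
  have G: "has_weak_gradient u G" "locally_integrable G" "locally_integrable (\<lambda>x. norm (G x) powr \<gamma>)"
    using assms(3) by (auto simp: sobolev_loc_def has_weak_gradient_def)
  define P where "P k uk Gk \<longleftrightarrow> (\<forall>x. GDERIV uk x :> Gk x) \<and> continuous_on UNIV Gk \<and>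
     (\<forall>x\<in>cball 0 R. \<bar>uk x - u x\<bar> \<le> min \<rho> (1 / real (Suc k))) \<and>
     powr_integral \<gamma> (cball 0 R) (\<lambda>x. Gk x - G x) \<le> ennreal (1 / real (Suc k))"
    for k uk Gk
  have "\<exists>w. P k (fst w) (snd w)" for k
  proof -
    have pos: "min \<rho> (1 / real (Suc k)) > 0" "1 / real (Suc k) > 0" using assms(4) by auto
    obtain d where d: "d > 0" "\<And>\<epsilon> \<eta> H x. mollifier \<epsilon> \<eta> H \<Longrightarrow> \<epsilon> \<le> d \<Longrightarrow> x \<in> cball 0 R \<Longrightarrow> norm (mollify \<eta> u x - u x) \<le> min \<rho> (1 / real (Suc k))"
      using mollify_uniform_convergence[OF assms(2) pos(1), of R] by blast
    obtain d' where d': "d' > 0" "\<And>\<epsilon> \<eta> H. mollifier \<epsilon> \<eta> H \<Longrightarrow> \<epsilon> \<le> d' \<Longrightarrow> continuous_on UNIV (mollify \<eta> G) \<Longrightarrow>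
      powr_integral \<gamma> (cball 0 R) (\<lambda>x. mollify \<eta> G x - G x) \<le> ennreal (1 / real (Suc k))"
      using mollify_powr_convergence[OF G(2,3) assms(1) pos(2), of R] by blast
    obtain \<eta> :: "real^'n \<Rightarrow> real" and H where mo: "mollifier (min d d') \<eta> H"
      using mollifier_exists[of "min d d'"] d(1) d'(1) by auto
    note C1 = mollify_C1[OF mo assms(2) G(1)]
    have "P k (mollify \<eta> u) (mollify \<eta> G)"
      unfolding P_def
      using C1 d(2)[OF mo] d'(2)[OF mo _ C1(2)] by (simp add: real_norm_def[symmetric] del: real_norm_def)
    then show ?thesis by (intro exI[of _ "(mollify \<eta> u, mollify \<eta> G)"]) simp
  qed
  then have "\<forall>k. \<exists>w. P k (fst w) (snd w)" by blast
  from choice[OF this] obtain w where w: "\<And>k. P k (fst (w k)) (snd (w k))" by blast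
  show ?thesis
    by (rule that[of "\<lambda>k. fst (w k)" "\<lambda>k. snd (w k)"]) (use w in \<open>simp_all add: P_def\<close>)
qed

text \<open>Suppose that \<open>w\<close> exceeds \<open>u\<close> somewhere. The equations are tested with the square of the positive part of
  \<open>w - u - \<delta>\<close>, which has compact support in \<open>\<Omega>\<close> because \<open>w \<le> u\<close> on the boundary. This is not a \<open>C\<^sup>1\<close> function, so \<open>u\<close> is
  first replaced by its mollifications; then the limit needs only their convergence in the Sobolev norm and no
  chain rule for weak derivatives. By monotonicity of the nonlinearity the two gradients agree where \<open>w > u + \<delta>\<close>, so
  the tested function has gradient zero, and having compact support it vanishes.\<close>

theorem weak_comparison_principle:
  fixes u w s f :: "real^'n \<Rightarrow> real"
  assumes "\<gamma> > 1" and sol: "positive_solution \<gamma> u f"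
    and \<Omega>: "open \<Omega>" "bounded \<Omega>"
    and w: "\<And>x. x \<in> \<Omega> \<Longrightarrow> GDERIV w x :> W x" "continuous_on \<Omega> W"
    and flux: "\<And>x. x \<in> \<Omega> \<Longrightarrow> (norm (W x) powr (\<gamma> - 2)) *\<^sub>R W x = s x *\<^sub>R x"
    and s: "\<And>x. x \<in> \<Omega> \<Longrightarrow> GDERIV s x :> S x" "continuous_on \<Omega> S"
    and le: "\<And>x. x \<in> \<Omega> \<Longrightarrow> - (real CARD('n) * s x + S x \<bullet> x) \<le> f x"
    and bd: "continuous_on (closure \<Omega>) w" "\<And>x. x \<in> frontier \<Omega> \<Longrightarrow> w x \<le> u x"
    and "x0 \<in> \<Omega>"
  shows "w x0 \<le> u x0"
proof (rule ccontr)
  obtain G where u: "continuous_on UNIV u" "sobolev_loc \<gamma> u G"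
    and divu: "has_weak_divergence (\<lambda>x. (norm (G x) powr (\<gamma> - 2)) *\<^sub>R G x) (\<lambda>x. - f x)"
    using sol by (auto simp: positive_solution_def has_gamma_Laplacian_def)
  assume "\<not> w x0 \<le> u x0"
  define \<delta> where "\<delta> = (w x0 - u x0) / 2"
  have \<delta>: "\<delta> > 0" using \<open>\<not> w x0 \<le> u x0\<close> by (simp add: \<delta>_def)
  define K where "K = {x \<in> closure \<Omega>. \<delta> / 2 \<le> w x - u x}"
  have cwu: "continuous_on (closure \<Omega>) (\<lambda>x. w x - u x)"
    by (intro continuous_intros bd continuous_on_subset[OF u(1)]) auto
  have K: "compact K"
  proof -
    have "compact (closure \<Omega>)" using \<Omega>(2) by simp
    moreover have "closed K"
      unfolding K_def by (rule continuous_on_closed_Collect_le[OF continuous_on_const cwu closed_closure])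
    moreover have "K \<subseteq> closure \<Omega>" by (auto simp: K_def)
    ultimately show ?thesis by (metis closed_Int_compact inf.absorb_iff1)
  qed
  have K\<Omega>: "K \<subseteq> \<Omega>"
    using bd(2) \<delta> \<Omega>(1) by (force simp: K_def frontier_def interior_open)
  obtain R where R: "\<Omega> \<subseteq> cball 0 R"
    using \<Omega>(2) bounded_subset_ballD[of \<Omega> 0] ball_subset_cball by blast
  obtain uk Gk where uk: "\<And>k x. GDERIV (uk k) x :> Gk k x" and Gk: "\<And>k. continuous_on UNIV (Gk k)"
    and near: "\<And>k x. x \<in> cball 0 R \<Longrightarrow> \<bar>uk k x - u x\<bar> \<le> min (\<delta> / 2) (1 / real (Suc k))"
    and Gconv: "\<And>k. powr_integral \<gamma> (cball 0 R) (\<lambda>x. Gk k x - G x) \<le> ennreal (1 / real (Suc k))"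
    using sobolev_mollifier_sequence[OF assms(1) u, of "\<delta> / 2" R] \<delta> by (auto simp del: of_nat_Suc)
  have cuk: "continuous_on UNIV (uk k)" for k
    using uk[of k] by (rule continuous_on_gderiv)
  have cw: "continuous_on \<Omega> w" using bd(1) by (rule continuous_on_subset) (rule closure_subset)

  \<comment> \<open>The cut-off excess \<open>m\<close> of \<open>w\<close> over \<open>u + \<delta>\<close>; the test functions are the squares of its approximations \<open>mk k\<close>.\<close>
  define cut where "cut z x = (if x \<in> \<Omega> then max 0 (w x - z x - \<delta>) else 0)" for z x
  define mk where "mk k = cut (uk k)" for k
  define m where "m = cut u"
  have cut_off: "cut z x = 0" if "x \<notin> K" "\<And>x. x \<in> \<Omega> \<Longrightarrow> \<bar>z x - u x\<bar> \<le> \<delta> / 2" for z x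
  proof (cases "x \<in> \<Omega>")
    case True
    then have "w x - u x < \<delta> / 2" using that closure_subset[of \<Omega>] by (auto simp: K_def)
    then have "w x - z x - \<delta> < 0" using that(2)[OF True] \<delta> by linarith
    then show ?thesis by (simp add: cut_def)
  qed (simp add: cut_def)
  have cut_cont: "continuous_on UNIV (cut z)"
    if "continuous_on UNIV z" "\<And>x. x \<in> \<Omega> \<Longrightarrow> \<bar>z x - u x\<bar> \<le> \<delta> / 2" for z
    unfolding cut_def
  proof (rule continuous_on_zero_extension[OF \<Omega>(1) K K\<Omega>])
    show "continuous_on \<Omega> (\<lambda>x. max 0 (w x - z x - \<delta>))"
      by (intro continuous_intros cw continuous_on_subset[OF that(1)]) auto
    show "max 0 (w x - z x - \<delta>) = 0" if "x \<in> \<Omega>" "x \<notin> K" for x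
      using cut_off[OF that(2), of z] \<open>\<And>x. x \<in> \<Omega> \<Longrightarrow> \<bar>z x - u x\<bar> \<le> \<delta> / 2\<close> that(1) by (simp add: cut_def)
  qed
  have near': "\<bar>uk k x - u x\<bar> \<le> \<delta> / 2" "\<bar>u x - u x\<bar> \<le> \<delta> / 2" if "x \<in> \<Omega>" for k x
    using near[of x k] that R \<delta> by auto
  have mk_off: "mk k x = 0" and m_off: "m x = 0" if "x \<notin> K" for k x
    using cut_off[OF that, of "uk k"] cut_off[OF that, of u] near' by (auto simp: mk_def m_def)
  have cmk: "continuous_on UNIV (mk k)" and cm: "continuous_on UNIV m" for k
    using cut_cont[OF cuk[of k]] cut_cont[OF u(1)] near' by (auto simp: mk_def m_def)
  have mk_near: "\<bar>mk k x - m x\<bar> \<le> 1 / real (Suc k)" for k x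
  proof (cases "x \<in> \<Omega>")
    case True
    then have "\<bar>uk k x - u x\<bar> \<le> 1 / real (Suc k)" using near[of x k] R by auto
    moreover have "\<bar>max 0 (w x - uk k x - \<delta>) - max 0 (w x - u x - \<delta>)\<bar> \<le> \<bar>uk k x - u x\<bar>"
      by (auto simp: max_def)
    ultimately show ?thesis using True unfolding mk_def m_def cut_def by (simp del: of_nat_Suc)
  qed (simp add: mk_def m_def cut_def)
  obtain Q where Q: "\<And>x. \<bar>m x\<bar> \<le> Q"
  proof -
    have "bounded (m ` K)" by (rule compact_imp_bounded[OF compact_continuous_image[OF continuous_on_subset[OF cm] K]]) simp
    then obtain Q where "Q > 0" "\<forall>x\<in>K. \<bar>m x\<bar> \<le> Q" by (auto simp: bounded_pos)
    then have "\<bar>m x\<bar> \<le> Q" for x using m_off[of x] by (cases "x \<in> K") auto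
    then show ?thesis by (rule that)
  qed
  have mkQ: "\<bar>mk k x\<bar> \<le> Q + 1" for k x
  proof -
    have "1 / real (Suc k) \<le> 1" by simp
    then show ?thesis using Q[of x] mk_near[of k x] by linarith
  qed
  have m_meas: "m \<in> borel_measurable lebesgue"
    by (rule continuous_lebesgue_measurable[OF cm])
  have mk_meas: "mk k \<in> borel_measurable lebesgue" for k
    by (rule continuous_lebesgue_measurable[OF cmk[of k]])
  define \<psi> where "\<psi> k x = (mk k x)\<^sup>2" for k x
  define D where "D k x = (2 * mk k x) *\<^sub>R (W x - Gk k x)" for k x
  have tf: "test_function (\<psi> k) (D k)" for k
  proof -
    let ?f = "\<lambda>x. (max 0 (w x - uk k x - \<delta>))\<^sup>2" and ?D = "\<lambda>x. (2 * max 0 (w x - uk k x - \<delta>)) *\<^sub>R (W x - Gk k x)"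
    have "test_function (\<lambda>x. if x \<in> \<Omega> then ?f x else 0) (\<lambda>x. if x \<in> \<Omega> then ?D x else 0)"
    proof (rule test_function_zero_extension[OF \<Omega>(1) K K\<Omega>])
      fix x assume x: "x \<in> \<Omega>"
      have "GDERIV (\<lambda>x. w x - uk k x - \<delta>) x :> W x - Gk k x"
        using w(1)[OF x] uk[of k x] unfolding gderiv_def
        by (auto intro!: derivative_eq_intros simp: inner_diff_right)
      from GDERIV_DERIV_compose[OF this has_real_derivative_pos_part_square]
      show "GDERIV ?f x :> ?D x" by simp
    next
      show "continuous_on \<Omega> ?D"
        by (intro continuous_intros cw w(2) continuous_on_subset[OF cuk] continuous_on_subset[OF Gk]) auto
    next
      fix x assume "x \<in> \<Omega>" "x \<notin> K"
      then have "max 0 (w x - uk k x - \<delta>) = 0" using mk_off[of x k] by (simp add: mk_def cut_def)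
      then show "?f x = 0 \<and> ?D x = 0" by simp
    qed
    moreover have "(\<lambda>x. if x \<in> \<Omega> then ?f x else 0) = \<psi> k" "(\<lambda>x. if x \<in> \<Omega> then ?D x else 0) = D k"
      by (auto simp: fun_eq_iff \<psi>_def D_def mk_def cut_def)
    ultimately show ?thesis by simp
  qed
  have supp: "closure {x. \<psi> k x \<noteq> 0} \<subseteq> \<Omega>" for k
  proof -
    have "{x. \<psi> k x \<noteq> 0} \<subseteq> K" using mk_off by (auto simp: \<psi>_def)
    then have "closure {x. \<psi> k x \<noteq> 0} \<subseteq> K" using K by (intro closure_minimal) (auto simp: compact_imp_closed)
    then show ?thesis using K\<Omega> by blast
  qed

  \<comment> \<open>Cutting off all fields outside \<open>K\<close> makes them globally defined.\<close>
  define A where "A x = (norm (G x) powr (\<gamma> - 2)) *\<^sub>R G x" for x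
  define Wb where "Wb x = indicator K x *\<^sub>R W x" for x
  define V where "V x = indicator K x *\<^sub>R (s x *\<^sub>R x)" for x
  define X where "X x = indicator K x *\<^sub>R x" for x :: "real^'n"
  have G: "locally_integrable G" "locally_integrable (\<lambda>x. norm (G x) powr \<gamma>)"
    using u(2) by (auto simp: sobolev_loc_def has_weak_gradient_def)
  have G_meas[measurable]: "G \<in> borel_measurable lebesgue" by (rule locally_integrable_measurable[OF G(1)])
  have A_meas[measurable]: "A \<in> borel_measurable lebesgue"
    using divu unfolding has_weak_divergence_def A_def[abs_def, symmetric]
    by (blast intro: locally_integrable_measurable)
  have f_li: "locally_integrable (\<lambda>x. - f x)" using divu by (simp add: has_weak_divergence_def)
  have cs: "continuous_on \<Omega> s"
    using s(1) by (rule continuous_on_gderiv)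
  have cb: "continuous_on K W" "continuous_on K (\<lambda>x. s x *\<^sub>R x)" "continuous_on K (\<lambda>x::real^'n. x)"
    using K\<Omega> by (auto intro!: continuous_intros continuous_on_subset[OF cs] continuous_on_subset[OF w(2)])
  have Wb_meas[measurable]: "Wb \<in> borel_measurable lebesgue" and V_meas[measurable]: "V \<in> borel_measurable lebesgue"
    and X_meas[measurable]: "X \<in> borel_measurable lebesgue"
    using integrable_continuous_on_compact[OF K cb(1)] integrable_continuous_on_compact[OF K cb(2)]
      integrable_continuous_on_compact[OF K cb(3)]
    unfolding Wb_def[abs_def] V_def[abs_def] X_def[abs_def] by (auto intro: borel_measurable_integrable)
  have Gk_meas[measurable]: "Gk k \<in> borel_measurable lebesgue" for k
    by (rule continuous_lebesgue_measurable[OF Gk[of k]])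
  have Ks[measurable]: "K \<in> sets lebesgue" using K by (simp add: lmeasurable_compact fmeasurableD)
  have int_powr: "powr_integrable lebesgue K a Z"
    if "continuous_on K Z" "a > 0" for Z :: "real^'n \<Rightarrow> real^'n" and a
  proof -
    have "continuous_on K (\<lambda>x. norm (Z x) powr a)"
      using that by (intro continuous_on_powr' continuous_intros) auto
    from integrable_continuous_on_compact[OF K this] show ?thesis by simp
  qed
  have ind: "indicator K x * norm (indicator K x *\<^sub>R Z) powr a = indicator K x * norm Z powr a"
    for x :: "real^'n" and Z :: "real^'n" and a by (simp add: indicator_def)
  have \<gamma>': "\<gamma> / (\<gamma> - 1) > 0" using assms(1) by simp
  have GK: "powr_integrable lebesgue K \<gamma> G"
    using G(2) K by (simp add: locally_integrable_def set_integrable_def)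
  have AK: "powr_integrable lebesgue K (\<gamma> / (\<gamma> - 1)) A"
  proof -
    have "norm (A x) powr (\<gamma> / (\<gamma> - 1)) = norm (G x) powr \<gamma>" for x
    proof -
      have "norm (A x) = norm (G x) powr (\<gamma> - 1)"
        using powr_mult_base[of "norm (G x)" "\<gamma> - 2"] by (simp add: A_def mult.commute)
      then show ?thesis using assms(1) by (simp add: powr_powr)
    qed
    then show ?thesis using GK by simp
  qed
  define Y where "Y x = Wb x - G x" for x
  define Yk where "Yk k x = Wb x - Gk k x" for k x
  have [measurable]: "Y \<in> borel_measurable lebesgue" "Yk k \<in> borel_measurable lebesgue" for k
    unfolding Y_def[abs_def] Yk_def[abs_def] by measurable
  have WbK: "powr_integrable lebesgue K \<gamma> Wb"
    unfolding Wb_def ind by (rule int_powr) (use cb assms(1) in auto)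
  have YK: "powr_integrable lebesgue K \<gamma> Y"
    unfolding Y_def by (rule powr_integrable_diff[OF _ _ _ _ WbK GK]) (use assms(1) in auto)
  have YkY: "Yk k x - Y x = G x - Gk k x" for k x by (simp add: Y_def Yk_def)
  have GkK: "powr_integrable lebesgue K \<gamma> (Gk k)" for k
    by (rule int_powr) (use Gk assms(1) in \<open>auto intro: continuous_on_subset\<close>)
  have diffK: "powr_integrable lebesgue K \<gamma> (\<lambda>x. Yk k x - Y x)" for k
    unfolding YkY by (rule powr_integrable_diff[OF _ _ _ _ GK GkK]) (use assms(1) in auto)
  have Lk: "(LINT x|lebesgue. indicator K x * norm (Yk k x - Y x) powr \<gamma>) \<le> 1 / real (Suc k)" for k
  proof -
    have "ennreal (LINT x|lebesgue. indicator K x * norm (Yk k x - Y x) powr \<gamma>)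
        = (\<integral>\<^sup>+x. ennreal (indicator K x * norm (Yk k x - Y x) powr \<gamma>) \<partial>lebesgue)"
      by (rule nn_integral_eq_integral[symmetric, OF diffK]) simp
    also have "\<dots> \<le> powr_integral \<gamma> (cball 0 R) (\<lambda>x. Gk k x - G x)"
      by (rule nn_integral_mono) (use K\<Omega> R in \<open>auto simp: YkY norm_minus_commute indicator_def\<close>)
    also have "\<dots> \<le> ennreal (1 / real (Suc k))" by (rule Gconv)
    finally show ?thesis by (subst (asm) ennreal_le_iff) auto
  qed
  have lim1: "(\<lambda>k. 1 / real (Suc k)) \<longlonglongrightarrow> 0" by (rule LIMSEQ_Suc[OF lim_1_over_n])
  have Lk0: "(\<lambda>k. LINT x|lebesgue. indicator K x * norm (Yk k x - Y x) powr \<gamma>) \<longlonglongrightarrow> 0"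
    by (rule tendsto_sandwich[OF _ _ tendsto_const lim1])
       (auto intro!: always_eventually Bochner_Integration.integral_nonneg Lk simp del: of_nat_Suc)
  have pairing: "(\<lambda>k. LINT x|lebesgue. mk k x * (\<Psi> x \<bullet> Yk k x)) \<longlonglongrightarrow> (LINT x|lebesgue. m x * (\<Psi> x \<bullet> Y x))"
      "\<And>k. integrable lebesgue (\<lambda>x. mk k x * (\<Psi> x \<bullet> Yk k x))"
      "integrable lebesgue (\<lambda>x. m x * (\<Psi> x \<bullet> Y x))"
    if "\<Psi> \<in> borel_measurable lebesgue" "powr_integrable lebesgue K (\<gamma> / (\<gamma> - 1)) \<Psi>" for \<Psi>
    using integral_inner_powr_tendsto[OF assms(1) that(1) _ _ m_meas mk_meas that(2) YK diffK Lk0 m_off Q mk_off mk_near lim1]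
      integral_inner_powr_bound(1)[OF assms(1) that(1) _ m_meas that(2) YK m_off Q] by auto
  have VK: "powr_integrable lebesgue K (\<gamma> / (\<gamma> - 1)) V"
    unfolding V_def ind by (rule int_powr[OF cb(2) \<gamma>'])
  have XK: "powr_integrable lebesgue K (\<gamma> / (\<gamma> - 1)) X"
    unfolding X_def ind by (rule int_powr[OF cb(3) \<gamma>'])
  have VAK: "powr_integrable lebesgue K (\<gamma> / (\<gamma> - 1)) (\<lambda>x. V x - A x)"
    by (rule powr_integrable_diff[OF \<gamma>' _ _ _ VK AK]) auto
  have DV: "(s x *\<^sub>R x) \<bullet> D k x = 2 * (mk k x * (V x \<bullet> Yk k x))" for k x
    using mk_off[of x k] by (cases "x \<in> K") (auto simp: D_def V_def Yk_def Wb_def)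
  have DX: "x \<bullet> D k x = 2 * (mk k x * (X x \<bullet> Yk k x))" for k x
    using mk_off[of x k] by (cases "x \<in> K") (auto simp: D_def X_def Yk_def Wb_def)
  have DA: "A x \<bullet> D k x = 2 * (mk k x * (A x \<bullet> Yk k x))" for k x
    using mk_off[of x k] by (cases "x \<in> K") (auto simp: D_def Yk_def Wb_def)

  \<comment> \<open>Both equations are tested with \<open>\<psi> k \<ge> 0\<close>, which preserves the inequality between the right-hand sides.\<close>
  have neg: "(LINT x|lebesgue. mk k x * ((V x - A x) \<bullet> Yk k x)) \<le> 0" for k
  proof -
    have "(LINT x|lebesgue. A x \<bullet> D k x) = - (LINT x|lebesgue. \<psi> k x * (- f x))"
      using divu tf[of k] unfolding has_weak_divergence_def A_def by blast
    moreover have "(LINT x|lebesgue. (s x *\<^sub>R x) \<bullet> D k x) = - (LINT x|lebesgue. \<psi> k x * (real CARD('n) * s x + S x \<bullet> x))"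
      by (rule integral_by_parts_radial_field[OF tf \<Omega>(1) supp s])
    moreover have "(LINT x|lebesgue. \<psi> k x * (- f x)) \<le> (LINT x|lebesgue. \<psi> k x * (real CARD('n) * s x + S x \<bullet> x))"
    proof (rule integral_mono)
      have "integrable lebesgue (\<lambda>x. \<psi> k x *\<^sub>R (- f x))"
      proof (rule integrable_bounded_times_locally_integrable[OF f_li K])
        show "\<psi> k \<in> borel_measurable lebesgue" using mk_meas[of k] unfolding \<psi>_def[abs_def] by simp
        show "\<bar>\<psi> k x\<bar> \<le> (Q + 1)\<^sup>2" for x
          using power_mono[OF mkQ[of k x] abs_ge_zero, of 2] by (simp add: \<psi>_def)
      qed (simp add: \<psi>_def mk_off)
      then show "integrable lebesgue (\<lambda>x. \<psi> k x * (- f x))" by simp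
      show "integrable lebesgue (\<lambda>x. \<psi> k x * (real CARD('n) * s x + S x \<bullet> x))"
        unfolding real_scaleR_def[symmetric, of "\<psi> k _"]
        by (rule test_function_product_integrable[OF tf \<Omega>(1) supp]) (intro continuous_intros cs s)
      fix x
      show "\<psi> k x * (- f x) \<le> \<psi> k x * (real CARD('n) * s x + S x \<bullet> x)"
      proof (cases "x \<in> \<Omega>")
        case True
        then show ?thesis using le[OF True] by (intro mult_left_mono) (auto simp: \<psi>_def)
      qed (simp add: \<psi>_def mk_def cut_def)
    qed
    ultimately have "(LINT x|lebesgue. (s x *\<^sub>R x) \<bullet> D k x) \<le> (LINT x|lebesgue. A x \<bullet> D k x)" by linarith
    then have "(LINT x|lebesgue. mk k x * (V x \<bullet> Yk k x)) \<le> (LINT x|lebesgue. mk k x * (A x \<bullet> Yk k x))"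
      unfolding DV DA by simp
    then show ?thesis
      using pairing(2)[OF V_meas VK, of k] pairing(2)[OF A_meas AK, of k]
      by (simp add: inner_diff_left right_diff_distrib)
  qed
  have "(LINT x|lebesgue. m x * ((V x - A x) \<bullet> Y x)) \<le> 0"
    by (rule tendsto_upperbound[OF pairing(1)[OF _ VAK]]) (auto simp: neg)
  moreover have mono: "0 \<le> m x * ((V x - A x) \<bullet> Y x)" for x
  proof (cases "x \<in> K")
    case True
    then have "V x = (norm (W x) powr (\<gamma> - 2)) *\<^sub>R W x" using flux K\<Omega> by (auto simp: V_def)
    then have "0 \<le> (V x - A x) \<bullet> Y x"
      using flux_monotone(1)[OF assms(1), of "W x" "G x"] True by (simp add: Y_def Wb_def A_def)
    then show ?thesis by (simp add: m_def cut_def)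
  qed (simp add: m_off)
  ultimately have "(LINT x|lebesgue. m x * ((V x - A x) \<bullet> Y x)) = 0"
    using Bochner_Integration.integral_nonneg[of lebesgue "\<lambda>x. m x * ((V x - A x) \<bullet> Y x)"] by (simp add: order_antisym)
  then have "AE x in lebesgue. m x * ((V x - A x) \<bullet> Y x) = 0"
    using pairing(3)[OF _ VAK] mono by (subst (asm) integral_nonneg_eq_0_iff_AE) auto
  then have "AE x in lebesgue. m x * (X x \<bullet> Y x) = 0"
  proof eventually_elim
    case (elim x)
    show ?case
    proof (cases "m x = 0")
      case False
      then have xK: "x \<in> K" using m_off by blast
      then have "V x = (norm (W x) powr (\<gamma> - 2)) *\<^sub>R W x" using flux K\<Omega> by (auto simp: V_def)
      then have "W x = G x"
        using flux_monotone(2)[OF assms(1), of "W x" "G x"] elim False xK by (simp add: Y_def Wb_def A_def)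
      then show ?thesis using xK by (simp add: Y_def Wb_def)
    qed simp
  qed
  then have X0: "(LINT x|lebesgue. m x * (X x \<bullet> Y x)) = 0"
    by (rule integral_eq_zero_AE)

  \<comment> \<open>The gradient of \<open>m\<^sup>2\<close> vanishes; integrating it against the field \<open>x\<close>, whose divergence is constant, gives \<open>m = 0\<close>.\<close>
  have intpsi: "(LINT x|lebesgue. \<psi> k x) = - (2 / real CARD('n)) * (LINT x|lebesgue. mk k x * (X x \<bullet> Yk k x))" for k
  proof -
    have "(LINT x|lebesgue. (1 *\<^sub>R x) \<bullet> D k x) = - (LINT x|lebesgue. \<psi> k x * (real CARD('n) * 1 + 0 \<bullet> x))"
      by (rule integral_by_parts_radial_field[OF tf open_UNIV]) (auto simp: GDERIV_const)
    then have "2 * (LINT x|lebesgue. mk k x * (X x \<bullet> Yk k x)) = - (real CARD('n) * (LINT x|lebesgue. \<psi> k x))"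
      by (simp add: DX mult.commute)
    then show ?thesis by (simp add: field_simps)
  qed
  have "(\<lambda>k. LINT x|lebesgue. \<psi> k x) \<longlonglongrightarrow> - (2 / real CARD('n)) * 0"
    unfolding intpsi X0[symmetric] by (rule tendsto_mult_left[OF pairing(1)[OF X_meas XK]])
  moreover have "(\<lambda>k. LINT x|lebesgue. \<psi> k x) \<longlonglongrightarrow> (LINT x|lebesgue. (m x)\<^sup>2)"
  proof (rule integral_dominated_convergence[where w = "\<lambda>x. indicator K x * (Q + 1)\<^sup>2"])
    show "integrable lebesgue (\<lambda>x. indicator K x * (Q + 1)\<^sup>2)"
      using integrable_continuous_on_compact[OF K continuous_on_const[of _ "(Q + 1)\<^sup>2"]] by simp
    have "(\<lambda>k. mk k x) \<longlonglongrightarrow> m x" for x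
    proof (rule LIM_zero_cancel, rule Lim_null_comparison[OF _ lim1])
      show "\<forall>\<^sub>F k in sequentially. norm (mk k x - m x) \<le> 1 / real (Suc k)"
        using mk_near by (simp del: of_nat_Suc)
    qed
    then have "(\<lambda>k. \<psi> k x) \<longlonglongrightarrow> (m x)\<^sup>2" for x unfolding \<psi>_def by (intro tendsto_intros)
    then show "AE x in lebesgue. (\<lambda>k. \<psi> k x) \<longlonglongrightarrow> (m x)\<^sup>2" by simp
    have "norm (\<psi> k x) \<le> indicator K x * (Q + 1)\<^sup>2" for k x
      using power_mono[OF mkQ[of k x] abs_ge_zero, of 2] mk_off[of x k]
      by (cases "x \<in> K") (auto simp: \<psi>_def)
    then show "AE x in lebesgue. norm (\<psi> k x) \<le> indicator K x * (Q + 1)\<^sup>2" for k by simp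
    show "\<psi> k \<in> borel_measurable lebesgue" for k using mk_meas[of k] unfolding \<psi>_def[abs_def] by simp
    show "(\<lambda>x. (m x)\<^sup>2) \<in> borel_measurable lebesgue" using m_meas by simp
  qed
  ultimately have "(LINT x|lebesgue. (m x)\<^sup>2) = 0" using LIMSEQ_unique by fastforce
  moreover have "integrable lebesgue (\<lambda>x. (m x)\<^sup>2)"
  proof -
    have "continuous_on K (\<lambda>x. (m x)\<^sup>2)" by (intro continuous_intros continuous_on_subset[OF cm]) simp
    from integrable_continuous_on_compact[OF K this]
    have "integrable lebesgue (\<lambda>x. indicator K x * (m x)\<^sup>2)" by simp
    moreover have "indicator K x * (m x)\<^sup>2 = (m x)\<^sup>2" for x
      using m_off[of x] by (cases "x \<in> K") auto
    ultimately show ?thesis by simp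
  qed
  ultimately have "AE x in lebesgue. (m x)\<^sup>2 = 0"
    by (subst (asm) integral_nonneg_eq_0_iff_AE) auto
  then have "negligible {x. m x \<noteq> 0}"
    by (simp add: eventually_ae_filter_negligible) (meson negligible_subset mem_Collect_eq subsetD subsetI)
  moreover have "open {x. m x \<noteq> 0}"
    using open_Collect_neq[OF cm continuous_on_const[of UNIV 0]] by simp
  moreover have "m x0 \<noteq> 0"
  proof -
    have "w x0 - u x0 - \<delta> = \<delta>" by (simp add: \<delta>_def field_simps)
    then show ?thesis using \<delta> \<open>x0 \<in> \<Omega>\<close> by (simp add: m_def cut_def)
  qed
  ultimately show False using open_not_negligible[of "{x. m x \<noteq> 0}"] by blast
qed

section \<open>Lower bounds by radial barriers\<close>

lemma gderiv_radial:
  fixes x :: "'a::euclidean_space"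
  assumes "x \<noteq> 0" "(\<omega> has_real_derivative d) (at (norm x))"
  shows "GDERIV (\<lambda>x. \<omega> (norm x)) x :> d *\<^sub>R sgn x"
  using GDERIV_DERIV_compose[OF GDERIV_norm[OF assms(1)] assms(2)] by simp

lemma continuous_norm_powr_scaleR:
  assumes "a > -1"
  shows "continuous_on UNIV (\<lambda>x::'a::euclidean_space. (norm x powr a) *\<^sub>R x)"
proof (rule continuous_at_imp_continuous_on, intro ballI)
  fix x :: 'a
  show "isCont (\<lambda>x. (norm x powr a) *\<^sub>R x) x"
  proof (cases "x = 0")
    case True
    have "((\<lambda>x::'a. norm x powr (a + 1)) \<longlongrightarrow> norm (0::'a) powr (a + 1)) (at 0)"
      using assms by (intro tendsto_powr' tendsto_intros) auto
    then have "((\<lambda>x::'a. norm x powr (a + 1)) \<longlongrightarrow> 0) (at 0)" using assms by simp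
    then have "((\<lambda>x::'a. (norm x powr a) *\<^sub>R x) \<longlongrightarrow> 0) (at 0)"
    proof (rule Lim_null_comparison[rotated], intro always_eventually allI)
      fix x :: 'a
      show "norm ((norm x powr a) *\<^sub>R x) \<le> norm x powr (a + 1)"
        using powr_mult_base[of "norm x" a] by (simp add: mult.commute add.commute)
    qed
    then show ?thesis using True by (simp add: isCont_def)
  qed (auto intro!: continuous_intros)
qed

lemma gderiv_norm_powr:
  fixes x :: "'a::euclidean_space"
  assumes "b > 1"
  shows "GDERIV (\<lambda>x. norm x powr b) x :> (b * norm x powr (b - 2)) *\<^sub>R x"
proof (cases "x = 0")
  case False
  then have "((\<lambda>t. t powr b) has_real_derivative b * norm x powr (b - 1)) (at (norm x))"
    by (intro has_real_derivative_powr) simp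
  from gderiv_radial[OF False this]
  have "GDERIV (\<lambda>x. norm x powr b) x :> (b * norm x powr (b - 1)) *\<^sub>R sgn x" .
  moreover have "(b * norm x powr (b - 1)) *\<^sub>R sgn x = (b * norm x powr (b - 2)) *\<^sub>R x"
    using powr_mult_base[of "norm x" "b - 2"] False by (simp add: sgn_div_norm field_simps)
  ultimately show ?thesis by simp
next
  case True
  have "((\<lambda>x::'a. norm x powr (b - 1)) \<longlongrightarrow> norm (0::'a) powr (b - 1)) (at 0)"
    using assms by (intro tendsto_powr' tendsto_intros) auto
  then have "((\<lambda>x::'a. norm x powr (b - 1)) \<longlongrightarrow> 0) (at 0)" using assms by simp
  moreover have "norm h powr b / norm h = norm h powr (b - 1)" for h :: 'a
    using powr_mult_base[of "norm h" "b - 1"] assms by (cases "h = 0") (auto simp: field_simps)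
  ultimately have "((\<lambda>h::'a. norm h powr b / norm h) \<longlongrightarrow> 0) (at 0)" by simp
  then show ?thesis using True assms by (simp add: gderiv_def has_derivative_at)
qed

text \<open>The powers of \<open>\<bar>x\<bar>\<close> cancel: with \<open>\<gamma>' = \<gamma> / (\<gamma> - 1)\<close> the gradient of \<open>\<bar>x\<bar> powr \<gamma>'\<close> is carried by the
  nonlinearity to a multiple of the field \<open>x\<close>, which is smooth at the origin.\<close>

lemma power_flux:
  fixes x :: "'a::euclidean_space"
  assumes "\<gamma> > 1" "l \<ge> 0"
  defines "\<gamma>' \<equiv> \<gamma> / (\<gamma> - 1)"
  defines "W \<equiv> (- l) *\<^sub>R ((norm x powr (\<gamma>' - 2)) *\<^sub>R x)"
  shows "(norm W powr (\<gamma> - 2)) *\<^sub>R W = (- (l powr (\<gamma> - 1))) *\<^sub>R x"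
proof (cases "x = 0")
  case False
  have "norm W = l * norm x powr (\<gamma>' - 1)"
    unfolding W_def using powr_mult_base[of "norm x" "\<gamma>' - 2"] assms(2) by (simp add: mult.commute)
  then have nW: "norm W powr (\<gamma> - 2) = l powr (\<gamma> - 2) * norm x powr ((\<gamma>' - 1) * (\<gamma> - 2))"
    using assms(2) by (simp add: powr_mult powr_powr)
  have one: "norm x powr ((\<gamma>' - 1) * (\<gamma> - 2)) * norm x powr (\<gamma>' - 2) = 1"
  proof -
    have "(\<gamma>' - 1) * (\<gamma> - 2) + (\<gamma>' - 2) = 0" using assms(1) by (simp add: \<gamma>'_def field_simps)
    then show ?thesis using False by (simp add: powr_add[symmetric])
  qed
  have ll: "l powr (\<gamma> - 2) * l = l powr (\<gamma> - 1)"
    using powr_mult_base[OF assms(2), of "\<gamma> - 2"] by (simp add: mult.commute)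
  have "(norm W powr (\<gamma> - 2)) *\<^sub>R W
      = - (((l powr (\<gamma> - 2) * l) * (norm x powr ((\<gamma>' - 1) * (\<gamma> - 2)) * norm x powr (\<gamma>' - 2))) *\<^sub>R x)"
    unfolding nW unfolding W_def by (simp add: mult_ac)
  then show ?thesis unfolding one ll by simp
qed (simp add: W_def)

text \<open>The barrier is the torsion function of the ball, the radial solution for the constant right-hand side \<open>\<kappa>\<close>.\<close>

lemma torsion_lower_bound:
  fixes u f :: "real^'n \<Rightarrow> real"
  assumes "\<gamma> > 1" "positive_solution \<gamma> u f" "R > 0" "\<kappa> \<ge> 0"
    and f: "\<And>x. x \<in> ball 0 R \<Longrightarrow> \<kappa> \<le> f x" and m: "\<And>x. x \<in> sphere 0 R \<Longrightarrow> m \<le> u x"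
    and x0: "x0 \<in> ball 0 R"
  defines "\<gamma>' \<equiv> \<gamma> / (\<gamma> - 1)"
  shows "m + (\<kappa> / real CARD('n)) powr (1 / (\<gamma> - 1)) / \<gamma>' * (R powr \<gamma>' - norm x0 powr \<gamma>') \<le> u x0"
proof -
  have g': "\<gamma>' > 1" "\<gamma>' - 1 = 1 / (\<gamma> - 1)" using assms(1) by (auto simp: \<gamma>'_def field_simps)
  define l where "l = (\<kappa> / real CARD('n)) powr (1 / (\<gamma> - 1))"
  have l: "l \<ge> 0" "l powr (\<gamma> - 1) = \<kappa> / real CARD('n)"
    using assms(1) \<open>\<kappa> \<ge> 0\<close> by (auto simp: l_def powr_powr)
  let ?w = "\<lambda>x::real^'n. m + l / \<gamma>' * (R powr \<gamma>' - norm x powr \<gamma>')"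
  let ?W = "\<lambda>x::real^'n. (- l) *\<^sub>R ((norm x powr (\<gamma>' - 2)) *\<^sub>R x)"
  have "?w x0 \<le> u x0"
  proof (rule weak_comparison_principle[OF assms(1,2) open_ball bounded_ball, where W = ?W
        and s = "\<lambda>x. - (\<kappa> / real CARD('n))" and S = "\<lambda>x. 0"])
    fix x :: "real^'n" assume "x \<in> ball 0 R"
    have nz: "\<gamma>' \<noteq> 0" using g'(1) by linarith
    then have "((\<lambda>t. m + l / \<gamma>' * (R powr \<gamma>' - t)) has_real_derivative - (l / \<gamma>')) (at (norm x powr \<gamma>'))"
      by (auto intro!: derivative_eq_intros)
    from GDERIV_DERIV_compose[OF gderiv_norm_powr[OF g'(1)] this]
    show "GDERIV ?w x :> ?W x" using nz by simp
  next
    show "continuous_on (ball 0 R) ?W"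
      by (intro continuous_intros continuous_on_subset[OF continuous_norm_powr_scaleR]) (use g' in auto)
  next
    fix x :: "real^'n" assume "x \<in> ball 0 R"
    show "(norm (?W x) powr (\<gamma> - 2)) *\<^sub>R ?W x = - (\<kappa> / real CARD('n)) *\<^sub>R x"
      unfolding \<gamma>'_def power_flux[OF assms(1) l(1)] l(2) ..
  next
    fix x :: "real^'n" assume "x \<in> ball 0 R"
    then show "- (real CARD('n) * - (\<kappa> / real CARD('n)) + 0 \<bullet> x) \<le> f x" using f by simp
  next
    show "continuous_on (closure (ball 0 R)) ?w"
      by (intro continuous_intros continuous_on_powr') (use g' in auto)
  next
    fix x :: "real^'n" assume "x \<in> frontier (ball 0 R)"
    then show "?w x \<le> u x" using m[of x] \<open>R > 0\<close> by (simp add: frontier_ball)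
  qed (use x0 in \<open>auto simp: GDERIV_const\<close>)
  then show ?thesis by (simp add: l_def)
qed

text \<open>For a radial function the equation says that the flux \<open>\<Phi>\<close> through the sphere of radius \<open>t\<close> (up to the area of the
  unit sphere) grows at the rate prescribed by the right-hand side, and the profile \<open>\<omega>\<close> is recovered from \<open>\<Phi>\<close>.\<close>

lemma annulus_lower_bound:
  fixes u f :: "real^'n \<Rightarrow> real" and \<omega> \<Phi> \<Phi>' :: "real \<Rightarrow> real"
  assumes "\<gamma> > 1" "positive_solution \<gamma> u f" "0 < \<rho>" "\<rho> < R"
    and \<omega>: "continuous_on {\<rho>..R} \<omega>"
      "\<And>t. \<rho> < t \<Longrightarrow> t < R \<Longrightarrow> (\<omega> has_real_derivative
         - (t powr (- ((real CARD('n) - 1) / (\<gamma> - 1))) * \<Phi> t powr (1 / (\<gamma> - 1)))) (at t)"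
    and \<Phi>: "\<And>t. \<rho> < t \<Longrightarrow> t < R \<Longrightarrow> 0 \<le> \<Phi> t"
      "\<And>t. \<rho> < t \<Longrightarrow> t < R \<Longrightarrow> (\<Phi> has_real_derivative \<Phi>' t) (at t)" "continuous_on {\<rho><..<R} \<Phi>'"
    and f: "\<And>x. \<rho> < norm x \<Longrightarrow> norm x < R \<Longrightarrow> \<Phi>' (norm x) * norm x powr (1 - real CARD('n)) \<le> f x"
    and bd: "\<And>x. norm x = \<rho> \<Longrightarrow> \<omega> \<rho> \<le> u x" "\<And>x. norm x = R \<Longrightarrow> \<omega> R \<le> u x"
    and x0: "\<rho> < norm x0" "norm x0 < R"
  shows "\<omega> (norm x0) \<le> u x0"
proof -
  define N where "N = real CARD('n)"
  define \<Omega> where "\<Omega> = {x::real^'n. \<rho> < norm x \<and> norm x < R}"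
  have nz: "x \<noteq> 0" "norm x > 0" if "x \<in> \<Omega>" for x using that assms(3) by (auto simp: \<Omega>_def)
  have open\<Omega>: "open \<Omega>"
    unfolding \<Omega>_def by (intro open_Collect_conj open_Collect_less continuous_intros)
  have closed: "closure \<Omega> \<subseteq> {x. norm x \<in> {\<rho>..R}}"
    by (rule closure_minimal) (auto simp: \<Omega>_def intro!: closed_Collect_conj closed_Collect_le continuous_intros)
  have c\<Phi>: "continuous_on {\<rho><..<R} \<Phi>"
    using \<Phi>(2) by (intro DERIV_continuous_on[of _ _ \<Phi>']) (auto intro: has_field_derivative_at_within)
  have cc: "continuous_on \<Omega> (\<lambda>x. \<Phi> (norm x))" "continuous_on \<Omega> (\<lambda>x. \<Phi>' (norm x))"
  proof -
    have "continuous_on \<Omega> norm" "norm ` \<Omega> \<subseteq> {\<rho><..<R}" by (auto simp: \<Omega>_def intro!: continuous_intros)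
    then show "continuous_on \<Omega> (\<lambda>x. \<Phi> (norm x))" "continuous_on \<Omega> (\<lambda>x. \<Phi>' (norm x))"
      by (rule continuous_on_compose2[OF c\<Phi>], rule continuous_on_compose2[OF \<Phi>(3)])
  qed
  have csgn: "continuous_on \<Omega> sgn" using nz(1) by (intro continuous_on_sgn continuous_on_id) auto
  define A where "A t = t powr (- ((N - 1) / (\<gamma> - 1))) * \<Phi> t powr (1 / (\<gamma> - 1))" for t
  define s where "s x = - (\<Phi> (norm x) * norm x powr (- N))" for x :: "real^'n"
  define S where "S x = - (\<Phi>' (norm x) * norm x powr (- N) + \<Phi> (norm x) * (- N * norm x powr (- N - 1))) *\<^sub>R sgn x"
    for x :: "real^'n"
  show ?thesis
  proof (rule weak_comparison_principle[OF assms(1,2) open\<Omega>, where W = "\<lambda>x. (- A (norm x)) *\<^sub>R sgn x"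
        and s = s and S = S])
    show "bounded \<Omega>" by (rule bounded_subset[OF bounded_ball[of 0 R]]) (auto simp: \<Omega>_def)
  next
    fix x assume x: "x \<in> \<Omega>"
    show "GDERIV (\<lambda>x. \<omega> (norm x)) x :> (- A (norm x)) *\<^sub>R sgn x"
      by (rule gderiv_radial) (use nz[OF x] \<omega>(2)[of "norm x"] x in \<open>auto simp: \<Omega>_def A_def N_def\<close>)
  next
    show "continuous_on \<Omega> (\<lambda>x. (- A (norm x)) *\<^sub>R sgn x)"
    proof -
      have "continuous_on \<Omega> (\<lambda>x. norm x powr (- ((N - 1) / (\<gamma> - 1))))"
        using nz by (intro continuous_on_powr continuous_intros) auto
      moreover have "continuous_on \<Omega> (\<lambda>x. \<Phi> (norm x) powr (1 / (\<gamma> - 1)))"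
        using assms(1) \<Phi>(1) by (intro continuous_on_powr' cc continuous_on_const) (auto simp: \<Omega>_def)
      ultimately show ?thesis
        unfolding A_def by (intro continuous_on_scaleR continuous_on_minus continuous_on_mult csgn)
    qed
  next
    fix x assume x: "x \<in> \<Omega>"
    have A0: "A (norm x) \<ge> 0" by (simp add: A_def)
    have "norm ((- A (norm x)) *\<^sub>R sgn x) = A (norm x)" using nz[OF x] A0 by (simp add: norm_sgn)
    then have "(norm ((- A (norm x)) *\<^sub>R sgn x) powr (\<gamma> - 2)) *\<^sub>R ((- A (norm x)) *\<^sub>R sgn x)
        = (- (A (norm x) powr (\<gamma> - 1))) *\<^sub>R sgn x"
      using powr_mult_base[OF A0, of "\<gamma> - 2"] by (simp add: mult.commute)
    also have "A (norm x) powr (\<gamma> - 1) = norm x powr (- (N - 1)) * \<Phi> (norm x)"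
    proof -
      have "0 \<le> \<Phi> (norm x)" using x \<Phi>(1) by (auto simp: \<Omega>_def)
      then show ?thesis
        using assms(1) unfolding A_def by (simp add: powr_mult powr_powr)
    qed
    also have "(- (norm x powr (- (N - 1)) * \<Phi> (norm x))) *\<^sub>R sgn x = s x *\<^sub>R x"
      using nz[OF x] powr_mult_base[of "norm x" "- N"] by (simp add: s_def sgn_div_norm field_simps)
    finally show "(norm ((- A (norm x)) *\<^sub>R sgn x) powr (\<gamma> - 2)) *\<^sub>R ((- A (norm x)) *\<^sub>R sgn x) = s x *\<^sub>R x" .
  next
    fix x assume x: "x \<in> \<Omega>"
    have "((\<lambda>t. - (\<Phi> t * t powr (- N))) has_real_derivative
        - (\<Phi>' (norm x) * norm x powr (- N) + \<Phi> (norm x) * (- N * norm x powr (- N - 1)))) (at (norm x))"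
      using \<Phi>(2)[of "norm x"] x nz[OF x]
      by (auto intro!: derivative_eq_intros has_real_derivative_powr simp: \<Omega>_def)
    from gderiv_radial[OF nz(1)[OF x] this]
    show "GDERIV s x :> S x" by (simp add: s_def[abs_def] S_def)
  next
    show "continuous_on \<Omega> S"
      unfolding S_def by (intro continuous_intros csgn continuous_on_powr cc) (use nz in auto)
  next
    fix x assume x: "x \<in> \<Omega>"
    have 1: "sgn x \<bullet> x = norm x" using nz[OF x] by (simp add: sgn_div_norm power2_norm_eq_inner[symmetric] power2_eq_square)
    have 2: "norm x powr (- N - 1) * norm x = norm x powr (- N)" "norm x powr (- N) * norm x = norm x powr (1 - N)"
      using powr_mult_base[of "norm x" "- N - 1"] powr_mult_base[of "norm x" "- N"] by (simp_all add: mult.commute)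
    have "S x \<bullet> x = - (\<Phi>' (norm x) * (norm x powr (- N) * norm x) + \<Phi> (norm x) * (- N * (norm x powr (- N - 1) * norm x)))"
      unfolding S_def inner_scaleR_left 1 by (simp add: algebra_simps)
    then have "- (N * s x + S x \<bullet> x) = \<Phi>' (norm x) * norm x powr (1 - N)"
      unfolding 2 by (simp add: s_def algebra_simps)
    then show "- (real CARD('n) * s x + S x \<bullet> x) \<le> f x"
      using f[of x] x by (simp add: \<Omega>_def N_def)
  next
    show "continuous_on (closure \<Omega>) (\<lambda>x. \<omega> (norm x))"
      by (rule continuous_on_compose2[OF \<omega>(1)]) (use closed in \<open>auto intro!: continuous_intros\<close>)
  next
    fix x assume "x \<in> frontier \<Omega>"
    then have "x \<in> closure \<Omega>" "x \<notin> \<Omega>" using open\<Omega> by (auto simp: frontier_def interior_open)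
    then have "norm x = \<rho> \<or> norm x = R" using closed by (auto simp: \<Omega>_def)
    then show "\<omega> (norm x) \<le> u x" using bd by auto
  qed (use x0 in \<open>auto simp: \<Omega>_def\<close>)
qed

text \<open>A multiple of the fundamental solution \<open>\<bar>x\<bar> powr (- a)\<close>, whose flux is constant, is lowered so as to vanish on the
  sphere of radius \<open>R\<close>; then \<open>R\<close> tends to infinity.\<close>

lemma fundamental_lower_bound:
  fixes u f :: "real^'n \<Rightarrow> real"
  assumes "\<gamma> > 1" "\<gamma> < real CARD('n)" "positive_solution \<gamma> u f" "\<And>x. f x \<ge> 0"
    and "\<rho> > 0" "m \<ge> 0" and m: "\<And>x. norm x = \<rho> \<Longrightarrow> m \<le> u x" and x: "norm x \<ge> \<rho>"
  defines "a \<equiv> (real CARD('n) - \<gamma>) / (\<gamma> - 1)"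
  shows "m * (\<rho> / norm x) powr a \<le> u x"
proof (cases "norm x = \<rho>")
  case True
  then show ?thesis using m[OF True] \<open>\<rho> > 0\<close> by simp
next
  case False
  then have x: "\<rho> < norm x" using x by simp
  have a: "a > 0" using assms(1,2) by (simp add: a_def)
  have u: "0 < u x" for x using assms(3) by (simp add: positive_solution_def)
  have b: "m * \<rho> powr a * (norm x powr (- a) - R powr (- a)) \<le> u x" if R: "R > norm x" for R
  proof -
    define k where "k = (m * \<rho> powr a * a) powr (\<gamma> - 1)"
    have k: "k powr (1 / (\<gamma> - 1)) = m * \<rho> powr a * a"
      using assms(1,5,6) a by (simp add: k_def powr_powr)
    let ?\<omega> = "\<lambda>t. m * \<rho> powr a * (t powr (- a) - R powr (- a))"
    show ?thesis
    proof (rule annulus_lower_bound[OF assms(1,3) \<open>\<rho> > 0\<close>, where R = R and \<Phi> = "\<lambda>_. k" and \<Phi>' = "\<lambda>_. 0"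
          and \<omega> = ?\<omega>])
      show "continuous_on {\<rho>..R} ?\<omega>"
        using \<open>\<rho> > 0\<close> by (intro continuous_intros) auto
    next
      fix t assume "\<rho> < t" "t < R"
      have e: "- ((real CARD('n) - 1) / (\<gamma> - 1)) = - a - 1" using assms(1) by (simp add: a_def field_simps)
      have "(?\<omega> has_real_derivative
          m * \<rho> powr a * (- a * t powr (- a - 1))) (at t)"
        using \<open>\<rho> > 0\<close> \<open>\<rho> < t\<close> by (auto intro!: derivative_eq_intros has_real_derivative_powr)
      then show "(?\<omega> has_real_derivative
         - (t powr (- ((real CARD('n) - 1) / (\<gamma> - 1))) * k powr (1 / (\<gamma> - 1)))) (at t)"
        unfolding e k by (rule DERIV_cong) (simp add: mult_ac)
    next
      fix x :: "real^'n" assume "norm x = \<rho>"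
      have "m * \<rho> powr a * (\<rho> powr (- a) - R powr (- a)) \<le> m * \<rho> powr a * \<rho> powr (- a)"
        using assms(6) by (intro mult_left_mono) auto
      also have "\<dots> = m" using \<open>\<rho> > 0\<close> by (simp add: powr_minus)
      also have "\<dots> \<le> u x" by (rule m) fact
      finally show "m * \<rho> powr a * (\<rho> powr (- a) - R powr (- a)) \<le> u x" .
    qed (use x R assms(4) u in \<open>auto simp: k_def less_imp_le\<close>)
  qed
  have "((\<lambda>R. m * \<rho> powr a * (norm x powr (- a) - R powr (- a))) \<longlongrightarrow> m * \<rho> powr a * (norm x powr (- a) - 0)) at_top"
    using a by (intro tendsto_intros tendsto_neg_powr filterlim_ident) auto
  moreover have "\<forall>\<^sub>F R in at_top. m * \<rho> powr a * (norm x powr (- a) - R powr (- a)) \<le> u x"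
    using eventually_gt_at_top[of "norm x"] by eventually_elim (rule b)
  ultimately have "m * \<rho> powr a * (norm x powr (- a) - 0) \<le> u x"
    by (rule tendsto_upperbound) simp
  moreover have "(\<rho> / norm x) powr a = \<rho> powr a * norm x powr (- a)"
    using x \<open>\<rho> > 0\<close> by (simp add: powr_divide powr_minus field_simps)
  ultimately show ?thesis by (simp add: mult.assoc)
qed

lemma ln_powr_le:
  fixes t a b :: real
  assumes "t \<ge> 1" "a > 0" "b > 0"
  shows "(ln t) powr b \<le> (b / a) powr b * t powr a"
proof -
  have "ln t \<le> t powr (a / b) / (a / b)"
    using ln_powr_bound[of t "a / b"] assms by simp
  then have "(ln t) powr b \<le> (t powr (a / b) / (a / b)) powr b"
    using assms by (intro powr_mono2) auto
  also have "\<dots> = (t powr (a / b)) powr b * (b / a) powr b"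
    using assms by (simp add: powr_mult powr_divide)
  also have "(t powr (a / b)) powr b = t powr a" using assms by (simp add: powr_powr)
  finally show ?thesis by (simp add: mult.commute)
qed

text \<open>A right-hand side of size \<open>\<bar>x\<bar> powr (- n)\<close> lets the flux through the sphere of radius \<open>t\<close> grow like \<open>ln t\<close>, which
  improves the decay of the fundamental solution by a logarithmic factor.\<close>

lemma logarithmic_lower_bound:
  fixes u f :: "real^'n \<Rightarrow> real"
  assumes "\<gamma> > 1" "\<gamma> < real CARD('n)" "positive_solution \<gamma> u f"
    and "\<kappa> > 0" "\<And>x. norm x \<ge> 1 \<Longrightarrow> \<kappa> * norm x powr (- real CARD('n)) \<le> f x"
    and "\<mu> > 0" "\<And>x. norm x = 1 \<Longrightarrow> \<mu> \<le> u x"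
  defines "a \<equiv> (real CARD('n) - \<gamma>) / (\<gamma> - 1)"
  shows "\<exists>c>0. \<forall>x. norm x \<ge> 1 \<longrightarrow> c * norm x powr (- a) * (ln (norm x)) powr (1 / (\<gamma> - 1)) \<le> u x"
proof -
  define N where "N = real CARD('n)"
  define b where "b = 1 / (\<gamma> - 1)"
  have b: "b > 0" and a: "a > 0" using assms(1,2) by (auto simp: b_def a_def)
  have a1: "a + 1 = (N - 1) / (\<gamma> - 1)" using assms(1) by (simp add: a_def N_def field_simps)
  have u: "0 < u x" for x using assms(3) by (simp add: positive_solution_def)
  define C where "C = (b / (a / 2)) powr b"
  have C: "C > 0" using a b by (simp add: C_def)
  define k where "k = min \<kappa> ((\<mu> * (a / 2) / C) powr (1 / b))"
  have k: "k > 0" "k \<le> \<kappa>" using assms(4,6) a C by (auto simp: k_def)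
  have kb: "k powr b * C * (2 / a) \<le> \<mu>"
  proof -
    have "k powr b \<le> ((\<mu> * (a / 2) / C) powr (1 / b)) powr b"
      using k(1) b by (intro powr_mono2) (auto simp: k_def)
    also have "\<dots> = \<mu> * (a / 2) / C" using assms(6) a b C by (simp add: powr_powr)
    finally show ?thesis using C a by (simp add: field_simps)
  qed
  define g where "g t = t powr (- (a + 1)) * (k * ln t) powr b" for t
  have cg: "continuous_on {1..R} g" for R
    unfolding g_def using b k(1) by (intro continuous_intros continuous_on_powr') auto
  have gb: "g t \<le> k powr b * C * t powr (- (a / 2) - 1)" if "t \<ge> 1" for t
  proof -
    have "g t = k powr b * (t powr (- (a + 1)) * (ln t) powr b)"
      using k(1) that by (simp add: g_def powr_mult)
    also have "\<dots> \<le> k powr b * (t powr (- (a + 1)) * (C * t powr (a / 2)))"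
      using ln_powr_le[OF that, of "a / 2" b] a b by (intro mult_left_mono) (auto simp: C_def)
    also have "t powr (- (a + 1)) * (C * t powr (a / 2)) = C * t powr (- (a / 2) - 1)"
      using that by (simp add: powr_add[symmetric] field_simps)
    finally show ?thesis by (simp add: mult.assoc)
  qed
  have int_le: "integral {1..R} g \<le> \<mu>" if "R \<ge> 1" for R
  proof -
    let ?B = "\<lambda>t. - (k powr b * C * (2 / a)) * t powr (- (a / 2))"
    have B: "((\<lambda>t. k powr b * C * t powr (- (a / 2) - 1)) has_integral (?B R - ?B 1)) {1..R}"
    proof (rule fundamental_theorem_of_calculus[OF that])
      fix t assume "t \<in> {1..R}"
      then have "(?B has_real_derivative - (k powr b * C * (2 / a)) * (- (a / 2) * t powr (- (a / 2) - 1))) (at t within {1..R})"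
        by (intro derivative_intros DERIV_cmult has_field_derivative_at_within[OF has_real_derivative_powr]) auto
      then show "(?B has_vector_derivative k powr b * C * t powr (- (a / 2) - 1)) (at t within {1..R})"
        using a by (simp add: has_real_derivative_iff_has_vector_derivative mult.assoc)
    qed
    have "integral {1..R} g \<le> ?B R - ?B 1"
    proof (rule integral_le[OF _ has_integral_integrable[OF B], unfolded integral_unique[OF B]])
      show "g integrable_on {1..R}" by (rule integrable_continuous_real[OF cg])
    qed (use gb in auto)
    also have "\<dots> \<le> k powr b * C * (2 / a)" using k C a by simp
    finally show ?thesis using kb by linarith
  qed
  let ?c = "2 powr (- (a + 1)) * k powr b"
  have bound: "?c * norm x powr (- a) * (ln (norm x)) powr b \<le> u x" if x: "norm x > 1" for x
  proof -
    define t where "t = norm x"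
    have t: "t > 1" using x by (simp add: t_def)
    define \<omega> where "\<omega> s = integral {1..2 * t} g - integral {1..s} g" for s
    have "\<omega> (norm x) \<le> u x"
    proof (rule annulus_lower_bound[OF assms(1,3), where \<rho> = 1 and R = "2 * t" and \<Phi> = "\<lambda>t. k * ln t" and \<Phi>' = "\<lambda>t. k / t"])
      have d: "((\<lambda>s. integral {1..s} g) has_real_derivative g s) (at s within {1..2 * t})" if "s \<in> {1..2 * t}" for s
        by (rule integral_has_real_derivative[OF cg that])
      then have "continuous_on {1..2 * t} (\<lambda>s. integral {1..s} g)" by (rule DERIV_continuous_on)
      then show "continuous_on {1..2 * t} \<omega>"
        unfolding \<omega>_def[abs_def] by (intro continuous_on_diff continuous_on_const)
      fix s assume s: "1 < s" "s < 2 * t"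
      have "at s within {1..2 * t} = at s"
        by (rule at_within_interior) (use s in \<open>simp add: interior_atLeastAtMost_real\<close>)
      then have "((\<lambda>s. integral {1..s} g) has_real_derivative g s) (at s)"
        using d[of s] s by simp
      then have "(\<omega> has_real_derivative - g s) (at s)"
        unfolding \<omega>_def[abs_def] by (auto intro!: derivative_eq_intros)
      then show "(\<omega> has_real_derivative - (s powr - ((real CARD('n) - 1) / (\<gamma> - 1)) * (k * ln s) powr (1 / (\<gamma> - 1)))) (at s)"
        by (simp add: g_def a1 N_def b_def)
      show "0 \<le> k * ln s" using s k by simp
      show "((\<lambda>t. k * ln t) has_real_derivative k / s) (at s)"
        using s by (auto intro!: derivative_eq_intros)
    next
      show "continuous_on {1<..<2 * t} (\<lambda>t. k / t)" by (intro continuous_intros) auto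
    next
      fix y :: "real^'n" assume y: "1 < norm y" "norm y < 2 * t"
      have "k / norm y * norm y powr (1 - N) = k * norm y powr (- N)"
        using y by (simp add: powr_diff powr_minus field_simps)
      also have "\<dots> \<le> \<kappa> * norm y powr (- N)" using k by (intro mult_right_mono) auto
      also have "\<dots> \<le> f y" using assms(5)[of y] y by (simp add: N_def)
      finally show "k / norm y * norm y powr (1 - real CARD('n)) \<le> f y" by (simp add: N_def)
    next
      fix y :: "real^'n" assume "norm y = 1"
      then show "\<omega> 1 \<le> u y" using assms(7)[of y] int_le[of "2 * t"] t by (simp add: \<omega>_def)
    qed (use t u in \<open>auto simp: \<omega>_def less_imp_le t_def\<close>)
    moreover have "?c * t powr (- a) * (ln t) powr b \<le> \<omega> t"
    proof -
      have "\<omega> t = integral {t..2 * t} g"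
        using Henstock_Kurzweil_Integration.integral_combine[of 1 t "2 * t" g] t integrable_continuous_real[OF cg]
        by (simp add: \<omega>_def)
      moreover have "integral {t..2 * t} (\<lambda>_. (2 * t) powr (- (a + 1)) * (k * ln t) powr b) \<le> integral {t..2 * t} g"
      proof (rule integral_le)
        show "g integrable_on {t..2 * t}"
          by (rule integrable_continuous_real[OF continuous_on_subset[OF cg[of "2 * t"]]]) (use t in auto)
        fix s assume s: "s \<in> {t..2 * t}"
        show "(2 * t) powr (- (a + 1)) * (k * ln t) powr b \<le> g s"
          unfolding g_def using s t a b k(1) by (intro mult_mono powr_mono2 powr_mono2') auto
      qed auto
      moreover have "integral {t..2 * t} (\<lambda>_. (2 * t) powr (- (a + 1)) * (k * ln t) powr b)
          = ?c * t powr (- a) * (ln t) powr b"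
      proof -
        have "t * t powr (- (a + 1)) = t powr (- a)"
          using powr_mult_base[of t "- (a + 1)"] t by simp
        then have "t * ((2 * t) powr (- (a + 1)) * (k * ln t) powr b)
            = ?c * t powr (- a) * (ln t) powr b"
          using t k(1) by (simp add: powr_mult mult_ac)
        then show ?thesis using t by (simp add: mult_ac)
      qed
      ultimately show ?thesis by simp
    qed
    ultimately show ?thesis by (simp add: t_def)
  qed
  show ?thesis
  proof (intro exI[of _ "?c"] conjI allI impI)
    show "?c > 0" using k by simp
    fix x :: "real^'n" assume "norm x \<ge> 1"
    then show "?c * norm x powr (- a) * (ln (norm x)) powr (1 / (\<gamma> - 1)) \<le> u x"
      using bound[of x] u[of x] by (cases "norm x = 1") (auto simp: b_def less_imp_le)
  qed
qed

section \<open>Nonexistence\<close>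

definition ball_min :: "(real^'n \<Rightarrow> real) \<Rightarrow> real \<Rightarrow> real" where
  "ball_min u r = (INF x\<in>cball 0 r. u x)"

lemma double_bounded_source_nonneg: "double_bounded c \<Longrightarrow> 0 \<le> c x * t powr (a::real)"
  unfolding double_bounded_def
  by (meson divide_pos_pos less_imp_le mult_nonneg_nonneg order_trans powr_ge_zero zero_less_one)

lemma ball_min_attained:
  fixes u :: "real^'n \<Rightarrow> real"
  assumes "continuous_on UNIV u" "r \<ge> 0"
  obtains x where "norm x \<le> r" "ball_min u r = u x"
proof -
  have "\<exists>x\<in>cball 0 r. \<forall>y\<in>cball 0 r. u x \<le> u y"
    by (rule continuous_attains_inf) (use assms in \<open>auto intro: continuous_on_subset\<close>)
  then obtain x where x: "x \<in> cball 0 r" "\<And>y. y \<in> cball 0 r \<Longrightarrow> u x \<le> u y" by blast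
  then have "ball_min u r = u x"
    unfolding ball_min_def by (intro cInf_eq_minimum) auto
  with x(1) show ?thesis by (intro that[of x]) auto
qed

lemma ball_min_le:
  fixes u :: "real^'n \<Rightarrow> real"
  assumes "continuous_on UNIV u" "norm x \<le> r"
  shows "ball_min u r \<le> u x"
proof -
  have "r \<ge> 0" using assms(2) norm_ge_zero order_trans by blast
  have "bounded (u ` cball 0 r)"
    by (rule compact_imp_bounded[OF compact_continuous_image]) (use assms(1) in \<open>auto intro: continuous_on_subset\<close>)
  then show ?thesis
    unfolding ball_min_def using assms(2) by (intro cINF_lower bounded_imp_bdd_below) auto
qed

lemma positive_solution_ball_min_pos:
  assumes "positive_solution \<gamma> u f" "r \<ge> 0"
  shows "ball_min u r > 0"
proof -
  have "continuous_on UNIV u" "\<And>x. 0 < u x" using assms(1) by (auto simp: positive_solution_def)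
  then show ?thesis using ball_min_attained[OF _ assms(2), of u] by metis
qed

text \<open>Outside the ball of radius \<open>\<rho>\<close> the fundamental solution bounds the decay. In particular doubling the radius costs
  only a constant factor.\<close>

lemma ball_min_ge_decay:
  fixes u f :: "real^'n \<Rightarrow> real"
  assumes "\<gamma> > 1" "\<gamma> < real CARD('n)" "positive_solution \<gamma> u f" "\<And>x. f x \<ge> 0" "0 < \<rho>" "\<rho> \<le> r"
  defines "a \<equiv> (real CARD('n) - \<gamma>) / (\<gamma> - 1)"
  shows "ball_min u \<rho> * (\<rho> / r) powr a \<le> ball_min u r"
proof -
  have u: "continuous_on UNIV u" using assms(3) by (simp add: positive_solution_def)
  have a: "a > 0" using assms(1,2) by (simp add: a_def)
  have pos: "ball_min u \<rho> > 0" using positive_solution_ball_min_pos[OF assms(3)] assms(5) by simp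
  obtain x where x: "norm x \<le> r" "ball_min u r = u x" using ball_min_attained[OF u, of r] assms(5,6) by auto
  show ?thesis
  proof (cases "norm x \<le> \<rho>")
    case True
    have "(\<rho> / r) powr a \<le> 1 powr a" using assms(5,6) a by (intro powr_mono2) auto
    then have "ball_min u \<rho> * (\<rho> / r) powr a \<le> ball_min u \<rho> * 1" using pos by (intro mult_left_mono) auto
    then show ?thesis using ball_min_le[OF u True] x(2) by simp
  next
    case False
    have "(\<rho> / r) powr a \<le> (\<rho> / norm x) powr a"
      using False x(1) assms(5,6) a by (intro powr_mono2 divide_left_mono mult_pos_pos) auto
    then have "ball_min u \<rho> * (\<rho> / r) powr a \<le> ball_min u \<rho> * (\<rho> / norm x) powr a"
      using pos by (intro mult_left_mono) auto
    also have "\<dots> \<le> u x"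
      unfolding a_def
      by (rule fundamental_lower_bound[OF assms(1-5)]) (use False pos ball_min_le[OF u] in auto)
    finally show ?thesis using x(2) by simp
  qed
qed

lemma ball_min_ge_source:
  fixes u f :: "real^'n \<Rightarrow> real"
  assumes "\<gamma> > 1" "positive_solution \<gamma> u f" "r > 0" "\<kappa> \<ge> 0" "\<And>x. norm x \<le> 2 * r \<Longrightarrow> \<kappa> \<le> f x"
  defines "\<gamma>' \<equiv> \<gamma> / (\<gamma> - 1)"
  shows "(\<kappa> / real CARD('n)) powr (1 / (\<gamma> - 1)) / \<gamma>' * (2 powr \<gamma>' - 1) * r powr \<gamma>' \<le> ball_min u r"
proof -
  have u: "continuous_on UNIV u" "\<And>x. 0 < u x" using assms(2) by (auto simp: positive_solution_def)
  have g': "\<gamma>' > 0" using assms(1) by (simp add: \<gamma>'_def)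
  obtain x where x: "norm x \<le> r" "ball_min u r = u x" using ball_min_attained[OF u(1), of r] assms(3) by auto
  have "(2 powr \<gamma>' - 1) * r powr \<gamma>' = (2 * r) powr \<gamma>' - r powr \<gamma>'"
    using assms(3) by (simp add: powr_mult algebra_simps)
  also have "\<dots> \<le> (2 * r) powr \<gamma>' - norm x powr \<gamma>'"
    using x(1) g' powr_mono2[of \<gamma>' "norm x" r] by simp
  finally have "(\<kappa> / real CARD('n)) powr (1 / (\<gamma> - 1)) / \<gamma>' * ((2 powr \<gamma>' - 1) * r powr \<gamma>')
      \<le> (\<kappa> / real CARD('n)) powr (1 / (\<gamma> - 1)) / \<gamma>' * ((2 * r) powr \<gamma>' - norm x powr \<gamma>')"
    using g' by (intro mult_left_mono) auto
  also have "\<dots> = 0 + (\<kappa> / real CARD('n)) powr (1 / (\<gamma> - 1)) / \<gamma>' * ((2 * r) powr \<gamma>' - norm x powr \<gamma>')" by simp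
  also have "\<dots> \<le> u x"
    unfolding \<gamma>'_def
    by (rule torsion_lower_bound[OF assms(1,2) _ assms(4)])
       (use assms(3,5) x(1) u(2) in \<open>auto simp: less_imp_le\<close>)
  finally show ?thesis using x(2) by (simp add: mult.assoc)
qed

text \<open>On the ball of radius \<open>2 * r\<close> the right-hand side of the equation for \<open>u\<close> is at least a multiple of the \<open>q\<close>-th
  power of the minimum of \<open>v\<close> there, which is comparable with the minimum over the ball of radius \<open>r\<close>; the torsion
  function turns this into a lower bound for \<open>u\<close>.\<close>

lemma ball_min_coupling:
  fixes u v c f :: "real^'n \<Rightarrow> real"
  assumes "\<gamma> > 1" "\<gamma> < real CARD('n)" "q > 0" "double_bounded c"
    and u: "positive_solution \<gamma> u (\<lambda>x. c x * v x powr q)" and v: "positive_solution \<gamma> v f" "\<And>x. f x \<ge> 0"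
  shows "\<exists>K>0. \<forall>r>0. K * r powr (\<gamma> / (\<gamma> - 1)) * ball_min v r powr (q / (\<gamma> - 1)) \<le> ball_min u r"
proof -
  define a where "a = (real CARD('n) - \<gamma>) / (\<gamma> - 1)"
  define \<gamma>' where "\<gamma>' = \<gamma> / (\<gamma> - 1)"
  obtain C where C: "C > 0" "\<And>x. 1 / C \<le> c x" using assms(4) by (auto simp: double_bounded_def)
  have cv: "continuous_on UNIV v" using v(1) by (simp add: positive_solution_def)
  define B where "B = (1 / C * (2 powr (- a)) powr q / real CARD('n)) powr (1 / (\<gamma> - 1)) / \<gamma>' * (2 powr \<gamma>' - 1)"
  have g': "\<gamma>' > 0" using assms(1) by (simp add: \<gamma>'_def)
  have "2 powr \<gamma>' > (1::real)" using g' by simp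
  then have "B > 0" using g' C by (simp add: B_def)
  moreover have "B * r powr \<gamma>' * ball_min v r powr (q / (\<gamma> - 1)) \<le> ball_min u r" if r: "r > 0" for r
  proof -
    have m: "ball_min v r > 0" using positive_solution_ball_min_pos[OF v(1)] r by simp
    have low: "2 powr (- a) * ball_min v r \<le> ball_min v (2 * r)"
      using ball_min_ge_decay[OF assms(1,2) v, of r "2 * r"] r
      by (simp add: a_def[symmetric] powr_divide powr_minus field_simps)
    define \<kappa> where "\<kappa> = 1 / C * (2 powr (- a) * ball_min v r) powr q"
    have \<kappa>: "\<kappa> \<le> c x * v x powr q" if "norm x \<le> 2 * r" for x
    proof -
      have "2 powr (- a) * ball_min v r \<le> v x" using low ball_min_le[OF cv that] by linarith
      then have "(2 powr (- a) * ball_min v r) powr q \<le> v x powr q"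
        using m assms(3) by (intro powr_mono2) auto
      then show ?thesis unfolding \<kappa>_def using C(2)[of x] C(1)
        by (intro mult_mono) (auto intro: order_trans[of 0 "1 / C"])
    qed
    have "(\<kappa> / real CARD('n)) powr (1 / (\<gamma> - 1)) / \<gamma>' * (2 powr \<gamma>' - 1) * r powr \<gamma>' \<le> ball_min u r"
      unfolding \<gamma>'_def by (rule ball_min_ge_source[OF assms(1) u r _ \<kappa>]) (use C in \<open>simp add: \<kappa>_def\<close>)
    moreover have "(\<kappa> / real CARD('n)) powr (1 / (\<gamma> - 1))
        = (1 / C * (2 powr (- a)) powr q / real CARD('n)) powr (1 / (\<gamma> - 1)) * ball_min v r powr (q / (\<gamma> - 1))"
    proof -
      have "\<kappa> / real CARD('n) = (1 / C * (2 powr (- a)) powr q / real CARD('n)) * ball_min v r powr q"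
        using m by (simp add: \<kappa>_def powr_mult)
      moreover have "((1 / C * (2 powr (- a)) powr q / real CARD('n)) * ball_min v r powr q) powr (1 / (\<gamma> - 1))
          = (1 / C * (2 powr (- a)) powr q / real CARD('n)) powr (1 / (\<gamma> - 1)) * (ball_min v r powr q) powr (1 / (\<gamma> - 1))"
        by (rule powr_mult)
      ultimately show ?thesis by (simp add: powr_powr)
    qed
    ultimately show ?thesis by (simp add: B_def mult_ac)
  qed
  ultimately show ?thesis unfolding \<gamma>'_def by blast
qed

lemma ball_min_ge_sphere:
  fixes u f :: "real^'n \<Rightarrow> real"
  assumes "\<gamma> > 1" "positive_solution \<gamma> u f" "\<And>x. f x \<ge> 0" "r > 0" "\<And>x. norm x = r \<Longrightarrow> m \<le> u x"
  shows "m \<le> ball_min u r"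
proof -
  have u: "continuous_on UNIV u" using assms(2) by (auto simp: positive_solution_def)
  obtain x where x: "norm x \<le> r" "ball_min u r = u x" using ball_min_attained[OF u, of r] assms(4) by auto
  show ?thesis
  proof (cases "norm x = r")
    case False
    then have "x \<in> ball 0 r" using x(1) by simp
    from torsion_lower_bound[OF assms(1,2,4) order_refl _ _ this, of m]
    show ?thesis using x(2) assms(3,5) by simp
  qed (use x assms(5) in simp)
qed

lemma powr_unbounded:
  fixes e K B :: real
  assumes "e > 0" "K > 0"
  obtains r where "r \<ge> 1" "K * r powr e > B"
proof
  define r where "r = max 1 (((\<bar>B\<bar> + 1) / K) powr (1 / e))"
  show "r \<ge> 1" by (simp add: r_def)
  have "(\<bar>B\<bar> + 1) / K = (((\<bar>B\<bar> + 1) / K) powr (1 / e)) powr e" using assms by (simp add: powr_powr)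
  also have "\<dots> \<le> r powr e" using assms by (intro powr_mono2) (auto simp: r_def)
  finally have "\<bar>B\<bar> + 1 \<le> K * r powr e" using assms by (simp add: field_simps)
  then show "K * r powr e > B" by linarith
qed

text \<open>Inserting the two coupling inequalities into each other gives \<open>K * r powr e * M powr P \<le> M\<close> for the minimum \<open>M\<close> of
  \<open>u\<close> over the ball of radius \<open>r\<close>, with \<open>e > 0\<close> and \<open>P = p * q / (\<gamma> - 1)\<^sup>2\<close>. Since \<open>M\<close> is bounded, this fails for large
  \<open>r\<close> if \<open>P \<le> 1\<close>. If \<open>P > 1\<close>, then \<open>M\<close> is at most a multiple of \<open>r powr (- e / (P - 1))\<close>, but by comparison with the
  fundamental solution at least a multiple of \<open>r powr (- a)\<close>; so \<open>e \<le> a * (P - 1)\<close>. The hypothesis on the exponents is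
  the reverse inequality, and equality contradicts the logarithmic lower bound.\<close>

lemma no_positive_solution_pair:
  fixes u v c1 c2 :: "real^'n \<Rightarrow> real"
  assumes "\<gamma> > 1" "\<gamma> < real CARD('n)" "p > 0" "q > 0" "double_bounded c1" "double_bounded c2"
    and u: "positive_solution \<gamma> u (\<lambda>x. c1 x * v x powr q)"
    and v: "positive_solution \<gamma> v (\<lambda>x. c2 x * u x powr p)"
    and exponents: "p * q \<le> (\<gamma> - 1)\<^sup>2 \<or> p * q > (\<gamma> - 1)\<^sup>2 \<and>
      \<gamma> * (q + \<gamma> - 1) / (p * q - (\<gamma> - 1)\<^sup>2) \<ge> (real CARD('n) - \<gamma>) / (\<gamma> - 1)"
  shows False
proof -
  define n where "n = real CARD('n)"
  define a where "a = (n - \<gamma>) / (\<gamma> - 1)"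
  define \<gamma>' where "\<gamma>' = \<gamma> / (\<gamma> - 1)"
  define b where "b = 1 / (\<gamma> - 1)"
  define e where "e = \<gamma>' * (1 + q * b)"
  define P where "P = p * q * b\<^sup>2"
  have b: "b > 0" "b * (\<gamma> - 1) = 1" and a: "a > 0" and g': "\<gamma>' > 0" and "\<gamma>' = \<gamma> * b"
    using assms(1,2) by (auto simp: b_def a_def \<gamma>'_def n_def)
  have e: "e > 0" using g' b assms(4) by (simp add: e_def add_pos_pos)
  have cu: "continuous_on UNIV u" and cv: "continuous_on UNIV v" and up: "\<And>x. 0 < u x" and vp: "\<And>x. 0 < v x"
    using u v by (auto simp: positive_solution_def)
  obtain C where C: "C > 0" "\<And>x. 1 / C \<le> c1 x" using assms(5) by (auto simp: double_bounded_def)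
  note f1 = double_bounded_source_nonneg[OF assms(5)] and f2 = double_bounded_source_nonneg[OF assms(6)]
  let ?M = "ball_min u" and ?N = "ball_min v"
  have Mpos: "?M r > 0" and Npos: "?N r > 0" if "r > 0" for r
    using positive_solution_ball_min_pos[OF u] positive_solution_ball_min_pos[OF v] that by auto
  obtain K1 where K1: "K1 > 0" "\<And>r. r > 0 \<Longrightarrow> K1 * r powr \<gamma>' * ?N r powr (q * b) \<le> ?M r"
    using ball_min_coupling[OF assms(1,2,4,5) u v f2] by (auto simp: \<gamma>'_def b_def)
  obtain K2 where K2: "K2 > 0" "\<And>r. r > 0 \<Longrightarrow> K2 * r powr \<gamma>' * ?M r powr (p * b) \<le> ?N r"
    using ball_min_coupling[OF assms(1,2,3,6) v u f1] by (auto simp: \<gamma>'_def b_def)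
  define K where "K = K1 * K2 powr (q * b)"
  have K: "K > 0" using K1(1) K2(1) by (simp add: K_def)
  have self: "K * r powr e * ?M r powr P \<le> ?M r" if r: "r > 0" for r
  proof -
    have "(K2 * r powr \<gamma>' * ?M r powr (p * b)) powr (q * b) \<le> ?N r powr (q * b)"
      using K2 r assms(4) b by (intro powr_mono2) auto
    also have "(K2 * r powr \<gamma>' * ?M r powr (p * b)) powr (q * b)
        = K2 powr (q * b) * r powr (\<gamma>' * (q * b)) * ?M r powr P"
      using K2(1) r by (simp add: powr_mult powr_powr P_def power2_eq_square mult_ac)
    finally have "K1 * r powr \<gamma>' * (K2 powr (q * b) * r powr (\<gamma>' * (q * b)) * ?M r powr P)
        \<le> K1 * r powr \<gamma>' * ?N r powr (q * b)"
      using K1(1) by (intro mult_left_mono) auto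
    also have "\<dots> \<le> ?M r" by (rule K1(2)[OF r])
    also have "K1 * r powr \<gamma>' * (K2 powr (q * b) * r powr (\<gamma>' * (q * b)) * ?M r powr P)
        = K * (r powr \<gamma>' * r powr (\<gamma>' * (q * b))) * ?M r powr P" by (simp add: K_def mult_ac)
    also have "r powr \<gamma>' * r powr (\<gamma>' * (q * b)) = r powr e"
      by (simp add: e_def powr_add[symmetric] distrib_left)
    finally show ?thesis .
  qed
  have self': "K * r powr e * ?M r powr (P - 1) \<le> 1" if r: "r > 0" for r
  proof -
    have "K * r powr e * ?M r powr (P - 1) = K * r powr e * ?M r powr P / ?M r"
      using Mpos[OF r] by (simp add: powr_diff)
    also have "\<dots> \<le> 1" using self[OF r] Mpos[OF r] by simp
    finally show ?thesis .
  qed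
  show False
  proof (cases "P \<le> 1")
    case True
    have le: "?M r \<le> u 0" if "r > 0" for r using ball_min_le[OF cu, of 0 r] that by simp
    have "u 0 \<noteq> 0" using up[of 0] by simp
    then have "K * (u 0) powr (P - 1) > 0" using K by simp
    then obtain r where r: "r \<ge> 1" "K * (u 0) powr (P - 1) * r powr e > 1"
      using powr_unbounded[OF e] by blast
    have "(u 0) powr (P - 1) \<le> ?M r powr (P - 1)"
      using True le[of r] Mpos[of r] r by (intro powr_mono2') auto
    then have "K * r powr e * (u 0) powr (P - 1) \<le> K * r powr e * ?M r powr (P - 1)"
      using K by (intro mult_left_mono) auto
    also have "\<dots> \<le> 1" by (rule self') (use r in simp)
    finally show False using r(2) by (simp add: mult_ac)
  next
    case False
    have Pb: "P - 1 = b\<^sup>2 * (p * q - (\<gamma> - 1)\<^sup>2)"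
    proof -
      have "b\<^sup>2 * (\<gamma> - 1)\<^sup>2 = 1" using b(2) by (metis power_mult_distrib power_one)
      then show ?thesis by (simp add: P_def algebra_simps)
    qed
    then have pq: "p * q > (\<gamma> - 1)\<^sup>2" using False b(1) by (smt (verit) mult_nonneg_nonpos zero_le_power2)
    then have "\<gamma> * (q + \<gamma> - 1) / (p * q - (\<gamma> - 1)\<^sup>2) \<ge> a"
      using exponents by (auto simp: a_def n_def)
    then have "a * (p * q - (\<gamma> - 1)\<^sup>2) \<le> \<gamma> * (q + \<gamma> - 1)"
      using pq by (simp add: pos_le_divide_eq)
    then have "b\<^sup>2 * (a * (p * q - (\<gamma> - 1)\<^sup>2)) \<le> b\<^sup>2 * (\<gamma> * (q + \<gamma> - 1))"
      by (rule mult_left_mono) simp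
    moreover have "b\<^sup>2 * (\<gamma> * (q + \<gamma> - 1)) = e"
    proof -
      have "b\<^sup>2 * (\<gamma> * (q + \<gamma> - 1)) = \<gamma> * b * (q * b + b * (\<gamma> - 1))"
        by (simp add: power2_eq_square algebra_simps)
      then show ?thesis by (simp add: b(2) e_def \<open>\<gamma>' = \<gamma> * b\<close> add.commute)
    qed
    ultimately have ae: "a * (P - 1) \<le> e" by (simp add: Pb mult_ac)
    define \<mu> where "\<mu> = ?M 1"
    have \<mu>: "\<mu> > 0" using Mpos by (simp add: \<mu>_def)
    have lower: "\<mu> * r powr (- a) \<le> ?M r" if "r \<ge> 1" for r
      using ball_min_ge_decay[OF assms(1,2) u f1, of 1 r] that
      by (simp add: \<mu>_def a_def n_def powr_divide powr_minus field_simps)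
    have "e \<le> a * (P - 1)"
    proof (rule ccontr)
      assume "\<not> e \<le> a * (P - 1)"
      then have pos: "e - a * (P - 1) > 0" by simp
      have "K * \<mu> powr (P - 1) > 0" using K \<mu> by simp
      then obtain r where r: "r \<ge> 1" "K * \<mu> powr (P - 1) * r powr (e - a * (P - 1)) > 1"
        using powr_unbounded[OF pos] by blast
      have "(\<mu> * r powr (- a)) powr (P - 1) \<le> ?M r powr (P - 1)"
        using lower[OF r(1)] \<mu> False by (intro powr_mono2) auto
      then have "K * r powr e * (\<mu> * r powr (- a)) powr (P - 1) \<le> K * r powr e * ?M r powr (P - 1)"
        using K by (intro mult_left_mono) auto
      also have "\<dots> \<le> 1" by (rule self') (use r in simp)
      also have "K * r powr e * (\<mu> * r powr (- a)) powr (P - 1)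
          = K * \<mu> powr (P - 1) * (r powr e * r powr (- a * (P - 1)))"
        using \<mu> by (simp add: powr_mult powr_powr mult_ac)
      also have "r powr e * r powr (- a * (P - 1)) = r powr (e - a * (P - 1))"
        by (simp add: powr_add[symmetric])
      finally show False using r(2) by simp
    qed
    with ae have crit: "e = a * (P - 1)" by simp
    define L where "L = (1 / K) powr (1 / (P - 1))"
    have upper: "?M r \<le> L * r powr (- a)" if r: "r > 0" for r
    proof -
      have "?M r powr (P - 1) \<le> 1 / (K * r powr e)"
        using self'[OF r] K r by (simp add: field_simps)
      then have "(?M r powr (P - 1)) powr (1 / (P - 1)) \<le> (1 / (K * r powr e)) powr (1 / (P - 1))"
        using False by (intro powr_mono2) auto
      moreover have "(?M r powr (P - 1)) powr (1 / (P - 1)) = ?M r"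
        using False Mpos[OF r] by (simp add: powr_powr)
      moreover have "(1 / (K * r powr e)) powr (1 / (P - 1)) = L * r powr (- a)"
      proof -
        have "1 / (K * r powr e) = 1 / K * r powr (- e)" by (simp add: powr_minus field_simps)
        then have "(1 / (K * r powr e)) powr (1 / (P - 1)) = L * (r powr (- e)) powr (1 / (P - 1))"
          unfolding L_def by (simp only: powr_mult)
        also have "(r powr (- e)) powr (1 / (P - 1)) = r powr (- a)"
          using False by (simp add: powr_powr crit)
        finally show ?thesis .
      qed
      ultimately show ?thesis by simp
    qed
    \<comment> \<open>In the critical case the lower bound for \<open>u\<close> makes the right-hand side of its own equation as large as
      \<open>\<bar>x\<bar> powr (- n)\<close>.\<close>
    have ve: "q * (\<gamma>' - a * (p * b)) = - n"
    proof -
      have "q * b * (\<gamma>' - a * (p * b)) = \<gamma>' * (q * b) - a * P"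
        by (simp add: P_def power2_eq_square algebra_simps)
      also have "\<dots> = - (a + \<gamma>')" using crit by (simp add: e_def algebra_simps)
      also have "a + \<gamma>' = n * b" by (simp add: a_def \<gamma>'_def b_def add_divide_distrib[symmetric])
      finally have "b * (q * (\<gamma>' - a * (p * b))) = b * (- n)" by (simp add: mult_ac)
      then show ?thesis using b(1) by (simp only: mult_left_cancel[OF less_imp_neq[OF b(1), symmetric]])
    qed
    define D where "D = K2 * \<mu> powr (p * b)"
    have D: "D > 0" using K2(1) \<mu> by (simp add: D_def)
    have vlow: "D * norm x powr (\<gamma>' - a * (p * b)) \<le> v x" if x: "norm x \<ge> 1" for x
    proof -
      have "(\<mu> * norm x powr (- a)) powr (p * b) \<le> ?M (norm x) powr (p * b)"
        using lower[OF x] \<mu> assms(3) b by (intro powr_mono2) auto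
      then have "K2 * norm x powr \<gamma>' * (\<mu> * norm x powr (- a)) powr (p * b)
          \<le> K2 * norm x powr \<gamma>' * ?M (norm x) powr (p * b)"
        using K2(1) by (intro mult_left_mono) auto
      also have "\<dots> \<le> ?N (norm x)" using K2(2)[of "norm x"] x by linarith
      also have "\<dots> \<le> v x" by (rule ball_min_le[OF cv order_refl])
      also have "K2 * norm x powr \<gamma>' * (\<mu> * norm x powr (- a)) powr (p * b)
          = D * (norm x powr \<gamma>' * norm x powr (- a * (p * b)))"
        using \<mu> by (simp add: D_def powr_mult powr_powr mult_ac)
      also have "norm x powr \<gamma>' * norm x powr (- a * (p * b)) = norm x powr (\<gamma>' - a * (p * b))"
        by (simp add: powr_add[symmetric])
      finally show ?thesis .
    qed
    have flow: "1 / C * D powr q * norm x powr (- n) \<le> c1 x * v x powr q" if x: "norm x \<ge> 1" for x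
    proof -
      have "(D * norm x powr (\<gamma>' - a * (p * b))) powr q \<le> v x powr q"
        using vlow[OF x] D assms(4) by (intro powr_mono2) auto
      moreover have "(D * norm x powr (\<gamma>' - a * (p * b))) powr q = D powr q * norm x powr (- n)"
        using D ve by (simp add: powr_mult powr_powr mult.commute)
      ultimately have "1 / C * (D powr q * norm x powr (- n)) \<le> c1 x * v x powr q"
        using C(1) C(2)[of x] by (intro mult_mono) (auto intro: order_trans[of 0 "1 / C"])
      then show ?thesis by (simp add: mult.assoc)
    qed
    have pos: "1 / C * D powr q > 0" using C D by simp
    have "\<exists>c>0. \<forall>x. norm x \<ge> 1 \<longrightarrow> c * norm x powr (- a) * (ln (norm x)) powr b \<le> u x"
      unfolding a_def b_def n_def
    proof (rule logarithmic_lower_bound[OF assms(1,2) u pos _ \<mu>])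
      show "1 / C * D powr q * norm x powr (- real CARD('n)) \<le> c1 x * v x powr q" if "1 \<le> norm x" for x
        using flow[OF that] by (simp add: n_def)
      show "\<mu> \<le> u x" if "norm x = 1" for x
        unfolding \<mu>_def by (rule ball_min_le[OF cu]) (simp add: that)
    qed
    then obtain c where c: "c > 0"
      "\<And>x. norm x \<ge> 1 \<Longrightarrow> c * norm x powr (- a) * (ln (norm x)) powr b \<le> u x" by blast
    have log_le: "(ln r) powr b \<le> L / c" if r: "r \<ge> 1" for r
    proof -
      have "c * r powr (- a) * (ln r) powr b \<le> ?M r"
        by (rule ball_min_ge_sphere[OF assms(1) u f1]) (use r c(2) in auto)
      also have "\<dots> \<le> L * r powr (- a)" by (rule upper) (use r in simp)
      finally have "c * (ln r) powr b * r powr (- a) \<le> L * r powr (- a)" by (simp add: mult_ac)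
      then have "c * (ln r) powr b \<le> L" by (rule mult_right_le_imp_le) (use r in simp)
      then show ?thesis using c(1) by (simp add: field_simps)
    qed
    obtain t where t: "t \<ge> 1" "1 * t powr b > L / c" using powr_unbounded[OF b(1), of 1 "L / c"] by auto
    have "t powr b \<le> L / c" using log_le[of "exp t"] t(1) by simp
    then show False using t(2) by simp
  qed
qed

section \<open>Existence\<close>

lemma classical_positive_solution:
  fixes u s f :: "real^'n \<Rightarrow> real"
  assumes "\<gamma> > 1" "\<And>x. 0 < u x"
    and u: "\<And>x. GDERIV u x :> W x" "continuous_on UNIV W"
    and flux: "\<And>x. (norm (W x) powr (\<gamma> - 2)) *\<^sub>R W x = s x *\<^sub>R x"
    and s: "\<And>x. GDERIV s x :> S x" "continuous_on UNIV S"
    and f: "\<And>x. real CARD('n) * s x + S x \<bullet> x = - f x"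
  shows "positive_solution \<gamma> u f"
proof -
  have cu: "continuous_on UNIV u" and cs: "continuous_on UNIV s"
    using u(1) s(1) by (auto intro: continuous_on_gderiv)
  have cf: "continuous_on UNIV (\<lambda>x. - f x)"
    unfolding f[symmetric] by (intro continuous_intros cs s)
  have "has_weak_gradient u W"
    unfolding has_weak_gradient_def
  proof (intro conjI allI impI)
    show "locally_integrable u" "locally_integrable W"
      using cu u(2) by (auto intro: locally_integrable_continuous)
    fix \<phi> :: "real^'n \<Rightarrow> real" and D assume \<phi>: "test_function \<phi> D"
    have "test_function (\<lambda>x. \<phi> x * u x) (\<lambda>x. u x *\<^sub>R D x + \<phi> x *\<^sub>R W x)"
      by (rule test_function_mult_C1[OF \<phi> open_UNIV]) (use u in auto)
    then have "(LINT x|lebesgue. u x *\<^sub>R D x + \<phi> x *\<^sub>R W x) = 0" by (rule integral_gradient_test_function)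
    moreover have "integrable lebesgue (\<lambda>x. u x *\<^sub>R D x)" "integrable lebesgue (\<lambda>x. \<phi> x *\<^sub>R W x)"
      using test_function_product_integrable[OF \<phi> open_UNIV subset_UNIV u(2)]
        test_function_gradient_product_integrable(1)[OF \<phi> open_UNIV subset_UNIV cu] by blast+
    ultimately show "(LINT x|lebesgue. u x *\<^sub>R D x) = - (LINT x|lebesgue. \<phi> x *\<^sub>R W x)"
      by (simp add: eq_neg_iff_add_eq_0)
  qed
  moreover have "locally_integrable (\<lambda>x. \<bar>u x\<bar> powr \<gamma>)" "locally_integrable (\<lambda>x. norm (W x) powr \<gamma>)"
    using assms(1) by (intro locally_integrable_continuous continuous_on_powr' continuous_intros cu u; simp)+
  moreover have "has_weak_divergence (\<lambda>x. (norm (W x) powr (\<gamma> - 2)) *\<^sub>R W x) (\<lambda>x. - f x)"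
    unfolding has_weak_divergence_def flux
  proof (intro conjI allI impI)
    show "locally_integrable (\<lambda>x. s x *\<^sub>R x)" "locally_integrable (\<lambda>x. - f x)"
      by (intro locally_integrable_continuous continuous_intros cs cf)+
    fix \<phi> :: "real^'n \<Rightarrow> real" and D assume "test_function \<phi> D"
    from integral_by_parts_radial_field[OF this open_UNIV subset_UNIV s]
    show "(LINT x|lebesgue. (s x *\<^sub>R x) \<bullet> D x) = - (LINT x|lebesgue. \<phi> x * (- f x))"
      unfolding f .
  qed
  ultimately show ?thesis
    using assms(2) cu unfolding positive_solution_def has_gamma_Laplacian_def sobolev_loc_def by blast
qed

text \<open>The power \<open>\<gamma> / (\<gamma> - 1)\<close> is the one for which the flux of the profile is a \<open>C\<^sup>1\<close> field, also at the origin.\<close>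

definition profile :: "real \<Rightarrow> real \<Rightarrow> real^'n \<Rightarrow> real" where
  "profile \<gamma> \<theta> x = (1 + norm x powr (\<gamma> / (\<gamma> - 1))) powr (- \<theta>)"

lemma gderiv_profile:
  fixes x :: "real^'n" and \<gamma> \<theta> :: real
  assumes "\<gamma> > 1"
  defines "\<gamma>' \<equiv> \<gamma> / (\<gamma> - 1)"
  defines "W \<equiv> \<lambda>x::real^'n. (- (\<theta> * \<gamma>' * (1 + norm x powr \<gamma>') powr (- \<theta> - 1))) *\<^sub>R ((norm x powr (\<gamma>' - 2)) *\<^sub>R x)"
  shows "GDERIV (profile \<gamma> \<theta>) x :> W x" and "continuous_on UNIV W"
proof -
  have g': "\<gamma>' > 1" using assms(1) by (simp add: \<gamma>'_def)
  have pos: "1 + norm x powr \<gamma>' > 0" for x :: "real^'n" by (simp add: add_pos_nonneg)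
  have "((\<lambda>t. (1 + t) powr (- \<theta>)) has_real_derivative - \<theta> * (1 + norm x powr \<gamma>') powr (- \<theta> - 1)) (at (norm x powr \<gamma>'))"
    by (rule DERIV_cong[OF DERIV_fun_powr[of "\<lambda>t. 1 + t" 1]]) (use pos in \<open>auto intro!: derivative_eq_intros\<close>)
  from GDERIV_DERIV_compose[OF gderiv_norm_powr[OF g', of x] this]
  show "GDERIV (profile \<gamma> \<theta>) x :> W x"
    by (simp add: W_def profile_def[abs_def] \<gamma>'_def mult_ac)
  have "continuous_on UNIV (\<lambda>x::real^'n. 1 + norm x powr \<gamma>')"
    using g' by (intro continuous_intros continuous_on_powr') auto
  then have "continuous_on UNIV (\<lambda>x::real^'n. (1 + norm x powr \<gamma>') powr (- \<theta> - 1))"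
    using pos by (intro continuous_on_powr continuous_on_const) (auto simp: less_imp_neq[symmetric])
  moreover have "continuous_on UNIV (\<lambda>x::real^'n. (norm x powr (\<gamma>' - 2)) *\<^sub>R x)"
    using g' by (intro continuous_norm_powr_scaleR) simp
  ultimately show "continuous_on UNIV W"
    unfolding W_def using continuous_on_scaleR[OF continuous_on_minus[OF continuous_on_mult[OF continuous_on_const]]] by blast
qed

text \<open>With \<open>t = \<bar>x\<bar> powr (\<gamma> / (\<gamma> - 1))\<close>, minus the \<open>\<gamma>\<close>-Laplacian of the profile is a constant multiple of
  \<open>(1 + t) powr (- (\<theta> + 1) * (\<gamma> - 1)) * (n - (\<theta> + 1) * \<gamma> * t / (1 + t))\<close>. The first factor is the required power of the
  other profile because of the relation between the exponents, and the second lies between two positive constants.\<close>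

lemma profile_solves:
  fixes q \<theta> \<theta>' :: real
  assumes "\<gamma> > 1" "\<theta> > 0" and decay: "\<theta>' * q = (\<theta> + 1) * (\<gamma> - 1)" and sub: "(\<theta> + 1) * \<gamma> < real CARD('n)"
  shows "\<exists>c :: real^'n \<Rightarrow> real. double_bounded c \<and> positive_solution \<gamma> (profile \<gamma> \<theta>) (\<lambda>x. c x * profile \<gamma> \<theta>' x powr q)"
proof -
  define n where "n = real CARD('n)"
  define \<gamma>' where "\<gamma>' = \<gamma> / (\<gamma> - 1)"
  have g': "\<gamma>' > 1" using assms(1) by (simp add: \<gamma>'_def)
  define K where "K = (\<theta> * \<gamma>') powr (\<gamma> - 1)"
  have K: "K > 0" using assms(2) g' by (simp add: K_def)
  define \<tau> where "\<tau> = (\<theta> + 1) * (\<gamma> - 1)"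
  define T where "T x = norm x powr \<gamma>'" for x :: "real^'n"
  have T: "T x \<ge> 0" for x by (simp add: T_def)
  define c where "c x = K * (n - (\<theta> + 1) * \<gamma> * (T x / (1 + T x)))" for x
  let ?W = "\<lambda>x::real^'n. (- (\<theta> * \<gamma>' * (1 + norm x powr \<gamma>') powr (- \<theta> - 1))) *\<^sub>R ((norm x powr (\<gamma>' - 2)) *\<^sub>R x)"
  let ?S = "\<lambda>x::real^'n. (- K) *\<^sub>R ((- (\<tau> * \<gamma>' * (1 + norm x powr \<gamma>') powr (- \<tau> - 1))) *\<^sub>R ((norm x powr (\<gamma>' - 2)) *\<^sub>R x))"
  have "positive_solution \<gamma> (profile \<gamma> \<theta>) (\<lambda>x. c x * profile \<gamma> \<theta>' x powr q)"
  proof (rule classical_positive_solution[OF assms(1), where W = ?W and s = "\<lambda>x. - K * profile \<gamma> \<tau> x" and S = ?S])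
    fix x :: "real^'n"
    have t: "1 + T x > 0" using T[of x] by simp
    show "0 < profile \<gamma> \<theta> x" using t by (simp add: profile_def T_def \<gamma>'_def)
    show "GDERIV (profile \<gamma> \<theta>) x :> ?W x" unfolding \<gamma>'_def by (rule gderiv_profile(1)[OF assms(1)])
    show "GDERIV (\<lambda>x. - K * profile \<gamma> \<tau> x) x :> ?S x"
      using GDERIV_DERIV_compose[OF gderiv_profile(1)[OF assms(1), of \<tau> x] DERIV_cmult_Id[of "- K"]]
      unfolding \<gamma>'_def .
    show "(norm (?W x) powr (\<gamma> - 2)) *\<^sub>R ?W x = (- K * profile \<gamma> \<tau> x) *\<^sub>R x"
    proof -
      let ?l = "\<theta> * \<gamma>' * (1 + norm x powr \<gamma>') powr (- \<theta> - 1)"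
      have "?l powr (\<gamma> - 1) = (\<theta> * \<gamma>') powr (\<gamma> - 1) * ((1 + norm x powr \<gamma>') powr (- \<theta> - 1)) powr (\<gamma> - 1)"
        by (rule powr_mult)
      also have "((1 + norm x powr \<gamma>') powr (- \<theta> - 1)) powr (\<gamma> - 1) = (1 + norm x powr \<gamma>') powr (- \<tau>)"
        by (simp add: powr_powr \<tau>_def algebra_simps)
      finally have l: "?l powr (\<gamma> - 1) = K * profile \<gamma> \<tau> x" by (simp add: K_def profile_def \<gamma>'_def)
      have "?l \<ge> 0" using assms(2) g' by simp
      from power_flux[OF assms(1) this, of x, folded \<gamma>'_def] show ?thesis unfolding l by simp
    qed
    have "norm x powr (\<gamma>' - 2) * (x \<bullet> x) = T x"
    proof -
      have "norm x powr (\<gamma>' - 2) * (norm x * norm x) = norm x powr \<gamma>'"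
        using powr_mult_base[of "norm x" "\<gamma>' - 2"] powr_mult_base[of "norm x" "\<gamma>' - 1"]
        by (simp add: mult_ac)
      then show ?thesis by (simp add: T_def power2_norm_eq_inner[symmetric] power2_eq_square)
    qed
    then have "?S x \<bullet> x = K * ((\<tau> * \<gamma>') * (1 + T x) powr (- \<tau> - 1)) * T x"
      by (simp add: T_def[symmetric])
    also have "\<dots> = K * (1 + T x) powr (- \<tau>) * ((\<theta> + 1) * \<gamma> * (T x / (1 + T x)))"
    proof -
      have "\<tau> * \<gamma>' = (\<theta> + 1) * \<gamma>" using assms(1) by (simp add: \<tau>_def \<gamma>'_def)
      moreover have "(1 + T x) powr (- \<tau> - 1) = (1 + T x) powr (- \<tau>) / (1 + T x)"
        using t by (simp add: powr_diff)
      ultimately show ?thesis by simp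
    qed
    finally have Sx: "?S x \<bullet> x = K * (1 + T x) powr (- \<tau>) * ((\<theta> + 1) * \<gamma> * (T x / (1 + T x)))" .
    have "profile \<gamma> \<theta>' x powr q = profile \<gamma> \<tau> x"
      using decay by (simp add: profile_def powr_powr \<tau>_def)
    then show "real CARD('n) * (- K * profile \<gamma> \<tau> x) + ?S x \<bullet> x = - (c x * profile \<gamma> \<theta>' x powr q)"
      unfolding Sx by (simp add: profile_def c_def n_def T_def \<gamma>'_def algebra_simps)
  next
    show "continuous_on UNIV ?W" unfolding \<gamma>'_def by (rule gderiv_profile(2)[OF assms(1)])
    show "continuous_on UNIV ?S"
      unfolding \<gamma>'_def by (intro continuous_on_scaleR continuous_on_const gderiv_profile(2)[OF assms(1)])
  qed
  moreover have "double_bounded c"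
  proof -
    define d where "d = n - (\<theta> + 1) * \<gamma>"
    have d: "d > 0" using sub by (simp add: d_def n_def)
    have n: "n > 0" by (simp add: n_def)
    have pos: "(\<theta> + 1) * \<gamma> \<ge> 0" using assms(1,2) by simp
    have b: "K * d \<le> c x" "c x \<le> K * n" for x
    proof -
      have "T x / (1 + T x) \<le> 1" "0 \<le> T x / (1 + T x)" using T[of x] by (auto simp: divide_le_eq_1)
      then have "(\<theta> + 1) * \<gamma> * (T x / (1 + T x)) \<le> (\<theta> + 1) * \<gamma> * 1" "0 \<le> (\<theta> + 1) * \<gamma> * (T x / (1 + T x))"
        using pos by (blast intro: mult_left_mono, blast intro: mult_nonneg_nonneg)
      then show "K * d \<le> c x" "c x \<le> K * n" unfolding c_def d_def using K by (auto intro!: mult_left_mono)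
    qed
    have "1 / max (K * n) (1 / (K * d)) \<le> K * d"
    proof -
      have "1 / max (K * n) (1 / (K * d)) \<le> 1 / (1 / (K * d))"
        using K d n by (intro divide_left_mono mult_pos_pos) (auto simp: less_max_iff_disj)
      then show ?thesis by simp
    qed
    then show ?thesis
      unfolding double_bounded_def using b K n
      by (intro exI[of _ "max (K * n) (1 / (K * d))"]) (auto simp: less_max_iff_disj le_max_iff_disj intro: order_trans)
  qed
  ultimately show ?thesis by blast
qed

section \<open>Existence and nonexistence thresholds\<close>

text \<open>The scalar equation is the case \<open>p = q\<close>, \<open>u = v\<close> of the system. The exponents \<open>\<theta>\<close> of the two profiles solve the
  linear system \<open>\<theta>' * q = (\<theta> + 1) * (\<gamma> - 1)\<close>, \<open>\<theta> * p = (\<theta>' + 1) * (\<gamma> - 1)\<close>.\<close>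

theorem corollary1p8:
  fixes \<gamma> p q n :: real
  assumes "n = real CARD('n::finite)"
    and "1 < \<gamma>" and "\<gamma> < n" and "0 < p" and "0 < q"
  shows
    "(p > n * (\<gamma> - 1) / (n - \<gamma>) \<longrightarrow>
        (\<exists>(c :: real^'n \<Rightarrow> real) u. double_bounded c \<and>
            positive_solution \<gamma> u (\<lambda>x. c x * u x powr p)))
     \<and>
     (p \<le> n * (\<gamma> - 1) / (n - \<gamma>) \<longrightarrow>
        (\<forall>c :: real^'n \<Rightarrow> real. double_bounded c \<longrightarrow>
            \<not> (\<exists>u. positive_solution \<gamma> u (\<lambda>x. c x * u x powr p) \<and> (INF x. u x) = 0)))
     \<and>
     (p * q > (\<gamma> - 1)\<^sup>2 \<and>
      max (\<gamma> * (q + \<gamma> - 1) / (p * q - (\<gamma> - 1)\<^sup>2))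
          (\<gamma> * (p + \<gamma> - 1) / (p * q - (\<gamma> - 1)\<^sup>2)) < (n - \<gamma>) / (\<gamma> - 1) \<longrightarrow>
        (\<exists>(c1 :: real^'n \<Rightarrow> real) c2 u v. double_bounded c1 \<and> double_bounded c2 \<and>
            positive_solution \<gamma> u (\<lambda>x. c1 x * v x powr q) \<and>
            positive_solution \<gamma> v (\<lambda>x. c2 x * u x powr p)))
     \<and>
     (\<forall>(c1 :: real^'n \<Rightarrow> real) c2. double_bounded c1 \<and> double_bounded c2 \<longrightarrow>
        (0 < p * q \<and> p * q \<le> (\<gamma> - 1)\<^sup>2) \<or>
        (p * q > (\<gamma> - 1)\<^sup>2 \<and>
         max (\<gamma> * (q + \<gamma> - 1) / (p * q - (\<gamma> - 1)\<^sup>2))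
             (\<gamma> * (p + \<gamma> - 1) / (p * q - (\<gamma> - 1)\<^sup>2)) \<ge> (n - \<gamma>) / (\<gamma> - 1)) \<longrightarrow>
        \<not> (\<exists>u v. positive_solution \<gamma> u (\<lambda>x. c1 x * v x powr q) \<and>
                 positive_solution \<gamma> v (\<lambda>x. c2 x * u x powr p) \<and>
                 (INF x. u x) = 0 \<and> (INF x. v x) = 0))"
proof -
  let ?\<Delta> = "p * q - (\<gamma> - 1)\<^sup>2" and ?a = "(n - \<gamma>) / (\<gamma> - 1)"
  let ?\<sigma> = "\<lambda>q D. \<gamma> * (q + \<gamma> - 1) / D" and ?\<theta> = "\<lambda>q D. (\<gamma> - 1) * (q + \<gamma> - 1) / D"
  \<comment> \<open>Powers of \<open>\<bar>x\<bar>\<close> solve the system up to constants with the decay exponents \<open>?\<sigma> q ?\<Delta>\<close> for \<open>u\<close> and \<open>?\<sigma> p ?\<Delta>\<close>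
    for \<open>v\<close>; that of the fundamental solution is \<open>?a\<close>.\<close>
  have n\<gamma>: "n - \<gamma> > 0" "\<gamma> - 1 > 0" "\<gamma> < real CARD('n)" using assms by auto
  have diff_sq: "p * p - (\<gamma> - 1)\<^sup>2 = (p - (\<gamma> - 1)) * (p + (\<gamma> - 1))" by (simp add: power2_eq_square algebra_simps)
  have crit: "p > n * (\<gamma> - 1) / (n - \<gamma>) \<longleftrightarrow> \<gamma> * (\<gamma> - 1) < (n - \<gamma>) * (p - (\<gamma> - 1))"
    using n\<gamma> by (simp add: pos_divide_less_eq algebra_simps)
  have ex: "\<exists>c :: real^'n \<Rightarrow> real. double_bounded c \<and>
      positive_solution \<gamma> (profile \<gamma> (?\<theta> q D)) (\<lambda>x. c x * profile \<gamma> (?\<theta> p D) x powr q)"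
    if D: "D = p * q - (\<gamma> - 1)\<^sup>2" "D > 0" "0 < q" and less: "?\<sigma> q D < ?a" for p q D :: real
  proof (rule profile_solves[OF assms(2)])
    show "?\<theta> q D > 0" using D(2,3) n\<gamma> by simp
    have "?\<theta> q D + 1 = q * (p + \<gamma> - 1) / D"
      using D(2) by (simp add: D(1) field_simps power2_eq_square)
    then show "?\<theta> p D * q = (?\<theta> q D + 1) * (\<gamma> - 1)" by simp
    have "(\<gamma> - 1) * ?\<sigma> q D < (\<gamma> - 1) * ?a"
      using n\<gamma> less by (intro mult_strict_left_mono)
    moreover have "(\<gamma> - 1) * ?a = n - \<gamma>" using n\<gamma>(2) by simp
    moreover have "(?\<theta> q D + 1) * \<gamma> = (\<gamma> - 1) * ?\<sigma> q D + \<gamma>"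
      by (subst distrib_right) (simp add: mult_ac)
    ultimately show "(?\<theta> q D + 1) * \<gamma> < real CARD('n)"
      using assms(1) by linarith
  qed
  have 1: "\<exists>(c :: real^'n \<Rightarrow> real) u. double_bounded c \<and> positive_solution \<gamma> u (\<lambda>x. c x * u x powr p)"
    if "p > n * (\<gamma> - 1) / (n - \<gamma>)"
  proof -
    have less: "\<gamma> * (\<gamma> - 1) < (n - \<gamma>) * (p - (\<gamma> - 1))" using that crit by simp
    have "0 < \<gamma> * (\<gamma> - 1)" using assms(2) by simp
    with less have "0 < (n - \<gamma>) * (p - (\<gamma> - 1))" by linarith
    then have p: "p - (\<gamma> - 1) > 0" using n\<gamma>(1) by (rule zero_less_mult_pos)
    then have D: "p * p - (\<gamma> - 1)\<^sup>2 > 0" unfolding diff_sq using n\<gamma>(2) assms(4) by simp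
    have "?\<sigma> p (p * p - (\<gamma> - 1)\<^sup>2) = \<gamma> / (p - (\<gamma> - 1))"
      unfolding diff_sq using p assms(4) n\<gamma>(2) by (simp add: add_diff_eq)
    also have "\<dots> < ?a"
      using less p n\<gamma> by (simp add: divide_less_eq less_divide_eq mult.commute)
    finally show ?thesis using ex[OF refl D assms(4)] by blast
  qed
  have 2: False if "p \<le> n * (\<gamma> - 1) / (n - \<gamma>)" "double_bounded c" "positive_solution \<gamma> u (\<lambda>x. c x * u x powr p)"
    for c u :: "real^'n \<Rightarrow> real"
  proof (rule no_positive_solution_pair[OF assms(2) n\<gamma>(3) assms(4,4) that(2,2,3,3)])
    show "p * p \<le> (\<gamma> - 1)\<^sup>2 \<or> p * p > (\<gamma> - 1)\<^sup>2 \<and>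
      ?\<sigma> p (p * p - (\<gamma> - 1)\<^sup>2) \<ge> (real CARD('n) - \<gamma>) / (\<gamma> - 1)"
    proof (cases "p * p \<le> (\<gamma> - 1)\<^sup>2")
      case False
      then have "(p - (\<gamma> - 1)) * (p + (\<gamma> - 1)) > 0" using diff_sq by simp
      then have p: "p - (\<gamma> - 1) > 0" using assms(4) n\<gamma>(2) by (simp add: zero_less_mult_iff)
      have "(n - \<gamma>) * (p - (\<gamma> - 1)) \<le> \<gamma> * (\<gamma> - 1)" using that(1) crit by (simp add: not_less[symmetric])
      then have "?a \<le> \<gamma> / (p - (\<gamma> - 1))"
        using p n\<gamma> by (simp add: divide_le_eq le_divide_eq mult.commute)
      also have "\<dots> = ?\<sigma> p (p * p - (\<gamma> - 1)\<^sup>2)"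
        unfolding diff_sq using p assms(4) n\<gamma>(2) by (simp add: add_diff_eq)
      finally show ?thesis using False assms(1) by simp
    qed simp
  qed
  have 3: False
    if cond: "(0 < p * q \<and> p * q \<le> (\<gamma> - 1)\<^sup>2) \<or> (p * q > (\<gamma> - 1)\<^sup>2 \<and>
         max (?\<sigma> q ?\<Delta>) (?\<sigma> p ?\<Delta>) \<ge> ?a)"
      and c: "double_bounded c1" "double_bounded c2"
      and u: "positive_solution \<gamma> u (\<lambda>x. c1 x * v x powr q)" and v: "positive_solution \<gamma> v (\<lambda>x. c2 x * u x powr p)"
    for c1 c2 u v :: "real^'n \<Rightarrow> real"
  proof -
    consider "p * q \<le> (\<gamma> - 1)\<^sup>2 \<or> p * q > (\<gamma> - 1)\<^sup>2 \<and> ?\<sigma> q ?\<Delta> \<ge> ?a"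
      | "p * q > (\<gamma> - 1)\<^sup>2 \<and> ?\<sigma> p ?\<Delta> \<ge> ?a"
      using cond unfolding le_max_iff_disj by blast
    then show False
    proof cases
      case 1
      then show False
        using no_positive_solution_pair[OF assms(2) n\<gamma>(3) assms(4,5) c u v] assms(1) by simp
    next
      case 2
      then show False
        using no_positive_solution_pair[OF assms(2) n\<gamma>(3) assms(5,4) c(2,1) v u] assms(1)
        by (simp add: mult.commute)
    qed
  qed
  have 4: "\<exists>(c1 :: real^'n \<Rightarrow> real) c2 u v. double_bounded c1 \<and> double_bounded c2 \<and>
            positive_solution \<gamma> u (\<lambda>x. c1 x * v x powr q) \<and> positive_solution \<gamma> v (\<lambda>x. c2 x * u x powr p)"
    if "p * q > (\<gamma> - 1)\<^sup>2 \<and> max (?\<sigma> q ?\<Delta>) (?\<sigma> p ?\<Delta>) < ?a"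
  proof -
    have "?\<Delta> > 0" "?\<sigma> q ?\<Delta> < ?a" "?\<sigma> p ?\<Delta> < ?a" "?\<Delta> = q * p - (\<gamma> - 1)\<^sup>2"
      using that by (simp_all only: max_less_iff_conj diff_gt_0_iff_gt mult.commute)
    from ex[OF refl this(1) assms(5) this(2)] ex[OF this(4,1) assms(4) this(3)]
    show ?thesis by blast
  qed
  show ?thesis using 1 2 3 4 by blast
qed

end
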